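(* Let $\mathcal{M}_{m\times n}$ be a 2D string and let $G_{rl}$ be a 2D RLSLP generating $\mathcal{M}_{m\times n}$. We can build in $O(|G_{rl}|)$ preprocessing time a data structure of $O(|G_{rl}|\log mn)$ bits of space which supports direct access queries to any cell $\mathcal{M}[i][j]$ in $O(\log mn \log \log \max(m,n))$ time.
   Context: A 2D string $\mathcal{M}_{m\times n}$ is an $m\times n$ matrix over a finite alphabet $\Sigma$. Horizontal concatenation, denoted here $A\oplus B$ (written in the paper with a rotated $\ominus$ symbol), places $B$ to the right of $A$ and requires equal numbers of rows; vertical concatenation $A\ominus B$ places $B$ below $A$ and requires equal numbers of columns. A 2D SLP for $\mathcal{M}$ is a context-free grammar $(V,\Sigma,R,S)$ uniquely generating $\mathcal{M}$ whose rules have the form $A\to a$ ($a\in\Sigma$), $A\to B\oplus C$ or $A\to B\ominus C$ ($B,C\in V$), with expansions $\mathtt{exp}(A)=a$, $\mathtt{exp}(B)\oplus\mathtt{exp}(C)$, $\mathtt{exp}(B)\ominus\mathtt{exp}(C)$ respectively. A 2D RLSLP additionally allows run-length rules $A\to\oplus^k B$ and $A\to\ominus^k B$ for $k>1$, whose expansion is $k$ copies of $\mathtt{exp}(B)$ concatenated horizontally (resp. vertically). The size $|G|$ of a grammar is the sum of its rule sizes: terminal rules have size 1, all other rules (including run-length rules) have size 2. *)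

theory Defs
  imports Complex_Main "Jordan_Normal_Form.Matrix"
begin

section \<open>Two-dimensional strings\<close>

text \<open>
  A 2D string is a \<^typ>\<open>nat mat\<close>: its symbols are natural numbers, so that they can be the contents
  of machine words. Rows and columns are numbered from 0. The two concatenations below are used only
  for operands with equally many rows (respectively columns).
\<close>

definition hcat :: "'a mat \<Rightarrow> 'a mat \<Rightarrow> 'a mat" where
  "hcat A B = mat (dim_row A) (dim_col A + dim_col B)
     (\<lambda>(i, j). if j < dim_col A then A $$ (i, j) else B $$ (i, j - dim_col A))"

definition vcat :: "'a mat \<Rightarrow> 'a mat \<Rightarrow> 'a mat" where
  "vcat A B = mat (dim_row A + dim_row B) (dim_col A)
     (\<lambda>(i, j). if i < dim_row A then A $$ (i, j) else B $$ (i - dim_row A, j))"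

definition hrep :: "nat \<Rightarrow> 'a mat \<Rightarrow> 'a mat" where
  "hrep k A = (hcat A ^^ (k - 1)) A"

definition vrep :: "nat \<Rightarrow> 'a mat \<Rightarrow> 'a mat" where
  "vrep k A = (vcat A ^^ (k - 1)) A"


section \<open>Run-length straight-line programs\<close>

text \<open>
  The variables of a grammar are the indices of the list of its rules, so that every variable has
  exactly one rule. The list need not be topologically sorted.
\<close>

datatype rule =
    Sym nat
  | HCat nat nat
  | VCat nat nat
  | HRun nat nat   \<comment> \<open>number of copies, then the variable\<close>
  | VRun nat nat

record grammar =
  rules :: "rule list"
  start :: nat

fun rule_ok :: "nat set \<Rightarrow> nat \<Rightarrow> rule \<Rightarrow> bool" where
  "rule_ok \<Sigma> v (Sym a) = (a \<in> \<Sigma>)"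
| "rule_ok \<Sigma> v (HCat B C) = (B < v \<and> C < v)"
| "rule_ok \<Sigma> v (VCat B C) = (B < v \<and> C < v)"
| "rule_ok \<Sigma> v (HRun k B) = (1 < k \<and> B < v)"
| "rule_ok \<Sigma> v (VRun k B) = (1 < k \<and> B < v)"

definition rlslp :: "nat set \<Rightarrow> grammar \<Rightarrow> bool" where
  "rlslp \<Sigma> G \<longleftrightarrow> start G < length (rules G) \<and>
     (\<forall>r \<in> set (rules G). rule_ok \<Sigma> (length (rules G)) r)"

text \<open>
  The relation \<open>expands G A X\<close> states that \<open>exp A\<close> is defined and equal to \<open>X\<close>; a variable has no
  expansion if its derivation is cyclic or concatenates strings whose dimensions do not match.
\<close>

inductive expands :: "grammar \<Rightarrow> nat \<Rightarrow> nat mat \<Rightarrow> bool" for G where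
  sym: "A < length (rules G) \<Longrightarrow> rules G ! A = Sym a \<Longrightarrow> expands G A (mat 1 1 (\<lambda>_. a))"
| hcat: "A < length (rules G) \<Longrightarrow> rules G ! A = HCat B C \<Longrightarrow> expands G B X \<Longrightarrow> expands G C Y \<Longrightarrow>
    dim_row X = dim_row Y \<Longrightarrow> expands G A (hcat X Y)"
| vcat: "A < length (rules G) \<Longrightarrow> rules G ! A = VCat B C \<Longrightarrow> expands G B X \<Longrightarrow> expands G C Y \<Longrightarrow>
    dim_col X = dim_col Y \<Longrightarrow> expands G A (vcat X Y)"
| hrun: "A < length (rules G) \<Longrightarrow> rules G ! A = HRun k B \<Longrightarrow> expands G B X \<Longrightarrow>
    expands G A (hrep k X)"
| vrun: "A < length (rules G) \<Longrightarrow> rules G ! A = VRun k B \<Longrightarrow> expands G B X \<Longrightarrow>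
    expands G A (vrep k X)"

lemma expands_unique: "expands G A X \<Longrightarrow> expands G A Y \<Longrightarrow> X = Y"
proof (induction arbitrary: Y rule: expands.induct)
  case (sym A a)
  from sym.prems show ?case by cases (simp_all add: sym.hyps)
next
  case outer: (hcat A B C X Z)
  from outer.prems show ?case
  proof cases
    case inner: (hcat B' C' X' Z')
    show ?thesis using inner outer.hyps outer.IH by simp
  qed (simp_all add: outer.hyps)
next
  case outer: (vcat A B C X Z)
  from outer.prems show ?case
  proof cases
    case inner: (vcat B' C' X' Z')
    show ?thesis using inner outer.hyps outer.IH by simp
  qed (simp_all add: outer.hyps)
next
  case outer: (hrun A k B X)
  from outer.prems show ?case
  proof cases
    case inner: (hrun k' B' X')
    show ?thesis using inner outer.hyps outer.IH by simp
  qed (simp_all add: outer.hyps)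
next
  case outer: (vrun A k B X)
  from outer.prems show ?case
  proof cases
    case inner: (vrun k' B' X')
    show ?thesis using inner outer.hyps outer.IH by simp
  qed (simp_all add: outer.hyps)
qed

definition generates :: "grammar \<Rightarrow> nat mat \<Rightarrow> bool" where
  "generates G M \<longleftrightarrow> expands G (start G) M"

fun rule_size :: "rule \<Rightarrow> nat" where
  "rule_size (Sym a) = 1"
| "rule_size (HCat B C) = 2"
| "rule_size (VCat B C) = 2"
| "rule_size (HRun k B) = 2"
| "rule_size (VRun k B) = 2"

definition gsize :: "grammar \<Rightarrow> nat" where
  "gsize G = (\<Sum>r\<leftarrow>rules G. rule_size r)"


section \<open>The word RAM\<close>

text \<open>
  A word RAM with \<open>w\<close>-bit words, programmed in a structured language. A word is a natural number
  below \<open>2 ^ w\<close>; all arithmetic is modulo \<open>2 ^ w\<close>. A program mentions a fixed finite number of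
  registers, and each arithmetic operation, memory access, test or assignment takes one time unit.
\<close>

datatype binop = Add | Sub | Mul | Div | Mod | And | Or | Xor | Shl | Shr | Eq | Less

datatype exp = Const nat | Reg nat | Load exp | Bin binop exp exp

datatype com =
    Skip
  | Assign nat exp
  | Store exp exp   \<comment> \<open>address, then value\<close>
  | Seq com com
  | Cond exp com com
  | While exp com

record state =
  reg :: "nat \<Rightarrow> nat"
  mem :: "nat \<Rightarrow> nat"

definition word_state :: "nat \<Rightarrow> state \<Rightarrow> bool" where
  "word_state w s \<longleftrightarrow> (\<forall>r. reg s r < 2 ^ w) \<and> (\<forall>a. mem s a < 2 ^ w)"

fun binop_val :: "nat \<Rightarrow> binop \<Rightarrow> nat \<Rightarrow> nat \<Rightarrow> nat" where
  "binop_val w Add x y = (x + y) mod 2 ^ w"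
| "binop_val w Sub x y = (2 ^ w + x - y) mod 2 ^ w"
| "binop_val w Mul x y = (x * y) mod 2 ^ w"
| "binop_val w Div x y = x div y"
| "binop_val w Mod x y = x mod y"
| "binop_val w And x y = semiring_bit_operations_class.and x y"
| "binop_val w Or x y = semiring_bit_operations_class.or x y"
| "binop_val w Xor x y = semiring_bit_operations_class.xor x y"
| "binop_val w Shl x y = (x * 2 ^ y) mod 2 ^ w"
| "binop_val w Shr x y = x div 2 ^ y"
| "binop_val w Eq x y = of_bool (x = y) mod 2 ^ w"
| "binop_val w Less x y = of_bool (x < y) mod 2 ^ w"

fun exp_val :: "nat \<Rightarrow> exp \<Rightarrow> state \<Rightarrow> nat" where
  "exp_val w (Const k) s = k mod 2 ^ w"
| "exp_val w (Reg r) s = reg s r"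
| "exp_val w (Load e) s = mem s (exp_val w e s)"
| "exp_val w (Bin f e e') s = binop_val w f (exp_val w e s) (exp_val w e' s)"

fun exp_time :: "exp \<Rightarrow> nat" where
  "exp_time (Const k) = 1"
| "exp_time (Reg r) = 1"
| "exp_time (Load e) = 1 + exp_time e"
| "exp_time (Bin f e e') = 1 + exp_time e + exp_time e'"

text \<open>
  The relation \<open>exec w p s t s'\<close> states that program \<open>p\<close>, started in state \<open>s\<close>, halts in state \<open>s'\<close>
  after \<open>t\<close> time units.
\<close>

inductive exec :: "nat \<Rightarrow> com \<Rightarrow> state \<Rightarrow> nat \<Rightarrow> state \<Rightarrow> bool" for w where
  skip: "exec w Skip s 1 s"
| assign: "exec w (Assign r e) s (1 + exp_time e) (s\<lparr>reg := (reg s)(r := exp_val w e s)\<rparr>)"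
| store: "exec w (Store e e') s (1 + exp_time e + exp_time e')
    (s\<lparr>mem := (mem s)(exp_val w e s := exp_val w e' s)\<rparr>)"
| seq: "exec w p s t s' \<Longrightarrow> exec w q s' t' s'' \<Longrightarrow> exec w (Seq p q) s (t + t') s''"
| cond_true: "exp_val w e s \<noteq> 0 \<Longrightarrow> exec w p s t s' \<Longrightarrow> exec w (Cond e p q) s (1 + exp_time e + t) s'"
| cond_false: "exp_val w e s = 0 \<Longrightarrow> exec w q s t s' \<Longrightarrow> exec w (Cond e p q) s (1 + exp_time e + t) s'"
| while_false: "exp_val w e s = 0 \<Longrightarrow> exec w (While e p) s (1 + exp_time e) s"
| while_true: "exp_val w e s \<noteq> 0 \<Longrightarrow> exec w p s t s' \<Longrightarrow> exec w (While e p) s' t' s'' \<Longrightarrow>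
    exec w (While e p) s (1 + exp_time e + t + t') s''"


section \<open>Input, output and queries\<close>

fun encode_rule :: "rule \<Rightarrow> nat list" where
  "encode_rule (Sym a) = [0, a, 0]"
| "encode_rule (HCat B C) = [1, B, C]"
| "encode_rule (VCat B C) = [2, B, C]"
| "encode_rule (HRun k B) = [3, k, B]"
| "encode_rule (VRun k B) = [4, k, B]"

definition encode :: "grammar \<Rightarrow> nat list" where
  "encode G = concat (map encode_rule (rules G))"

text \<open>
  Preprocessing starts with the encoded rules in memory from address 0 on, and with the number of
  variables and the start variable in registers 0 and 1; everything else is 0.
\<close>

definition input_state :: "grammar \<Rightarrow> state" where
  "input_state G = \<lparr>reg = (\<lambda>_. 0)(0 := length (rules G), 1 := start G),
     mem = (\<lambda>a. if a < length (encode G) then encode G ! a else 0)\<rparr>"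

text \<open>
  When preprocessing halts, registers 0 and 1 hold the address and the length of the block of memory
  cells that is the data structure; the remaining memory is discarded.
\<close>

definition built_structure :: "state \<Rightarrow> nat list" where
  "built_structure s = map (mem s) [reg s 0 ..< reg s 0 + reg s 1]"

text \<open>
  The space of a data structure is that of an array of cells of one common width, the least one
  (but at least one bit) in which all its entries fit. This width may be smaller than the word size.
\<close>

definition cell_width :: "nat list \<Rightarrow> nat" where
  "cell_width D = (LEAST b. 1 \<le> b \<and> (\<forall>x \<in> set D. x < 2 ^ b))"

definition space_bits :: "nat list \<Rightarrow> nat" where
  "space_bits D = length D * cell_width D"

text \<open>
  A query is run with the data structure in memory from address 0 on and the cell's row and column in
  registers 0 and 1; it leaves the symbol in register 0. Nothing is assumed about the rest of the
  state and the data structure has to be left intact, so any sequence of queries can be answered.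
\<close>

definition answers_access :: "nat \<Rightarrow> com \<Rightarrow> nat list \<Rightarrow> nat mat \<Rightarrow> real \<Rightarrow> bool" where
  "answers_access w query D M T \<longleftrightarrow>
     (\<forall>i < dim_row M. \<forall>j < dim_col M. \<forall>s.
        word_state w s \<and> (\<forall>a < length D. mem s a = D ! a) \<and> reg s 0 = i \<and> reg s 1 = j \<longrightarrow>
        (\<exists>t s'. exec w query s t s' \<and> real t \<le> T \<and> reg s' 0 = M $$ (i, j) \<and>
           (\<forall>a < length D. mem s' a = D ! a)))"

text \<open>
  Logarithms in bounds are at least 1, as \<open>log (m * n)\<close> and \<open>log (log (max m n))\<close> would otherwise be
  0, negative or undefined for small \<open>m\<close> and \<open>n\<close>.
\<close>

definition lg :: "real \<Rightarrow> real" where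
  "lg x = max 1 (log 2 x)"

end

(*
Collapse every run to a single edge and let rho(v) be the number of paths from the start variable
to v; the collapsed derivation tree has fewer than 2mn nodes, so rho <= 2mn. Call an edge v -> u of a
concatenation rule symmetric if area and rho have the same floor of the binary logarithm at v and
at u. Every variable has at most one symmetric edge in and one out, so these edges form disjoint
paths, and a descent from the start variable uses O(log mn) other edges.

To skip along a path, give v the highest bit in which the areas of v and of its successor differ as
its priority (at the end of the path, the highest bit of the area). From v, look only at the chain of
those variables on the path that have a larger priority than all variables between: it has O(log mn)
elements, is computed for all v in linear time with a stack, as in the computation of next larger
elements, and every variable stores its successor on the chain together with a skew-binary jump
pointer (Myers). The variables of a path whose expansion covers the queried cell form a prefix of
it, so O(log log mn) chain steps lead to the last chain element that covers the cell. The next step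
goes to a child. If it stays on the path, the largest priority b of a chain element that covers the
cell drops; if it leaves the path, the child has area below 2^(b+1), because the area lost in a step
of priority b is less than that. So b plus the level of v, floor log(area) plus
floor log(2mn) minus floor log(rho), is a potential that drops with every step to a child; it is
O(log mn).
*)
theory Submission
  imports Defs "HOL-Library.Discrete_Functions"
begin

section \<open>Binary logarithms and skew-binary numbers\<close>

text \<open>A symmetric path can have on the order of \<open>max m n\<close> variables, so jumps
  over the whole path would cost \<open>log (max m n)\<close> each time instead of
  \<open>log log\<close>. Searching only the chain avoids this, at the price that the search ends at
  the last covering chain element, which need not be the last covering variable; the potential must
  therefore also drop when the next step stays on the path.

  The space bound has the factor \<open>log mn\<close>, whereas the number of rules, with
  unreachable variables among them, is not bounded in terms of \<open>mn\<close>. Records are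
  therefore made for reachable variables only and numbered by topological position. The node count
  that bounds \<open>rho\<close> also bounds the number of reachable variables, so an address has
  \<open>O(log mn)\<close> bits. The repetition count of a run is not stored, since a query only
  needs a remainder modulo the size of one copy.

  The machine has no logarithm instruction. Levels and priorities are compared through one bitwise
  test on the numbers themselves, so preprocessing never computes a
  \<open>floor_log\<close>.\<close>

lemma floor_log_div_power:
  assumes "x > 0"
  shows "x div 2 ^ floor_log x = 1"
proof -
  have "2 ^ floor_log x \<le> x" "x < 2 * 2 ^ floor_log x"
    using assms floor_log_exp2_le floor_log_exp2_gt by blast+
  then show ?thesis by (intro div_nat_eqI) simp_all
qed

lemma floor_log_less_power: "floor_log x < b \<Longrightarrow> x < 2 ^ b"
proof -
  assume "floor_log x < b"
  then have "(2::nat) ^ Suc (floor_log x) \<le> 2 ^ b" by (intro power_increasing) simp_all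
  then show ?thesis using floor_log_exp2_gt [of x] by simp
qed

lemma floor_log_le_of_less_power: "x < 2 ^ Suc b \<Longrightarrow> floor_log x \<le> b"
proof (cases "x = 0")
  case False
  assume "x < 2 ^ Suc b"
  moreover have "2 ^ floor_log x \<le> x" using False floor_log_exp2_le by simp
  ultimately have "(2::nat) ^ floor_log x < 2 ^ Suc b" by linarith
  then show ?thesis by (simp add: power_strict_increasing_iff del: power_Suc)
qed simp

lemma xor_div_power: "semiring_bit_operations_class.xor a b div 2 ^ k =
    semiring_bit_operations_class.xor (a div 2 ^ k) (b div (2::nat) ^ k)"
  by (metis drop_bit_eq_div drop_bit_xor)

lemma and_div_power: "semiring_bit_operations_class.and a b div 2 ^ k =
    semiring_bit_operations_class.and (a div 2 ^ k) (b div (2::nat) ^ k)"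
  by (metis drop_bit_eq_div drop_bit_and)

text \<open>A shared top bit cancels in the xor and survives in the and; if the top bits differ, the
  higher one survives only in the xor. This decides equality of \<open>floor_log\<close> in constant
  time.\<close>

lemma xor_less_and_iff:
  fixes a b :: nat
  assumes "a > 0" "b > 0"
  shows "semiring_bit_operations_class.xor a b < semiring_bit_operations_class.and a b
    \<longleftrightarrow> floor_log a = floor_log b"
proof -
  let ?x = "semiring_bit_operations_class.xor" and ?a = "semiring_bit_operations_class.and"
  have lt: "\<not> ?x a b < ?a a b \<and> \<not> ?x b a < ?a b a" if "a > 0" "b > 0" "floor_log a < floor_log b" for a b :: nat
  proof -
    let ?k = "floor_log b"
    have "a div 2 ^ ?k = 0" "b div 2 ^ ?k = 1"
      using that floor_log_less_power floor_log_div_power by auto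
    then have "?x a b div 2 ^ ?k = 1" "?x b a div 2 ^ ?k = 1" "?a a b div 2 ^ ?k = 0" "?a b a div 2 ^ ?k = 0"
      by (simp_all add: xor_div_power and_div_power)
    then show ?thesis by (metis div_le_mono less_imp_le not_one_le_zero)
  qed
  have "?x a b < ?a a b" if eq: "floor_log a = floor_log b"
  proof -
    have "a div 2 ^ floor_log a = 1" "b div 2 ^ floor_log a = 1"
      using assms floor_log_div_power [of a] floor_log_div_power [of b] eq by auto
    then have "?x a b div 2 ^ floor_log a = 0" "?a a b div 2 ^ floor_log a = 1"
      by (simp_all add: xor_div_power and_div_power)
    then show ?thesis by (metis div_le_mono linorder_not_less not_one_le_zero)
  qed
  then show ?thesis using lt assms by (metis linorder_neqE_nat)
qed

lemma xor_pos: "a \<noteq> b \<Longrightarrow> semiring_bit_operations_class.xor a b > (0::nat)"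
  by (metis bit_xor_iff bit_eq_iff bit_0_eq bot_apply bot_bool_def gr0I)

text \<open>Shifting by \<open>Suc k\<close> clears the xor and shifting by \<open>k\<close> leaves
  a single 1, so \<open>k\<close> is the highest position where the numbers differ, and the larger
  number has the 1 there. Applied to the areas at the two ends of a symmetric edge.\<close>

lemma top_differing_bit:
  fixes a b :: nat
  assumes "b < a"
  defines "k \<equiv> floor_log (semiring_bit_operations_class.xor a b)"
  shows "a div 2 ^ Suc k = b div 2 ^ Suc k" and "odd (a div 2 ^ k)" and "even (b div 2 ^ k)"
proof -
  let ?x = "semiring_bit_operations_class.xor"
  have "?x a b > 0" using assms by (intro xor_pos) simp
  then have k: "?x a b div 2 ^ k = 1" unfolding k_def by (rule floor_log_div_power)
  have "?x a b < 2 ^ Suc k" unfolding k_def by (simp add: floor_log_exp2_gt)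
  then have "?x a b div 2 ^ Suc k = 0" by simp
  then have "?x (a div 2 ^ Suc k) (b div 2 ^ Suc k) = 0" by (simp only: xor_div_power)
  then show e: "a div 2 ^ Suc k = b div 2 ^ Suc k" using xor_pos by fastforce
  have x1: "?x (a div 2 ^ k) (b div 2 ^ k) = 1" using k by (simp only: xor_div_power)
  then have "odd (?x (a div 2 ^ k) (b div 2 ^ k))" by simp
  then have o: "odd (a div 2 ^ k) \<noteq> odd (b div 2 ^ k)" by (simp add: even_xor_iff)
  have le: "b div 2 ^ k \<le> a div 2 ^ k" using assms by (intro div_le_mono) simp
  have "a div 2 ^ k div 2 = b div 2 ^ k div 2" using e
    by (simp only: power_Suc2 div_mult2_eq)
  moreover have "odd x \<and> even y" if "x div 2 = y div 2" "odd x \<noteq> odd y" "y \<le> x" for x y :: nat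
    using that by presburger
  ultimately have "odd (a div 2 ^ k) \<and> even (b div 2 ^ k)" using o le by blast
  then show "odd (a div 2 ^ k)" "even (b div 2 ^ k)" by simp_all
qed

text \<open>Skew-binary numbers: the digit list of \<open>d\<close> consists of the exponents \<open>a\<close> of its summands
  \<open>2 ^ a - 1\<close>, least first; only the first two may be equal.\<close>

fun skew :: "nat \<Rightarrow> nat list" where
  "skew 0 = []"
| "skew (Suc d) = (case skew d of a # b # r \<Rightarrow> if a = b then Suc a # r else 1 # a # b # r | r \<Rightarrow> 1 # r)"

fun skew_valid :: "nat list \<Rightarrow> bool" where
  "skew_valid [] = True"
| "skew_valid [a] = (1 \<le> a)"
| "skew_valid (a # b # r) = (1 \<le> a \<and> a \<le> b \<and> sorted_wrt (<) (b # r))"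

fun mersenne :: "nat \<Rightarrow> nat" where
  "mersenne 0 = 0"
| "mersenne (Suc a) = Suc (2 * mersenne a)"

lemma mersenne_inject [simp]: "mersenne a = mersenne b \<longleftrightarrow> a = b"
proof (induction a arbitrary: b)
  case 0
  then show ?case by (cases b) auto
next
  case (Suc a)
  then show ?case by (cases b) auto
qed

lemma mersenne_pos: "1 \<le> a \<Longrightarrow> 1 \<le> mersenne a"
  by (cases a) auto

lemma Suc_mersenne: "Suc (mersenne a) = 2 ^ a"
  by (induction a) auto

definition skew_val :: "nat list \<Rightarrow> nat" where
  "skew_val r = (\<Sum>a\<leftarrow>r. mersenne a)"

lemma skew_val_simps [simp]: "skew_val [] = 0" "skew_val (a # r) = mersenne a + skew_val r"
  by (simp_all add: skew_val_def)

lemma skew_valid_skew: "skew_valid (skew d)"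
proof (induction d)
  case (Suc d)
  show ?case
  proof (cases "skew d" rule: skew_valid.cases)
    case (3 a b r)
    with Suc show ?thesis by (cases r) auto
  qed (use Suc in auto)
qed simp

lemma skew_val_skew [simp]: "skew_val (skew d) = d"
proof (induction d)
  case (Suc d)
  then show ?case by (cases "skew d" rule: skew_valid.cases) auto
qed simp

lemma skew_valid_tl: "skew_valid r \<Longrightarrow> skew_valid (tl r)"
proof (cases r rule: skew_valid.cases)
  case (3 a b r')
  assume "skew_valid r"
  with 3 show ?thesis by (cases r') auto
qed auto

text \<open>Uniqueness of the representation, by undoing one increment: a least digit 1 is dropped,
  and a larger least digit splits into two equal digits smaller by one, which gives the
  representation of the predecessor.\<close>

lemma skew_skew_val: "skew_valid r \<Longrightarrow> skew (skew_val r) = r"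
proof (induction "skew_val r" arbitrary: r rule: less_induct)
  case less
  show ?case
  proof (cases r)
    case (Cons a r')
    have a1: "1 \<le> a" using less.prems Cons by (cases r') auto
    have v': "skew_valid r'" using skew_valid_tl [OF less.prems] Cons by simp
    show ?thesis
    proof (cases "a = 1")
      case True
      then have "skew (skew_val r') = r'" using less Cons v' by simp
      with Cons True less.prems show ?thesis by (auto split: list.splits)
    next
      case False
      then obtain b where b: "a = Suc b" "1 \<le> b" using a1 by (cases a) auto
      have e: "skew_val r = Suc (skew_val (b # b # r'))" using Cons b by simp
      have "skew_valid (b # b # r')" using less.prems Cons b by (cases r' rule: skew_valid.cases) auto
      moreover have "skew_val (b # b # r') < skew_val r" using e by simp
      ultimately have "skew (skew_val (b # b # r')) = b # b # r'" using less.hyps by blast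
      then have "skew (Suc (skew_val (b # b # r'))) = Suc b # r'" by (simp del: skew_val_simps)
      then show ?thesis using e Cons b by metis
    qed
  qed simp
qed

text \<open>Myers' rule: the pointer at depth \<open>d\<close> skips the least summand of the
  skew-binary form of \<open>d\<close>, so repeated jumps remove its digits one by one.\<close>

definition jump_depth :: "nat \<Rightarrow> nat" where
  "jump_depth d = skew_val (tl (skew d))"

lemma skew_jump_depth: "skew (jump_depth d) = tl (skew d)"
  unfolding jump_depth_def by (intro skew_skew_val skew_valid_tl skew_valid_skew)

lemma jump_depth_0 [simp]: "jump_depth 0 = 0"
  by (simp add: jump_depth_def)

lemma skew_Cons:
  assumes "skew d = a # r"
  shows "d = mersenne a + jump_depth d" "jump_depth d = skew_val r" "1 \<le> a"
proof -
  have "skew_val (skew d) = skew_val (a # r)" by (simp only: assms)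
  then have "d = mersenne a + skew_val r" by (simp only: skew_val_skew skew_val_simps)
  then show "d = mersenne a + jump_depth d" unfolding jump_depth_def assms list.sel .
  show "jump_depth d = skew_val r" by (simp add: jump_depth_def assms)
  have "skew_valid (a # r)" using skew_valid_skew [of d] assms by simp
  then show "1 \<le> a" by (cases r) auto
qed

lemma jump_depth_less: "0 < d \<Longrightarrow> jump_depth d < d"
proof (cases "skew d")
  case (Cons a r)
  then show ?thesis using skew_Cons(1,3) [OF Cons] mersenne_pos [of a] by linarith
qed (use skew_val_skew [of d] in auto)

lemma jump_depth_le: "jump_depth d \<le> d"
  using jump_depth_less [of d] by (cases "d = 0") auto

text \<open>Two equal least digits mean two consecutive jumps of equal length, and then the
  increment merges them; for \<open>d = 0\<close> both branches give 0. The rule mentions depths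
  only, so jump pointers can be computed without representing skew-binary numbers.\<close>

lemma jump_depth_Suc:
  "jump_depth (Suc d) = (if d - jump_depth d = jump_depth d - jump_depth (jump_depth d)
     then jump_depth (jump_depth d) else d)"
proof (cases "skew d" rule: skew_valid.cases)
  case 1
  then have "d = 0" using skew_val_skew [of d] by simp
  then show ?thesis by (simp add: jump_depth_def)
next
  case (2 a)
  have "jump_depth d = 0" using 2 by (simp add: jump_depth_def)
  moreover have "d \<noteq> 0" using 2 by (metis list.distinct(1) skew.simps(1))
  moreover have "jump_depth (Suc d) = skew_val (skew d)" using 2 by (simp add: jump_depth_def)
  ultimately show ?thesis by simp
next
  case (3 a b r)
  have j: "skew (jump_depth d) = b # r" using 3 skew_jump_depth by simp
  have "d - jump_depth d = mersenne a" using skew_Cons(1) [OF 3] by linarith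
  moreover have "jump_depth d - jump_depth (jump_depth d) = mersenne b" using skew_Cons(1) [OF j] by linarith
  moreover have "jump_depth (Suc d) = (if a = b then skew_val r else skew_val (skew d))"
    using 3 by (simp add: jump_depth_def)
  ultimately show ?thesis using skew_Cons(2) [OF j] by simp
qed

section \<open>Number of steps of the greedy descent with jump pointers\<close>

function jump_steps :: "nat \<Rightarrow> nat \<Rightarrow> nat" where
  "jump_steps d t = (if d \<le> t then 0 else if t \<le> jump_depth d then Suc (jump_steps (jump_depth d) t)
     else Suc (jump_steps (d - 1) t))"
  by auto
termination by (relation "measure fst") (auto simp: jump_depth_less)

declare jump_steps.simps [simp del]

text \<open>When the jump would overshoot, a single step turns the least digit \<open>a\<close> into
  two digits \<open>a - 1\<close>. At most one of them is jumped over, and the target then lies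
  within the span of the other, so each unit of \<open>a\<close> costs at most two steps.\<close>

lemma jump_steps_descend:
  assumes "skew d = a # r" "jump_depth d < t" "t \<le> d"
  shows "jump_steps d t \<le> 2 * (a - 1)"
  using assms
proof (induction a arbitrary: d r)
  case 0
  then show ?case using skew_Cons(3) [OF 0(1)] by simp
next
  case (Suc a)
  show ?case
  proof (cases "t = d")
    case True
    then show ?thesis by (subst jump_steps.simps) simp
  next
    case False
    have a: "1 \<le> a"
    proof (rule ccontr)
      assume "\<not> 1 \<le> a"
      then have "mersenne (Suc a) = 1" by (cases a) auto
      then show False using skew_Cons(1) [OF Suc.prems(1)] Suc.prems False by linarith
    qed
    have v: "skew_valid (a # a # r)"
      using skew_valid_skew [of d] Suc.prems(1) a by (cases r rule: skew_valid.cases) auto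
    have "d - 1 = skew_val (a # a # r)" using skew_val_skew [of d] Suc.prems(1) by simp
    then have s: "skew (d - 1) = a # a # r" using skew_skew_val [OF v] by simp
    have s': "skew (jump_depth (d - 1)) = a # r" using s skew_jump_depth by simp
    have st: "jump_steps d t = Suc (jump_steps (d - 1) t)"
      using False Suc.prems by (simp add: jump_steps.simps [of d])
    show ?thesis
    proof (cases "t \<le> jump_depth (d - 1)")
      case True
      have "jump_steps (jump_depth (d - 1)) t \<le> 2 * (a - 1)"
        using skew_Cons(2) [OF s'] skew_Cons(2) [OF Suc.prems(1)] Suc.prems True
        by (intro Suc.IH [OF s']) auto
      moreover have "jump_steps (d - 1) t \<le> Suc (jump_steps (jump_depth (d - 1)) t)"
        using True by (subst jump_steps.simps) auto
      ultimately show ?thesis using st a by simp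
    next
      case False
      have "jump_steps (d - 1) t \<le> 2 * (a - 1)"
        using False \<open>t \<noteq> d\<close> Suc.prems by (intro Suc.IH [OF s]) auto
      then show ?thesis using st a by simp
    qed
  qed
qed

text \<open>Jumps that do not overshoot each remove a digit. The first refused jump starts the
  descent of \<open>jump_steps_descend\<close>, whose digit is at most the last one.\<close>

lemma jump_steps_le_last:
  "t \<le> d \<Longrightarrow> 0 < d \<Longrightarrow> jump_steps d t \<le> length (skew d) + 2 * last (skew d)"
proof (induction d rule: less_induct)
  case (less d)
  obtain a r where s: "skew d = a # r" using less.prems skew_val_skew [of d] by (cases "skew d") auto
  have s': "skew (jump_depth d) = r" using s skew_jump_depth by simp
  show ?case
  proof (cases "t \<le> jump_depth d")
    case False
    have "a \<le> last (skew d)" using skew_valid_skew [of d] s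
      by (cases r) (auto simp: last_conv_nth less_imp_le intro: order_trans)
    moreover have "jump_steps d t \<le> 2 * (a - 1)"
      using jump_steps_descend [OF s] False less.prems by simp
    ultimately show ?thesis by linarith
  next
    case True
    show ?thesis
    proof (cases "jump_depth d = 0")
      case z: True
      have "jump_steps d t \<le> 1" using True z by (subst jump_steps.simps) (auto simp: jump_steps.simps [of 0])
      then show ?thesis using s by simp
    next
      case False
      have "jump_steps (jump_depth d) t \<le> length r + 2 * last r"
        using less.IH [OF jump_depth_less True] less.prems False s' by simp
      moreover have "r \<noteq> []" using False s by (auto simp: jump_depth_def)
      moreover have "jump_steps d t \<le> Suc (jump_steps (jump_depth d) t)"
        using True by (subst jump_steps.simps) auto
      ultimately show ?thesis using s by simp
    qed
  qed
qed

lemma sorted_wrt_length_le_last: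
  "sorted_wrt (<) r \<Longrightarrow> r \<noteq> [] \<Longrightarrow> \<forall>x \<in> set r. 1 \<le> x \<Longrightarrow> length r \<le> (last r :: nat)"
proof (induction r rule: rev_induct)
  case (snoc x r)
  show ?case
  proof (cases "r = []")
    case False
    then have "last r < x" using snoc.prems by (simp add: sorted_wrt_append)
    moreover have "length r \<le> last r" using snoc False by (simp add: sorted_wrt_append)
    ultimately show ?thesis by simp
  qed (use snoc in auto)
qed simp

text \<open>Apart from the first, the digits are positive and strictly increasing, so there are at
  most one more of them than the value of the last digit; the last summand is at most
  \<open>d\<close>, which makes that digit logarithmic. The factor 3 is one for the removed digits
  and two for the descent.\<close>

lemma jump_steps_le:
  assumes "t \<le> d"
  shows "jump_steps d t \<le> 3 * floor_log (Suc d) + 1"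
proof (cases "d = 0")
  case False
  then obtain a r where s: "skew d = a # r" using skew_val_skew [of d] by (cases "skew d") auto
  let ?l = "last (skew d)"
  have "mersenne x \<le> skew_val r'" if "x \<in> set r'" for x r'
    using that by (induction r') auto
  then have "mersenne ?l \<le> d" using s skew_val_skew [of d] last_in_set [of "skew d"] by (metis list.distinct(1))
  then have "2 ^ ?l \<le> Suc d" by (simp flip: Suc_mersenne)
  then have l: "?l \<le> floor_log (Suc d)" using floor_log_le_iff [of "2 ^ ?l" "Suc d"] by simp
  have "length (skew d) \<le> Suc ?l"
  proof (cases r)
    case (Cons b r')
    have "\<forall>x \<in> set r. b \<le> x" "1 \<le> b" "sorted_wrt (<) r" using skew_valid_skew [of d] s Cons by auto
    then have "length r \<le> last r" using Cons by (intro sorted_wrt_length_le_last) auto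
    then show ?thesis using s Cons by simp
  qed (use s in simp)
  then show ?thesis using jump_steps_le_last [OF assms] False l by simp
qed (simp add: jump_steps.simps [of 0])

section \<open>Expansions of the variables\<close>

lemma dim_hcat [simp]: "dim_row (hcat A B) = dim_row A" "dim_col (hcat A B) = dim_col A + dim_col B"
  and dim_vcat [simp]: "dim_row (vcat A B) = dim_row A + dim_row B" "dim_col (vcat A B) = dim_col A"
  by (simp_all add: hcat_def vcat_def)

lemma index_hcat: "i < dim_row A \<Longrightarrow> j < dim_col A + dim_col B \<Longrightarrow>
    hcat A B $$ (i, j) = (if j < dim_col A then A $$ (i, j) else B $$ (i, j - dim_col A))"
  by (simp add: hcat_def)

lemma index_vcat: "i < dim_row A + dim_row B \<Longrightarrow> j < dim_col A \<Longrightarrow>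
    vcat A B $$ (i, j) = (if i < dim_row A then A $$ (i, j) else B $$ (i - dim_row A, j))"
  by (simp add: vcat_def)

lemma dim_hrep: "dim_row (hrep k A) = dim_row A" "0 < k \<Longrightarrow> dim_col (hrep k A) = k * dim_col A"
proof -
  have *: "dim_row ((hcat A ^^ n) A) = dim_row A \<and> dim_col ((hcat A ^^ n) A) = Suc n * dim_col A" for n
    by (induction n) auto
  show "dim_row (hrep k A) = dim_row A" using * by (simp add: hrep_def)
  show "0 < k \<Longrightarrow> dim_col (hrep k A) = k * dim_col A" using * [of "k - 1"] by (simp add: hrep_def)
qed

lemma dim_vrep: "dim_col (vrep k A) = dim_col A" "0 < k \<Longrightarrow> dim_row (vrep k A) = k * dim_row A"
proof -
  have *: "dim_col ((vcat A ^^ n) A) = dim_col A \<and> dim_row ((vcat A ^^ n) A) = Suc n * dim_row A" for n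
    by (induction n) auto
  show "dim_col (vrep k A) = dim_col A" using * by (simp add: vrep_def)
  show "0 < k \<Longrightarrow> dim_row (vrep k A) = k * dim_row A" using * [of "k - 1"] by (simp add: vrep_def)
qed

lemma index_hrep:
  assumes "i < dim_row A" "j < k * dim_col A"
  shows "hrep k A $$ (i, j) = A $$ (i, j mod dim_col A)"
proof -
  have "(hcat A ^^ n) A $$ (i, j) = A $$ (i, j mod dim_col A)" if "j < Suc n * dim_col A" for n j
    using that
  proof (induction n arbitrary: j)
    case (Suc n)
    have "hrep (Suc n) A = (hcat A ^^ n) A" by (simp add: hrep_def)
    then have d: "dim_row ((hcat A ^^ n) A) = dim_row A" "dim_col ((hcat A ^^ n) A) = Suc n * dim_col A"
      using dim_hrep [where k = "Suc n" and A = A] by auto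
    show ?case
    proof (cases "j < dim_col A")
      case True
      then show ?thesis using assms d by (simp add: index_hcat)
    next
      case False
      then show ?thesis using assms d Suc.prems Suc.IH [of "j - dim_col A"]
        by (simp add: index_hcat le_mod_geq)
    qed
  qed simp
  moreover obtain n where "k = Suc n" using assms by (cases k) auto
  ultimately show ?thesis using assms by (simp add: hrep_def)
qed

lemma index_vrep:
  assumes "j < dim_col A" "i < k * dim_row A"
  shows "vrep k A $$ (i, j) = A $$ (i mod dim_row A, j)"
proof -
  have "(vcat A ^^ n) A $$ (i, j) = A $$ (i mod dim_row A, j)" if "i < Suc n * dim_row A" for n i
    using that
  proof (induction n arbitrary: i)
    case (Suc n)
    have "vrep (Suc n) A = (vcat A ^^ n) A" by (simp add: vrep_def)
    then have d: "dim_col ((vcat A ^^ n) A) = dim_col A" "dim_row ((vcat A ^^ n) A) = Suc n * dim_row A"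
      using dim_vrep [where k = "Suc n" and A = A] by auto
    show ?case
    proof (cases "i < dim_row A")
      case True
      then show ?thesis using assms d by (simp add: index_vcat)
    next
      case False
      then show ?thesis using assms d Suc.prems Suc.IH [of "i - dim_row A"]
        by (simp add: index_vcat le_mod_geq)
    qed
  qed simp
  moreover obtain n where "k = Suc n" using assms by (cases k) auto
  ultimately show ?thesis using assms by (simp add: vrep_def)
qed

lemma expands_dim_pos: "expands G v X \<Longrightarrow> 0 < dim_row X \<and> 0 < dim_col X"
proof (induction rule: expands.induct)
  case (hrun A k B X)
  then show ?case using dim_hrep [of k X] by (cases "k = 0") (auto simp: hrep_def)
next
  case (vrun A k B X)
  then show ?case using dim_vrep [of k X] by (cases "k = 0") (auto simp: vrep_def)
qed auto

text \<open>The second operand comes first because it shares an input word with the operand of a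
  run: a traversal reads this word for every nonterminal rule and the other one only for
  concatenations. A run contributes a single edge.\<close>

fun kids :: "rule \<Rightarrow> nat list" where
  "kids (Sym a) = []"
| "kids (HCat B C) = [C, B]"
| "kids (VCat B C) = [C, B]"
| "kids (HRun k B) = [B]"
| "kids (VRun k B) = [B]"

section \<open>Dimensions and areas of the reachable variables\<close>

locale slp2d =
  fixes \<Sigma> :: "nat set" and G :: grammar and M :: "nat mat"
  assumes rlslp: "rlslp \<Sigma> G" and generates: "generates G M"
begin

abbreviation rl :: "nat \<Rightarrow> rule" where "rl v \<equiv> rules G ! v"
abbreviation N :: nat where "N \<equiv> length (rules G)"

inductive_set V :: "nat set" where
  start: "start G \<in> V"
| kid: "v \<in> V \<Longrightarrow> c \<in> set (kids (rl v)) \<Longrightarrow> c \<in> V"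

definition expn :: "nat \<Rightarrow> nat mat" where "expn v = (THE X. expands G v X)"
definition nr :: "nat \<Rightarrow> nat" where "nr v = dim_row (expn v)"
definition nc :: "nat \<Rightarrow> nat" where "nc v = dim_col (expn v)"
definition area :: "nat \<Rightarrow> nat" where "area v = nr v * nc v"

text \<open>A derivation of the expansion of the start variable contains one for each of its parts,
  so every reachable variable has an expansion; other variables may have none.\<close>

lemma expands_expn:
  assumes "v \<in> V"
  shows "expands G v (expn v)"
proof -
  have "\<exists>X. expands G v X" using assms
  proof induction
    case start
    then show ?case using generates by (auto simp: generates_def)
  next
    case (kid v c)
    then obtain X where "expands G v X" by blast
    then show ?case using kid.hyps(2) by cases auto
  qed
  then obtain X where X: "expands G v X" ..
  then have "expn v = X" unfolding expn_def using expands_unique by blast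
  then show ?thesis using X by simp
qed

lemma expn_eq: "expands G v X \<Longrightarrow> expn v = X"
  unfolding expn_def using expands_unique by blast

lemma expn_start: "expn (start G) = M"
  using generates expn_eq by (simp add: generates_def)

lemma V_less: "v \<in> V \<Longrightarrow> v < N"
  by (drule expands_expn, erule expands.cases) auto

lemma finite_V: "finite V"
  using V_less by (meson bounded_nat_set_is_finite)

lemma nr_pos: "v \<in> V \<Longrightarrow> 0 < nr v" and nc_pos: "v \<in> V \<Longrightarrow> 0 < nc v"
  using expands_dim_pos expands_expn by (auto simp: nr_def nc_def)

lemma area_pos: "v \<in> V \<Longrightarrow> 0 < area v"
  by (simp add: area_def nr_pos nc_pos)

lemma Sym_expn:
  assumes "v \<in> V" "rl v = Sym a"
  shows "nr v = 1" "nc v = 1" "expn v $$ (0, 0) = a" "a \<in> \<Sigma>"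
proof -
  have "expn v = mat 1 1 (\<lambda>_. a)" using expands_expn [OF assms(1)] by cases (simp_all add: assms(2))
  then show "nr v = 1" "nc v = 1" "expn v $$ (0, 0) = a" by (simp_all add: nr_def nc_def)
  have "rl v \<in> set (rules G)" using V_less assms(1) by simp
  then show "a \<in> \<Sigma>" using rlslp assms(2) unfolding rlslp_def by fastforce
qed

lemma HCat_expn:
  assumes "v \<in> V" "rl v = HCat B C"
  shows "B \<in> V" "C \<in> V" "nr B = nr v" "nr C = nr v" "nc v = nc B + nc C"
    "i < nr v \<Longrightarrow> j < nc v \<Longrightarrow>
      expn v $$ (i, j) = (if j < nc B then expn B $$ (i, j) else expn C $$ (i, j - nc B))"
proof -
  show BC: "B \<in> V" "C \<in> V" using assms kid [OF assms(1)] by auto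
  have "dim_row (expn B) = dim_row (expn C) \<and> expn v = hcat (expn B) (expn C)"
    using expands_expn [OF assms(1)] by cases (use assms(2) expn_eq in auto)
  then show "nr B = nr v" "nr C = nr v" "nc v = nc B + nc C"
    "i < nr v \<Longrightarrow> j < nc v \<Longrightarrow>
      expn v $$ (i, j) = (if j < nc B then expn B $$ (i, j) else expn C $$ (i, j - nc B))"
    by (auto simp: nr_def nc_def index_hcat)
qed

lemma VCat_expn:
  assumes "v \<in> V" "rl v = VCat B C"
  shows "B \<in> V" "C \<in> V" "nc B = nc v" "nc C = nc v" "nr v = nr B + nr C"
    "i < nr v \<Longrightarrow> j < nc v \<Longrightarrow>
      expn v $$ (i, j) = (if i < nr B then expn B $$ (i, j) else expn C $$ (i - nr B, j))"
proof -
  show BC: "B \<in> V" "C \<in> V" using assms kid [OF assms(1)] by auto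
  have "dim_col (expn B) = dim_col (expn C) \<and> expn v = vcat (expn B) (expn C)"
    using expands_expn [OF assms(1)] by cases (use assms(2) expn_eq in auto)
  then show "nc B = nc v" "nc C = nc v" "nr v = nr B + nr C"
    "i < nr v \<Longrightarrow> j < nc v \<Longrightarrow>
      expn v $$ (i, j) = (if i < nr B then expn B $$ (i, j) else expn C $$ (i - nr B, j))"
    by (auto simp: nr_def nc_def index_vcat)
qed

lemma rule_ok_V: "v \<in> V \<Longrightarrow> rule_ok \<Sigma> N (rl v)"
  using rlslp V_less unfolding rlslp_def by simp

lemma HRun_expn:
  assumes "v \<in> V" "rl v = HRun k B"
  shows "B \<in> V" "2 \<le> k" "nr B = nr v" "nc v = k * nc B"
    "i < nr v \<Longrightarrow> j < nc v \<Longrightarrow> expn v $$ (i, j) = expn B $$ (i, j mod nc B)"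
proof -
  show B: "B \<in> V" using assms kid [OF assms(1)] by auto
  show k: "2 \<le> k" using rule_ok_V [OF assms(1)] assms(2) by simp
  have e: "expn v = hrep k (expn B)"
    using expands_expn [OF assms(1)] by cases (use assms(2) expn_eq in auto)
  show "nr B = nr v" "nc v = k * nc B" using e k by (simp_all add: nr_def nc_def dim_hrep)
  then show "i < nr v \<Longrightarrow> j < nc v \<Longrightarrow> expn v $$ (i, j) = expn B $$ (i, j mod nc B)"
    using e k index_hrep [of i "expn B" j k] by (simp add: nr_def nc_def dim_hrep)
qed

lemma VRun_expn:
  assumes "v \<in> V" "rl v = VRun k B"
  shows "B \<in> V" "2 \<le> k" "nc B = nc v" "nr v = k * nr B"
    "i < nr v \<Longrightarrow> j < nc v \<Longrightarrow> expn v $$ (i, j) = expn B $$ (i mod nr B, j)"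
proof -
  show B: "B \<in> V" using assms kid [OF assms(1)] by auto
  show k: "2 \<le> k" using rule_ok_V [OF assms(1)] assms(2) by simp
  have e: "expn v = vrep k (expn B)"
    using expands_expn [OF assms(1)] by cases (use assms(2) expn_eq in auto)
  show "nc B = nc v" "nr v = k * nr B" using e k by (simp_all add: nr_def nc_def dim_vrep)
  then show "i < nr v \<Longrightarrow> j < nc v \<Longrightarrow> expn v $$ (i, j) = expn B $$ (i mod nr B, j)"
    using e k index_vrep [of j "expn B" i k] by (simp add: nr_def nc_def dim_vrep)
qed

lemma area_Cat:
  assumes "v \<in> V" "rl v = HCat B C \<or> rl v = VCat B C"
  shows "B \<in> V" "C \<in> V" "area v = area B + area C"
proof -
  from assms(2) have "B \<in> V \<and> C \<in> V \<and> area v = area B + area C"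
  proof
    assume "rl v = HCat B C"
    from HCat_expn(1-5) [OF assms(1) this] show ?thesis by (simp add: area_def algebra_simps)
  next
    assume "rl v = VCat B C"
    from VCat_expn(1-5) [OF assms(1) this] show ?thesis by (simp add: area_def algebra_simps)
  qed
  then show "B \<in> V" "C \<in> V" "area v = area B + area C" by blast+
qed

lemma area_Run:
  assumes "v \<in> V" "rl v = HRun k B \<or> rl v = VRun k B"
  shows "B \<in> V" "area v = k * area B" "2 \<le> k"
proof -
  from assms(2) have "B \<in> V \<and> area v = k * area B \<and> 2 \<le> k"
  proof
    assume "rl v = HRun k B"
    from HRun_expn(1-4) [OF assms(1) this] show ?thesis by (simp add: area_def algebra_simps)
  next
    assume "rl v = VRun k B"
    from VRun_expn(1-4) [OF assms(1) this] show ?thesis by (simp add: area_def algebra_simps)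
  qed
  then show "B \<in> V" "area v = k * area B" "2 \<le> k" by blast+
qed

text \<open>A binary tree with \<open>area\<close> leaves has \<open>2 * area - 1\<close> nodes. The
  bound is strict at a concatenation because areas add up, and at a collapsed run because two or
  more copies at least double the area. The difference of at least 1 pays for the variable
  itself.\<close>

lemma area_kids:
  assumes "v \<in> V"
  shows "(\<Sum>c\<leftarrow>kids (rl v). 2 * area c - 1) < 2 * area v - 1"
proof (cases "rl v")
  case (Sym a)
  then show ?thesis using Sym_expn [OF assms] by (simp add: area_def)
next
  case (HCat B C)
  then show ?thesis using area_Cat [OF assms disjI1 [OF HCat]] area_pos [of B] area_pos [of C] by simp
next
  case (VCat B C)
  then show ?thesis using area_Cat [OF assms disjI2 [OF VCat]] area_pos [of B] area_pos [of C] by simp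
next
  case (HRun k B)
  then have r: "B \<in> V" "area v = k * area B" "2 \<le> k" using area_Run [OF assms, of k B] by blast+
  have "2 * area B \<le> area v" unfolding r(2) using r(3) by (rule mult_le_mono1)
  then show ?thesis using HRun area_pos [OF r(1)] by simp
next
  case (VRun k B)
  then have r: "B \<in> V" "area v = k * area B" "2 \<le> k" using area_Run [OF assms, of k B] by blast+
  have "2 * area B \<le> area v" unfolding r(2) using r(3) by (rule mult_le_mono1)
  then show ?thesis using VRun area_pos [OF r(1)] by simp
qed

lemma area_kid: "v \<in> V \<Longrightarrow> c \<in> set (kids (rl v)) \<Longrightarrow> area c < area v"
proof -
  assume v: "v \<in> V" and c: "c \<in> set (kids (rl v))"
  have "2 * area c - 1 \<le> (\<Sum>c\<leftarrow>kids (rl v). 2 * area c - 1)"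
    using c by (intro member_le_sum_list) auto
  then show ?thesis using area_kids [OF v] area_pos [OF V.kid [OF v c]] by simp
qed

lemma kid_dims:
  assumes "v \<in> V" "c \<in> set (kids (rl v))"
  shows "nr c \<le> nr v \<and> nc c \<le> nc v"
proof (cases "rl v")
  case (HCat B C)
  then show ?thesis using HCat_expn(1-5) [OF assms(1) HCat] assms(2) by auto
next
  case (VCat B C)
  then show ?thesis using VCat_expn(1-5) [OF assms(1) VCat] assms(2) by auto
next
  case (HRun k B)
  then show ?thesis using HRun_expn(1-4) [OF assms(1) HRun] assms(2) by auto
next
  case (VRun k B)
  then show ?thesis using VRun_expn(1-4) [OF assms(1) VRun] assms(2) by auto
qed (use assms in auto)

lemma dims_le: "v \<in> V \<Longrightarrow> nr v \<le> dim_row M \<and> nc v \<le> dim_col M"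
proof (induction rule: V.induct)
  case (kid v c)
  then show ?case using kid_dims by (meson order_trans)
qed (simp add: nr_def nc_def expn_start)

definition cells :: nat where "cells = dim_row M * dim_col M"

lemma area_le_cells: "v \<in> V \<Longrightarrow> area v \<le> cells"
  unfolding area_def cells_def by (intro mult_mono) (auto simp: dims_le)

lemma area_start: "area (start G) = cells"
  by (simp add: area_def cells_def nr_def nc_def expn_start)

end

section \<open>Paths of equal size and multiplicity\<close>

text \<open>The interface between the two graph traversals, which provide these facts, and the
  analysis of paths and queries. \<open>rho\<close> counts parallel edges such as those of
  \<open>HCat B B\<close> separately. The bound on \<open>length Q\<close> later limits the width of
  addresses.\<close>

locale ordered_slp2d = slp2d +
  fixes Q :: "nat list" and rho :: "nat \<Rightarrow> nat"
  assumes distinct_Q: "distinct Q" and set_Q: "set Q = V" and Q_start: "Q ! 0 = start G"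
    and Q_topological: "i < length Q \<Longrightarrow> c \<in> set (kids (rl (Q ! i))) \<Longrightarrow> c \<notin> set (take (Suc i) Q)"
    and rho_eq: "c \<in> V \<Longrightarrow>
      rho c = of_bool (c = start G) + (\<Sum>v\<in>V. count_list (kids (rl v)) c * rho v)"
    and rho_le: "c \<in> V \<Longrightarrow> rho c \<le> 2 * cells"
    and length_Q: "length Q \<le> 2 * cells"
begin

section \<open>Path counts and symmetric edges\<close>

lemma count_kids_pos: "c \<in> set xs \<Longrightarrow> 1 \<le> count_list xs c"
  by (metis One_nat_def Suc_leI count_list_0_iff gr0I)

lemma rho_kid_le:
  assumes "v \<in> V" "c \<in> set (kids (rl v))"
  shows "rho v \<le> rho c"
proof -
  have "rho v \<le> count_list (kids (rl v)) c * rho v" using count_kids_pos [OF assms(2)] by simp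
  also have "\<dots> \<le> (\<Sum>v\<in>V. count_list (kids (rl v)) c * rho v)"
    by (intro member_le_sum) (use assms finite_V in auto)
  finally show ?thesis using rho_eq [OF V.kid [OF assms]] by simp
qed

lemma rho_pos: "v \<in> V \<Longrightarrow> 0 < rho v"
proof (induction rule: V.induct)
  case start
  then show ?case using rho_eq [OF V.start] by simp
next
  case (kid v c)
  then show ?case using rho_kid_le by force
qed

lemma rho_kid_sum_le:
  assumes "v \<in> V" "v' \<in> V" "v \<noteq> v'" "c \<in> set (kids (rl v))" "c \<in> set (kids (rl v'))"
  shows "rho v + rho v' \<le> rho c"
proof -
  have "rho v + rho v' \<le> count_list (kids (rl v)) c * rho v + count_list (kids (rl v')) c * rho v'"
    using count_kids_pos [OF assms(4)] count_kids_pos [OF assms(5)] by (intro add_mono) auto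
  also have "\<dots> = (\<Sum>v\<in>{v, v'}. count_list (kids (rl v)) c * rho v)" using assms(3) by simp
  also have "\<dots> \<le> (\<Sum>v\<in>V. count_list (kids (rl v)) c * rho v)"
    by (intro sum_mono2) (use assms finite_V in auto)
  finally show ?thesis using rho_eq [OF V.kid [OF assms(1,4)]] by simp
qed

definition same :: "nat \<Rightarrow> nat \<Rightarrow> bool" where
  "same v u \<longleftrightarrow> floor_log (area v) = floor_log (area u) \<and> floor_log (rho v) = floor_log (rho u)"

definition same_of :: "nat \<Rightarrow> nat \<Rightarrow> nat \<Rightarrow> nat option" where
  "same_of v B C = (if same v B then Some B else if same v C then Some C else None)"

definition sc :: "nat \<Rightarrow> nat option" where
  "sc v = (if v \<in> V then (case rl v of HCat B C \<Rightarrow> same_of v B C | VCat B C \<Rightarrow> same_of v B C | _ \<Rightarrow> None)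
     else None)"

lemma sc_Cat:
  assumes "sc v = Some u"
  obtains B C where "v \<in> V" "rl v = HCat B C \<or> rl v = VCat B C" "u = B \<and> same v B \<or> u = C \<and> \<not> same v B \<and> same v C"
  using assms by (auto simp: sc_def same_of_def split: if_splits rule.splits)

lemma scD:
  assumes "sc v = Some u"
  shows "v \<in> V" "u \<in> V" "u \<in> set (kids (rl v))" "area u < area v" "same v u"
proof -
  obtain B C where *: "v \<in> V" "rl v = HCat B C \<or> rl v = VCat B C" "u = B \<and> same v B \<or> u = C \<and> \<not> same v B \<and> same v C"
    using sc_Cat [OF assms] by blast
  then show "v \<in> V" "u \<in> set (kids (rl v))" "same v u" by auto
  then show "u \<in> V" "area u < area v" using V.kid area_kid by auto
qed

text \<open>Each summand is at least \<open>2 ^ floor_log c\<close>, and twice this power exceeds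
  \<open>c\<close>. Applied to areas this excludes two symmetric edges out of a variable, applied to
  path counts two symmetric edges into one.\<close>

lemma floor_log_add_less:
  assumes "0 < a" "0 < b" "floor_log a = floor_log c" "floor_log b = floor_log c"
  shows "c < a + (b :: nat)"
proof -
  have "2 ^ floor_log c \<le> a" "2 ^ floor_log c \<le> b"
    using floor_log_exp2_le [OF assms(1)] floor_log_exp2_le [OF assms(2)] assms(3,4) by simp_all
  then show ?thesis using floor_log_exp2_gt [of c] by simp
qed

text \<open>Distinct parents contribute different paths, so \<open>rho\<close> of the child is at
  least their sum, which is impossible if all three counts have the same
  \<open>floor_log\<close>.\<close>

lemma sc_inj:
  assumes "sc v = Some u" "sc v' = Some u"
  shows "v = v'"
proof (rule ccontr)
  assume "v \<noteq> v'"
  then have "rho v + rho v' \<le> rho u"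
    using scD [OF assms(1)] scD [OF assms(2)] by (intro rho_kid_sum_le) auto
  moreover have "rho u < rho v + rho v'"
    using scD(1,5) [OF assms(1)] scD(1,5) [OF assms(2)]
    by (intro floor_log_add_less rho_pos) (auto simp: same_def)
  ultimately show False by simp
qed

text \<open>If both operands were in the class of \<open>v\<close>, their areas would sum to more
  than the area of \<open>v\<close>; a run at least doubles the area, which changes its
  \<open>floor_log\<close>. So \<open>sc\<close> misses no edge within a class.\<close>

lemma not_same_kid:
  assumes v: "v \<in> V" and c: "c \<in> set (kids (rl v))" and n: "sc v \<noteq> Some c"
  shows "\<not> same v c"
proof -
  have cat: "\<not> same v c" if r: "rl v = HCat B C \<or> rl v = VCat B C" for B C
  proof
    assume s: "same v c"
    have BC: "c = B \<or> c = C" using r c by auto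
    have e: "sc v = same_of v B C" using r v by (auto simp: sc_def)
    then have *: "same v B" "same v C" using n s BC by (auto simp: same_of_def split: if_splits)
    have a: "area v = area B + area C" "0 < area B" "0 < area C"
      using area_Cat [OF v r] area_pos by auto
    have "area v < area B + area C"
      using * by (intro floor_log_add_less a) (simp_all only: same_def)
    then show False using a(1) by simp
  qed
  have run: "\<not> same v c" if r: "rl v = HRun k c \<or> rl v = VRun k c" for k
  proof
    assume s: "same v c"
    have le: "2 * area c \<le> area v"
      unfolding area_Run(2) [OF v r] using area_Run(3) [OF v r] by (rule mult_le_mono1)
    have "0 < area c" using area_Run(1) [OF v r] by (rule area_pos)
    then have "area v < area c + area c"
      using s by (intro floor_log_add_less) (simp_all only: same_def)
    then show False using le by simp
  qed
  show ?thesis using cat run c by (cases "rl v") auto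
qed

text \<open>The raw word is kept instead of its logarithm because priorities only have to be
  compared. Taking the whole area at the end of a path makes the last variable a sentinel above all
  other priorities of the path.\<close>

definition key :: "nat \<Rightarrow> nat" where
  "key v = (case sc v of None \<Rightarrow> area v | Some u \<Rightarrow> semiring_bit_operations_class.xor (area v) (area u))"

definition prio :: "nat \<Rightarrow> nat" where "prio v = floor_log (key v)"

section \<open>Chains of priority records\<close>

function spath :: "nat \<Rightarrow> nat list" where
  "spath v = v # (case sc v of None \<Rightarrow> [] | Some u \<Rightarrow> spath u)"
  by auto
termination by (relation "measure area") (auto dest: scD)

text \<open>These are the records of the priority sequence along the path, computed backwards as
  with a monotone stack: popping everything that is not above \<open>prio v\<close> leaves a suffix
  of the successor's chain.\<close>

function chain :: "nat \<Rightarrow> nat list" where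
  "chain v = v # (case sc v of None \<Rightarrow> [] | Some u \<Rightarrow> dropWhile (\<lambda>x. prio x \<le> prio v) (chain u))"
  by auto
termination by (relation "measure area") (auto dest: scD)

declare spath.simps [simp del] chain.simps [simp del]

lemma sc_induct [case_names None Some]:
  assumes "\<And>v. sc v = None \<Longrightarrow> P v" "\<And>v u. sc v = Some u \<Longrightarrow> P u \<Longrightarrow> P v"
  shows "P v"
proof (induction v rule: measure_induct_rule [of area])
  case (less v)
  show ?case
  proof (cases "sc v")
    case (Some u)
    then show ?thesis using assms(2) less scD(4) by blast
  qed (rule assms(1))
qed

lemma chain_None: "sc v = None \<Longrightarrow> chain v = [v]"
  and chain_Some: "sc v = Some u \<Longrightarrow> chain v = v # dropWhile (\<lambda>x. prio x \<le> prio v) (chain u)"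
  and spath_None: "sc v = None \<Longrightarrow> spath v = [v]"
  and spath_Some: "sc v = Some u \<Longrightarrow> spath v = v # spath u"
  by (subst chain.simps spath.simps, simp)+

lemma chain_nonempty [simp]: "chain v \<noteq> []" and hd_chain [simp]: "hd (chain v) = v"
  by (subst chain.simps, simp)+

lemma chain_0 [simp]: "chain v ! 0 = v"
  using hd_conv_nth [of "chain v"] by simp

lemma self_in_spath [simp]: "v \<in> set (spath v)" and self_in_chain [simp]: "v \<in> set (chain v)"
  by (subst spath.simps chain.simps, simp)+

lemma set_chain: "set (chain v) \<subseteq> set (spath v)"
proof (induction v rule: sc_induct)
  case (Some v u)
  then show ?case by (auto simp: chain_Some spath_Some dest: set_dropWhileD)
qed (simp add: chain_None)

lemma sorted_dropWhile_wrt: "sorted_wrt P xs \<Longrightarrow> sorted_wrt P (dropWhile f xs)"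
  by (metis sorted_wrt_append takeWhile_dropWhile_id)

lemma sorted_chain_prio: "sorted_wrt (\<lambda>x y. prio x < prio y) (chain v)"
proof (induction v rule: sc_induct)
  case (Some v u)
  let ?d = "dropWhile (\<lambda>x. prio x \<le> prio v) (chain u)"
  have s: "sorted_wrt (\<lambda>x y. prio x < prio y) ?d" using Some by (intro sorted_dropWhile_wrt)
  have "prio v < prio y" if "y \<in> set ?d" for y
  proof -
    obtain h t where ht: "?d = h # t" using \<open>y \<in> set ?d\<close> by (cases ?d) auto
    then have "prio v < prio h" by (metis dropWhile_eq_Cons_conv linorder_not_less)
    then show ?thesis using s that ht by auto
  qed
  then show ?case using Some s by (simp add: chain_Some)
qed (simp add: chain_None)

lemma sorted_chain_spath: "sorted_wrt (\<lambda>x y. y \<in> set (spath x)) (chain v)"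
proof (induction v rule: sc_induct)
  case (Some v u)
  have "set (dropWhile (\<lambda>x. prio x \<le> prio v) (chain u)) \<subseteq> set (spath v)"
    using set_chain [of u] by (auto simp: spath_Some [OF Some(1)] dest: set_dropWhileD)
  then show ?case using Some sorted_dropWhile_wrt by (auto simp: chain_Some)
qed (simp add: chain_None)

text \<open>Chains that meet stay together. The chains of a path thus form a tree, and one pointer
  per variable represents all of them.\<close>

lemma chain_suffix: "chain v = a @ x # b \<Longrightarrow> chain x = x # b"
proof (induction v arbitrary: a rule: sc_induct)
  case (None v)
  then show ?case by (cases a) (auto simp: chain_None)
next
  case (Some v u)
  show ?case
  proof (cases a)
    case Nil
    then show ?thesis using Some by (metis append_Nil hd_chain list.sel(1))
  next
    case (Cons y a')
    then have "chain u = (takeWhile (\<lambda>x. prio x \<le> prio v) (chain u) @ a') @ x # b"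
      using Some(3) chain_Some [OF Some(1)] takeWhile_dropWhile_id [of _ "chain u"]
      by (metis append.assoc append_Cons list.inject)
    then show ?thesis by (rule Some.IH)
  qed
qed

lemma chain_nth: "i < length (chain v) \<Longrightarrow> chain (chain v ! i) = drop i (chain v)"
  by (metis Cons_nth_drop_Suc chain_suffix append_take_drop_id)

lemma spath_same:
  assumes "x \<in> set (spath v)" "v \<in> V"
  shows "x \<in> V" "floor_log (area x) = floor_log (area v)" "floor_log (rho x) = floor_log (rho v)"
proof -
  have "x \<in> V \<and> floor_log (area x) = floor_log (area v) \<and> floor_log (rho x) = floor_log (rho v)"
    using assms
  proof (induction v rule: sc_induct)
    case (Some v u)
    then show ?case using scD [OF Some(1)] by (auto simp: spath_Some same_def)
  qed (simp add: spath_None)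
  then show "x \<in> V" "floor_log (area x) = floor_log (area v)" "floor_log (rho x) = floor_log (rho v)" by auto
qed

lemma key_pos: "v \<in> V \<Longrightarrow> 0 < key v"
  using scD(4) by (fastforce simp: key_def area_pos split: option.split intro: xor_pos)

lemma prio_le: "v \<in> V \<Longrightarrow> prio v \<le> floor_log (area v)"
proof (cases "sc v")
  case (Some u)
  let ?k = "floor_log (area v)"
  have "area v div 2 ^ Suc ?k = 0" "area u div 2 ^ Suc ?k = 0"
    using scD(5) [OF Some] floor_log_less_power [of "area v" "Suc ?k"] floor_log_less_power [of "area u" "Suc ?k"]
    by (simp_all add: same_def del: power_Suc)
  then have "semiring_bit_operations_class.xor (area v) (area u) div 2 ^ Suc ?k = 0"
    by (simp only: xor_div_power) simp
  then have "semiring_bit_operations_class.xor (area v) (area u) < 2 ^ Suc ?k"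
    by (metis div_eq_0_iff power_not_zero zero_neq_numeral)
  then show ?thesis using Some by (simp add: prio_def key_def floor_log_le_of_less_power)
qed (simp add: prio_def key_def)

text \<open>Both areas have the same top bit, which cancels in the xor. Hence the sentinel at the
  end of the path is never popped.\<close>

lemma prio_less:
  assumes "sc v = Some u"
  shows "prio v < floor_log (area v)"
proof -
  have "semiring_bit_operations_class.xor (area v) (area u) < semiring_bit_operations_class.and (area v) (area u)"
    using scD [OF assms] by (simp add: xor_less_and_iff area_pos same_def)
  moreover have "semiring_bit_operations_class.xor (area v) (area u) div 2 ^ floor_log (area v) = 0"
    using scD [OF assms] area_pos floor_log_div_power [of "area v"] floor_log_div_power [of "area u"]
    by (simp add: xor_div_power same_def)
  ultimately have "key v < 2 ^ floor_log (area v)" using assms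
    by (simp add: key_def) (metis div_eq_0_iff power_not_zero zero_neq_numeral)
  moreover have "2 ^ prio v \<le> key v" using key_pos scD(1) [OF assms] by (simp add: prio_def floor_log_exp2_le)
  ultimately have "(2::nat) ^ prio v < 2 ^ floor_log (area v)" by linarith
  then show ?thesis by simp
qed

text \<open>Priorities strictly increase along the chain, and each is a bit position in an area of
  the path; all these areas have the same bit length.\<close>

lemma length_chain: "v \<in> V \<Longrightarrow> length (chain v) \<le> floor_log (area v) + 1"
proof -
  assume v: "v \<in> V"
  let ?p = "map prio (chain v)"
  have "sorted_wrt (<) ?p" using sorted_chain_prio by (simp add: sorted_wrt_map)
  then have "distinct ?p" by (simp add: strict_sorted_iff)
  moreover have "set ?p \<subseteq> {..floor_log (area v)}"
  proof
    fix p
    assume "p \<in> set ?p"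
    then obtain x where x: "x \<in> set (spath v)" "p = prio x" using set_chain [of v] by auto
    then show "p \<in> {..floor_log (area v)}"
      using prio_le [OF spath_same(1) [OF x(1) v]] spath_same(2) [OF x(1) v] by simp
  qed
  ultimately have "length ?p \<le> card {..floor_log (area v)}"
    by (metis card_mono distinct_card finite_atMost)
  then show ?thesis by simp
qed

text \<open>Every edge between \<open>v\<close> and the record \<open>x\<close> has a smaller
  priority than \<open>x\<close>, so only bits below \<open>prio x\<close> change in
  between.\<close>

lemma chain_area_div:
  assumes "x \<in> set (chain v)" "v \<in> V"
  shows "area x div 2 ^ prio x = area v div 2 ^ prio x"
  using assms
proof (induction v rule: sc_induct)
  case (None v)
  then show ?case by (simp add: chain_None)
next
  case (Some v u)
  show ?case
  proof (cases "x = v")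
    case False
    then have d: "x \<in> set (dropWhile (\<lambda>x. prio x \<le> prio v) (chain u))"
      using Some by (simp add: chain_Some)
    have "area x div 2 ^ prio x = area u div 2 ^ prio x"
      using Some(2) [OF set_dropWhileD [OF d] scD(2) [OF Some(1)]] .
    moreover have "prio v < prio x"
      using sorted_chain_prio [of v] d by (simp add: chain_Some [OF Some(1)])
    then obtain k where k: "prio x = Suc (prio v) + k" by (metis Suc_leI le_Suc_ex)
    have "area v div 2 ^ (Suc (prio v) + k) = area u div 2 ^ (Suc (prio v) + k)"
      if "area v div 2 ^ Suc (prio v) = area u div 2 ^ Suc (prio v)"
      using that by (simp only: power_add div_mult2_eq)
    moreover have "area v div 2 ^ Suc (prio v) = area u div 2 ^ Suc (prio v)"
      using top_differing_bit(1) [OF scD(4) [OF Some(1)]] Some(1) by (simp add: prio_def key_def)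
    ultimately show ?thesis unfolding k by simp
  qed simp
qed

lemma prio_odd: "v \<in> V \<Longrightarrow> odd (area v div 2 ^ prio v)"
  using top_differing_bit(2) [OF scD(4)] floor_log_div_power [OF area_pos]
  by (cases "sc v") (auto simp: prio_def key_def)

text \<open>Areas decrease along a path, so the edge from \<open>v\<close> clears bit \<open>prio v\<close> of the area. Only a change of
  a higher bit can set it again.\<close>

lemma chain_prio_neq:
  assumes "sc v = Some u" "x \<in> set (chain u)"
  shows "prio x \<noteq> prio v"
proof
  assume e: "prio x = prio v"
  have "x \<in> V" using subsetD [OF set_chain assms(2)] scD(2) [OF assms(1)] by (rule spath_same(1))
  then have "odd (area x div 2 ^ prio x)" by (rule prio_odd)
  moreover have "area x div 2 ^ prio x = area u div 2 ^ prio x"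
    using assms(2) scD(2) [OF assms(1)] by (rule chain_area_div)
  moreover have "even (area u div 2 ^ prio v)"
    using top_differing_bit(3) [OF scD(4) [OF assms(1)]] assms(1) by (simp add: prio_def key_def)
  ultimately show False using e by simp
qed

text \<open>The area of the sibling is the difference of \<open>area v\<close> and
  \<open>area u\<close>, two numbers that agree above bit \<open>prio v\<close>.\<close>

lemma light_sibling_level:
  assumes "sc v = Some u" "c \<in> set (kids (rl v))" "c \<noteq> u"
  shows "floor_log (area c) \<le> prio v"
proof -
  obtain B C where BC: "v \<in> V" "rl v = HCat B C \<or> rl v = VCat B C" "u = B \<or> u = C"
    using sc_Cat [OF assms(1)] by metis
  then have sum: "area c + area u = area v" using area_Cat [OF BC(1,2)] assms by auto
  have "area v div 2 ^ Suc (prio v) = area u div 2 ^ Suc (prio v)"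
    using top_differing_bit(1) [OF scD(4) [OF assms(1)]] assms(1) by (simp add: prio_def key_def)
  moreover have "x < y + p" if "x div p = y div p" "0 < p" for x y p :: nat
  proof -
    have "x = y div p * p + x mod p" "y = y div p * p + y mod p" "x mod p < p"
      using div_mult_mod_eq [of x p] div_mult_mod_eq [of y p] that by simp_all
    then show ?thesis by linarith
  qed
  ultimately have "area v < area u + 2 ^ Suc (prio v)"
    by simp
  then have "area c < 2 ^ Suc (prio v)" using sum by linarith
  then show ?thesis by (rule floor_log_le_of_less_power)
qed

section \<open>Depths, jump pointers and the amortised cost of the chains\<close>

definition depth :: "nat \<Rightarrow> nat" where "depth v = length (chain v) - 1"
definition nx :: "nat \<Rightarrow> nat" where "nx v = (if depth v = 0 then v else chain v ! 1)"
text \<open>Depth is counted from the end of the chain, where chains have merged: an element has the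
  same depth in every chain that contains it, so a jump pointer can be shared by all of them. At
  depth 0 both \<open>nx\<close> and \<open>jp\<close> are loops.\<close>

definition jp :: "nat \<Rightarrow> nat" where "jp v = chain v ! (depth v - jump_depth (depth v))"

lemma length_chain_depth: "length (chain v) = Suc (depth v)"
  by (simp add: depth_def)

lemma chain_at:
  assumes "d \<le> depth v"
  defines "x \<equiv> chain v ! (depth v - d)"
  shows "chain x = drop (depth v - d) (chain v)" "depth x = d" "x \<in> set (chain v)"
proof -
  show c: "chain x = drop (depth v - d) (chain v)"
    unfolding x_def by (intro chain_nth) (simp add: length_chain_depth)
  show "depth x = d" unfolding depth_def [of x] c using assms(1) length_chain_depth [of v] by simp
  show "x \<in> set (chain v)" unfolding x_def by (simp add: length_chain_depth)
qed

lemma nx_at: "depth v \<noteq> 0 \<Longrightarrow> nx v = chain v ! (depth v - (depth v - 1))"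
  by (simp add: nx_def)

lemma depth_jp: "depth (jp v) = jump_depth (depth v)"
  unfolding jp_def by (intro chain_at jump_depth_le)

lemma depth_nx: "depth (nx v) = depth v - 1"
  by (cases "depth v = 0") (simp add: nx_def, metis nx_at chain_at(2) diff_le_self)

lemma chain_nth_nx:
  assumes "Suc i < length (chain v)"
  shows "nx (chain v ! i) = chain v ! Suc i"
proof -
  have "chain (chain v ! i) = drop i (chain v)" using assms by (intro chain_nth) simp
  then show ?thesis using assms by (simp add: nx_def depth_def)
qed

lemma chain_last_key:
  assumes "v \<in> V"
  shows "\<exists>x \<in> set (chain v). prio x = floor_log (area v)"
  using assms
proof (induction v rule: sc_induct)
  case (None v)
  then show ?case by (simp add: chain_None prio_def key_def)
next
  case (Some v u)
  then obtain x where x: "x \<in> set (chain u)" "prio x = floor_log (area v)"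
    using scD [OF Some(1)] by (auto simp: same_def)
  then have "x \<in> set (dropWhile (\<lambda>x. prio x \<le> prio v) (chain u))"
    using prio_less [OF Some(1)] by (metis Un_iff linorder_not_less set_append set_takeWhileD takeWhile_dropWhile_id)
  then show ?case using x by (auto simp: chain_Some [OF Some(1)])
qed

text \<open>The number of stack entries removed at \<open>v\<close>, which is the number of rounds
  of the loop in \<open>climb\<close>.\<close>

definition pops :: "nat \<Rightarrow> nat" where
  "pops v = (case sc v of None \<Rightarrow> 0 | Some u \<Rightarrow> length (takeWhile (\<lambda>x. prio x \<le> prio v) (chain u)))"

lemma pops_Some:
  assumes "sc v = Some u"
  shows "pops v < length (chain u)" "nx v = chain u ! pops v" "depth v = Suc (depth (nx v))"
    "i < pops v \<Longrightarrow> prio (chain u ! i) \<le> prio v" "prio v < prio (chain u ! pops v)"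
    "pops v + length (chain v) = Suc (length (chain u))"
proof -
  let ?t = "takeWhile (\<lambda>x. prio x \<le> prio v) (chain u)" and ?d = "dropWhile (\<lambda>x. prio x \<le> prio v) (chain u)"
  have p: "pops v = length ?t" using assms by (simp add: pops_def)
  obtain x where "x \<in> set (chain u)" "prio x = floor_log (area u)"
    using chain_last_key [OF scD(2) [OF assms]] by blast
  then have "\<not> (\<forall>x \<in> set (chain u). prio x \<le> prio v)"
    using prio_less [OF assms] scD(5) [OF assms] by (auto simp: same_def not_le intro!: bexI [of _ x])
  then have ne: "?d \<noteq> []" by simp
  have c: "chain v = v # ?d" by (rule chain_Some [OF assms])
  have l: "length ?t + length ?d = length (chain u)"
    by (metis length_append takeWhile_dropWhile_id)
  show lt: "pops v < length (chain u)"
  proof -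
    have "0 < length ?d" using ne by (simp only: length_greater_0_conv not_False_eq_True)
    then show ?thesis unfolding p using l by linarith
  qed
  show pl: "pops v + length (chain v) = Suc (length (chain u))" using l c p by simp
  have d: "depth v \<noteq> 0" using c ne by (simp add: depth_def)
  have dd: "?d = drop (pops v) (chain u)" by (simp add: p dropWhile_eq_drop)
  show nx: "nx v = chain u ! pops v" using d c ne dd lt by (simp add: nx_def)
  show "depth v = Suc (depth (nx v))" using d by (simp add: depth_nx)
  show "i < pops v \<Longrightarrow> prio (chain u ! i) \<le> prio v"
    using nth_mem [of i ?t] by (auto simp: p takeWhile_nth dest: set_takeWhileD)
  show "prio v < prio (chain u ! pops v)"
    using nth_length_takeWhile [of "\<lambda>x. prio x \<le> prio v" "chain u"] lt by (simp add: p)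
qed

lemma chain_nx:
  assumes "sc v = Some u"
  shows "chain v = v # chain (nx v)"
proof -
  have "chain (nx v) = drop (pops v) (chain u)"
    unfolding pops_Some(2) [OF assms] by (rule chain_nth [OF pops_Some(1) [OF assms]])
  then show ?thesis using assms by (simp add: chain_Some pops_def dropWhile_eq_drop)
qed

lemma jp_None: "sc v = None \<Longrightarrow> jp v = v" and nx_None: "sc v = None \<Longrightarrow> nx v = v"
  and depth_None: "sc v = None \<Longrightarrow> depth v = 0"
  by (simp_all add: depth_def chain_None nx_def jp_def)

text \<open>Beyond \<open>v\<close> itself, the chain of \<open>v\<close> is the chain of
  \<open>nx v\<close>, so \<open>jump_depth_Suc\<close> transfers from depths to chain elements and
  a jump pointer is computed in constant time.\<close>

lemma jp_Some:
  assumes "sc v = Some u"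
  defines "n \<equiv> nx v"
  shows "jp v = (if depth n - depth (jp n) = depth (jp n) - depth (jp (jp n)) then jp (jp n) else n)"
proof -
  have d: "depth v = Suc (depth n)" using pops_Some(3) [OF assms(1)] by (simp add: n_def)
  have cv: "chain v = v # chain n" unfolding n_def by (rule chain_nx [OF assms(1)])
  have at: "chain v ! (depth v - e) = chain n ! (depth n - e)" if "e \<le> depth n" for e
    using that cv d by (simp add: Suc_diff_le)
  have j: "jp n = chain n ! (depth n - jump_depth (depth n))" by (simp add: jp_def)
  have jj: "jp (jp n) = chain n ! (depth n - jump_depth (jump_depth (depth n)))"
  proof -
    have "jump_depth (jump_depth (depth n)) \<le> jump_depth (depth n)" "jump_depth (depth n) \<le> depth n"
      by (rule jump_depth_le)+
    then show ?thesis
      using chain_at(1) [of "jump_depth (depth n)" n] length_chain_depth [of n]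
      by (simp add: jp_def [of "jp n"] depth_jp) (simp add: j)
  qed
  have jv: "jump_depth (depth v) = (if depth n - depth (jp n) = depth (jp n) - depth (jp (jp n))
      then jump_depth (jump_depth (depth n)) else depth n)"
    unfolding d depth_jp by (rule jump_depth_Suc)
  have "jump_depth (depth v) \<le> depth n"
    using jump_depth_less [of "depth v"] d by simp
  then have "jp v = chain n ! (depth n - jump_depth (depth v))"
    unfolding jp_def [of v] by (rule at)
  then show ?thesis unfolding jv jj by simp
qed

text \<open>Amortisation with the chain length as potential: each variable pushes one element, and
  by \<open>sc_inj\<close> the chain of a variable is handed on to at most one predecessor. At the
  end of a path the chain has length one.\<close>

lemma sum_pops: "(\<Sum>v\<in>V. pops v) \<le> card V"
proof -
  let ?W = "{v \<in> V. sc v \<noteq> None}" and ?E = "{v \<in> V. sc v = None}" and ?l = "\<lambda>v. length (chain v)"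
  have f: "finite ?W" "finite ?E" using finite_V by auto
  have V: "V = ?W \<union> ?E" by auto
  have split: "sum g V = sum g ?W + sum g ?E" for g :: "nat \<Rightarrow> nat"
    by (subst V, rule sum.union_disjoint) (use f in auto)
  have "(\<Sum>v\<in>?W. ?l (the (sc v))) = (\<Sum>u\<in>(the \<circ> sc) ` ?W. ?l u)"
    by (subst sum.reindex) (auto simp: inj_on_def intro: sc_inj)
  also have "\<dots> \<le> sum ?l V" by (intro sum_mono2 finite_V) (use scD(2) in auto)
  also have "\<dots> = sum ?l ?W + card ?E" by (simp add: split chain_None)
  finally have le: "(\<Sum>v\<in>?W. ?l (the (sc v))) \<le> sum ?l ?W + card ?E" .
  have "(\<Sum>v\<in>?W. pops v) + sum ?l ?W = (\<Sum>v\<in>?W. ?l (the (sc v)) + 1)"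
    unfolding sum.distrib [symmetric] by (intro sum.cong) (use pops_Some(6) in auto)
  also have "\<dots> = (\<Sum>v\<in>?W. ?l (the (sc v))) + card ?W" by (simp only: sum.distrib) simp
  finally have "(\<Sum>v\<in>?W. pops v) \<le> card ?E + card ?W" using le by simp
  moreover have "card V = card ?W + card ?E" using split [of "\<lambda>_. 1"] by simp
  moreover have "(\<Sum>v\<in>?E. pops v) = 0" by (simp add: pops_def)
  ultimately show ?thesis using split [of pops] by simp
qed

end

section \<open>Positions on a path and the length of a query\<close>

text \<open>A predicate closed towards the front holds on an initial segment, so counting the hits
  locates its boundary.\<close>

lemma nth_iff_less_length_filter:
  "sorted_wrt (\<lambda>x y. P y \<longrightarrow> P x) xs \<Longrightarrow> i < length xs \<Longrightarrow> P (xs ! i) \<longleftrightarrow> i < length (filter P xs)"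
proof (induction xs arbitrary: i)
  case (Cons x xs)
  show ?case
  proof (cases "P x")
    case True
    then show ?thesis using Cons by (cases i) auto
  next
    case False
    then have none: "\<forall>y \<in> set (x # xs). \<not> P y" using Cons.prems by auto
    then have "filter P (x # xs) = []" by (simp only: filter_empty_conv)
    moreover have "\<not> P ((x # xs) ! i)" using none nth_mem [OF Cons.prems(2)] by blast
    ultimately show ?thesis by simp
  qed
qed simp

fun lead :: "rule \<Rightarrow> nat" where
  "lead (HCat B C) = B"
| "lead (VCat B C) = B"
| "lead (Sym a) = 0"
| "lead (HRun k B) = B"
| "lead (VRun k B) = B"

section \<open>Nested rectangles along a path\<close>

context ordered_slp2d
begin

text \<open>For the second operand one formula serves both directions: across the concatenation it
  has the same extent as \<open>v\<close>, so the difference is 0 there.\<close>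

definition offr :: "nat \<Rightarrow> nat \<Rightarrow> nat" where "offr v u = (if u = lead (rl v) then 0 else nr v - nr u)"
definition offc :: "nat \<Rightarrow> nat \<Rightarrow> nat" where "offc v u = (if u = lead (rl v) then 0 else nc v - nc u)"

function endr :: "nat \<Rightarrow> nat" where
  "endr v = (case sc v of None \<Rightarrow> 0 | Some u \<Rightarrow> offr v u + endr u)"
  by auto
termination by (relation "measure area") (auto dest: scD)

function endc :: "nat \<Rightarrow> nat" where
  "endc v = (case sc v of None \<Rightarrow> 0 | Some u \<Rightarrow> offc v u + endc u)"
  by auto
termination by (relation "measure area") (auto dest: scD)

declare endr.simps [simp del] endc.simps [simp del]

lemma endr_None: "sc v = None \<Longrightarrow> endr v = 0"
  and endr_Some: "sc v = Some u \<Longrightarrow> endr v = offr v u + endr u"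
  and endc_None: "sc v = None \<Longrightarrow> endc v = 0"
  and endc_Some: "sc v = Some u \<Longrightarrow> endc v = offc v u + endc u"
  by (subst endr.simps endc.simps, simp)+

text \<open>Two copies of a variable in the class of \<open>v\<close> would have more area than
  \<open>v\<close>. Hence the name of the symmetric child already determines its place in
  \<open>v\<close>, as \<open>offr\<close> and \<open>offc\<close> require.\<close>

lemma sc_kids_distinct:
  assumes "sc v = Some u" "rl v = HCat B C \<or> rl v = VCat B C"
  shows "B \<noteq> C" "u = B \<or> u = C"
proof -
  have v: "v \<in> V" by (rule scD(1) [OF assms(1)])
  show u: "u = B \<or> u = C" using scD(3) [OF assms(1)] assms(2) by auto
  show "B \<noteq> C"
  proof
    assume "B = C"
    then have "area v = area u + area u" using area_Cat(3) [OF v assms(2)] u by auto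
    moreover have "area v < area u + area u"
      using scD(5) [OF assms(1)] area_pos [OF scD(2) [OF assms(1)]]
      by (intro floor_log_add_less) (simp_all add: same_def)
    ultimately show False by simp
  qed
qed

lemma sc_place:
  assumes "sc v = Some u"
  shows "offr v u + nr u \<le> nr v" "offc v u + nc u \<le> nc v"
    "i < nr u \<Longrightarrow> j < nc u \<Longrightarrow> expn v $$ (offr v u + i, offc v u + j) = expn u $$ (i, j)"
proof -
  obtain B C where BC: "v \<in> V" "rl v = HCat B C \<or> rl v = VCat B C" using sc_Cat [OF assms] by metis
  have d: "B \<noteq> C" "u = B \<or> u = C" using sc_kids_distinct [OF assms BC(2)] by auto
  from BC(2) have "offr v u + nr u \<le> nr v \<and> offc v u + nc u \<le> nc v \<and>
    (\<forall>i j. i < nr u \<longrightarrow> j < nc u \<longrightarrow> expn v $$ (offr v u + i, offc v u + j) = expn u $$ (i, j))"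
  proof
    assume r: "rl v = HCat B C"
    show ?thesis using d HCat_expn(3-6) [OF BC(1) r] r by (auto simp: offr_def offc_def)
  next
    assume r: "rl v = VCat B C"
    show ?thesis using d VCat_expn(3-6) [OF BC(1) r] r by (auto simp: offr_def offc_def)
  qed
  then show "offr v u + nr u \<le> nr v" "offc v u + nc u \<le> nc v"
    "i < nr u \<Longrightarrow> j < nc u \<Longrightarrow> expn v $$ (offr v u + i, offc v u + j) = expn u $$ (i, j)" by blast+
qed

text \<open>Positions are taken relative to the end of the path, so that they do not change along the path.\<close>

definition here :: "nat \<Rightarrow> nat \<Rightarrow> nat \<Rightarrow> int \<times> int" where
  "here v i j = (int i - int (endr v), int j - int (endc v))"

definition inside :: "int \<times> int \<Rightarrow> nat \<Rightarrow> bool" where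
  "inside P x \<longleftrightarrow> 0 \<le> fst P + int (endr x) \<and> fst P + int (endr x) < int (nr x) \<and>
     0 \<le> snd P + int (endc x) \<and> snd P + int (endc x) < int (nc x)"

definition symbol_at :: "int \<times> int \<Rightarrow> nat \<Rightarrow> nat" where
  "symbol_at P x = expn x $$ (nat (fst P + int (endr x)), nat (snd P + int (endc x)))"

lemma inside_here: "inside (here v i j) v \<longleftrightarrow> i < nr v \<and> j < nc v"
  by (auto simp: inside_def here_def)

lemma symbol_at_here: "symbol_at (here v i j) v = expn v $$ (i, j)"
  by (simp add: symbol_at_def here_def)

lemma inside_sc:
  assumes "sc v = Some u" "inside P u"
  shows "inside P v" "symbol_at P v = symbol_at P u"
proof -
  note p = sc_place [OF assms(1)]
  have e: "int (endr v) = int (offr v u) + int (endr u)" "int (endc v) = int (offc v u) + int (endc u)"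
    using endr_Some [OF assms(1)] endc_Some [OF assms(1)] by simp_all
  show "inside P v" using assms(2) p(1,2) e unfolding inside_def by linarith
  have "nat (fst P + int (endr v)) = offr v u + nat (fst P + int (endr u))"
    "nat (snd P + int (endc v)) = offc v u + nat (snd P + int (endc u))"
    using e assms(2) by (simp_all add: inside_def nat_eq_iff)
  moreover have "nat (fst P + int (endr u)) < nr u" "nat (snd P + int (endc u)) < nc u"
    using assms(2) by (auto simp: inside_def)
  ultimately show "symbol_at P v = symbol_at P u" by (simp add: symbol_at_def p(3))
qed

lemma inside_spath:
  assumes "x \<in> set (spath v)" "inside P x"
  shows "inside P v \<and> symbol_at P v = symbol_at P x"
  using assms
proof (induction v rule: sc_induct)
  case (Some v u)
  then show ?case using inside_sc [OF Some(1), of P] by (auto simp: spath_Some)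
qed (simp add: spath_None)

lemma end_spath:
  assumes "x \<in> set (spath v)"
  shows "endr x \<le> endr v \<and> endr v - endr x + nr x \<le> nr v \<and> endc x \<le> endc v \<and> endc v - endc x + nc x \<le> nc v"
  using assms
proof (induction v rule: sc_induct)
  case (Some v u)
  show ?case
  proof (cases "x = v")
    case False
    then have "x \<in> set (spath u)" using Some by (simp add: spath_Some)
    then show ?thesis
      using Some(2) sc_place(1,2) [OF Some(1)] endr_Some [OF Some(1)] endc_Some [OF Some(1)] by auto
  qed simp
qed (simp add: spath_None)

lemma inside_here_iff:
  assumes "x \<in> set (spath v)"
  shows "inside (here v i j) x \<longleftrightarrow> endr v - endr x \<le> i \<and> i < endr v - endr x + nr x \<and>
    endc v - endc x \<le> j \<and> j < endc v - endc x + nc x"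
  using end_spath [OF assms] by (auto simp: inside_def here_def)

lemma here_move:
  assumes "x \<in> set (spath v)" "inside (here v i j) x"
  shows "here x (i - (endr v - endr x)) (j - (endc v - endc x)) = here v i j"
  using end_spath [OF assms(1)] assms(2) unfolding inside_here_iff [OF assms(1)]
  by (auto simp: here_def)

text \<open>By nesting, the chain elements that miss the cell are those at the end of the chain, so
  this number is the depth of the last covering element whenever there is one.\<close>

definition outer :: "int \<times> int \<Rightarrow> nat \<Rightarrow> nat" where
  "outer P v = length (filter (\<lambda>x. \<not> inside P x) (chain v))"

lemma inside_chain_iff:
  assumes "d \<le> depth v"
  shows "inside P (chain v ! (depth v - d)) \<longleftrightarrow> outer P v \<le> d"
proof -
  have s: "sorted_wrt (\<lambda>x y. inside P y \<longrightarrow> inside P x) (chain v)"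
    using sorted_chain_spath [of v] by (rule sorted_wrt_mono_rel [rotated]) (use inside_spath in blast)
  have "length (filter (inside P) (chain v)) + outer P v = Suc (depth v)"
    unfolding outer_def length_chain_depth [symmetric] by (rule sum_length_filter_compl)
  then show ?thesis
    using nth_iff_less_length_filter [OF s, of "depth v - d"] assms length_chain_depth [of v] by auto
qed

lemma inside_iff_outer: "inside P v \<longleftrightarrow> outer P v \<le> depth v"
  using inside_chain_iff [of "depth v" v P] by simp

definition top_prio :: "int \<times> int \<Rightarrow> nat \<Rightarrow> nat" where
  "top_prio P v = prio (chain v ! (depth v - outer P v))"

text \<open>A step along the chain only cuts off covering elements at the front. It leaves the
  potential unchanged, and what decreases is the number of remaining chain steps.\<close>

lemma chain_move:
  assumes "d \<le> depth v" "inside P (chain v ! (depth v - d))"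
  defines "x \<equiv> chain v ! (depth v - d)"
  shows "outer P x = outer P v" "top_prio P x = top_prio P v"
proof -
  have cx: "chain x = drop (depth v - d) (chain v)" "depth x = d"
    using chain_at [OF assms(1)] by (simp_all add: x_def)
  have t: "outer P v \<le> d" using inside_chain_iff [OF assms(1)] assms(2) by simp
  have "inside P y" if y: "y \<in> set (take (depth v - d) (chain v))" for y
  proof -
    obtain k where k: "k < depth v - d" "y = chain v ! k" using y by (auto simp: in_set_conv_nth)
    then have e: "depth v - (depth v - k) = k" "depth v - k \<le> depth v" by auto
    show ?thesis using inside_chain_iff [OF e(2), of P] k t unfolding e(1) by simp
  qed
  then have "filter (\<lambda>x. \<not> inside P x) (take (depth v - d) (chain v)) = []"
    by (simp add: filter_empty_conv)
  moreover have "filter (\<lambda>x. \<not> inside P x) (chain v) =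
      filter (\<lambda>x. \<not> inside P x) (take (depth v - d) (chain v)) @ filter (\<lambda>x. \<not> inside P x) (chain x)"
    unfolding cx(1) filter_append [symmetric] by simp
  ultimately show o: "outer P x = outer P v" by (simp add: outer_def)
  show "top_prio P x = top_prio P v"
    unfolding top_prio_def o cx using t assms(1) length_chain_depth [of v] by simp
qed

lemma top_prio_le:
  assumes "v \<in> V" "inside P v"
  shows "top_prio P v \<le> floor_log (area v)"
proof -
  have "chain v ! (depth v - outer P v) \<in> set (spath v)"
    using set_chain [of v] length_chain_depth [of v] by (auto intro!: nth_mem)
  then show ?thesis
    unfolding top_prio_def using prio_le spath_same [OF _ assms(1)] by metis
qed

text \<open>Here \<open>v\<close> is the only element of its chain that covers the cell. A covering
  record of the successor's chain with a larger priority would survive the popping at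
  \<open>v\<close> and so lie on the chain of \<open>v\<close>; an equal priority is excluded by
  \<open>chain_prio_neq\<close>.\<close>

lemma top_prio_sc:
  assumes sc: "sc v = Some u" and "inside P u" "outer P v = depth v"
  shows "top_prio P u < top_prio P v"
proof -
  define y where "y = chain u ! (depth u - outer P u)"
  have le: "outer P u \<le> depth u" using assms(2) by (simp add: inside_iff_outer)
  have y: "y \<in> set (chain u)" "inside P y"
    using inside_chain_iff [OF le, of P] length_chain_depth [of u] by (auto simp: y_def)
  have "\<not> prio v < prio y"
  proof
    assume "prio v < prio y"
    then have "y \<in> set (dropWhile (\<lambda>x. prio x \<le> prio v) (chain u))"
      using y(1) by (metis Un_iff linorder_not_less set_append set_takeWhileD takeWhile_dropWhile_id)
    then have "y \<in> set (tl (chain v))" by (simp add: chain_Some [OF sc])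
    then obtain k where "k < depth v" "y = tl (chain v) ! k" by (auto simp: in_set_conv_nth depth_def)
    then have k: "k < depth v" "y = chain v ! Suc k" by (simp_all add: nth_tl depth_def)
    then have "y = chain v ! (depth v - (depth v - Suc k))" by (simp add: Suc_diff_Suc)
    then show False using inside_chain_iff [of "depth v - Suc k" v P] y(2) assms(3) k(1) by simp
  qed
  moreover have "prio y \<noteq> prio v" by (rule chain_prio_neq [OF sc y(1)])
  moreover have "top_prio P v = prio v" using assms(3) by (simp add: top_prio_def)
  ultimately show ?thesis by (simp add: top_prio_def [of P u] y_def [symmetric])
qed

section \<open>Potential and number of steps of a query\<close>

definition lev :: "nat \<Rightarrow> nat" where
  "lev v = floor_log (area v) + (floor_log (2 * cells) - floor_log (rho v))"

lemma lev_spath: "x \<in> set (spath v) \<Longrightarrow> v \<in> V \<Longrightarrow> lev x = lev v"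
  by (simp add: lev_def spath_same)

text \<open>Down an edge the level of the area cannot rise and the level of \<open>rho\<close>
  cannot fall, so both summands are non-increasing; they stay fixed together only within a
  class.\<close>

lemma lev_kid:
  assumes "v \<in> V" "c \<in> set (kids (rl v))" "sc v \<noteq> Some c"
  shows "lev c < lev v"
proof -
  have c: "c \<in> V" using assms V.kid by blast
  have "floor_log (area c) \<le> floor_log (area v)" "floor_log (rho v) \<le> floor_log (rho c)"
    "floor_log (rho c) \<le> floor_log (2 * cells)"
    using area_kid [OF assms(1,2)] rho_kid_le [OF assms(1,2)] rho_le [OF c] by (auto intro!: floor_log_le_iff)
  moreover have "\<not> same v c" by (rule not_same_kid [OF assms])
  ultimately show ?thesis by (auto simp: lev_def same_def)
qed

definition kid_step :: "nat \<Rightarrow> nat \<Rightarrow> nat \<Rightarrow> nat \<times> nat \<times> nat" where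
  "kid_step v i j = (case rl v of Sym a \<Rightarrow> (v, i, j)
    | HCat B C \<Rightarrow> if j < nc B then (B, i, j) else (C, i, j - nc B)
    | VCat B C \<Rightarrow> if i < nr B then (B, i, j) else (C, i - nr B, j)
    | HRun k B \<Rightarrow> (B, i, j mod nc B)
    | VRun k B \<Rightarrow> (B, i mod nr B, j))"

lemma kid_step:
  assumes "v \<in> V" "i < nr v" "j < nc v" "kid_step v i j = (c, i', j')" "\<nexists>a. rl v = Sym a"
  shows "c \<in> set (kids (rl v))" "i' < nr c" "j' < nc c" "expn c $$ (i', j') = expn v $$ (i, j)"
    "sc v = Some c \<Longrightarrow> here c i' j' = here v i j"
proof -
  have "c \<in> set (kids (rl v)) \<and> i' < nr c \<and> j' < nc c \<and> expn c $$ (i', j') = expn v $$ (i, j) \<and>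
    (sc v = Some c \<longrightarrow> here c i' j' = here v i j)"
  proof (cases "rl v")
    case (HCat B C)
    have d: "sc v = Some c \<Longrightarrow> B \<noteq> C" using sc_kids_distinct HCat by blast
    show ?thesis using HCat assms(2-4) HCat_expn(3-6) [OF assms(1) HCat] d
      by (auto simp: kid_step_def here_def endr_Some endc_Some offr_def offc_def split: if_splits)
  next
    case (VCat B C)
    have d: "sc v = Some c \<Longrightarrow> B \<noteq> C" using sc_kids_distinct VCat by blast
    show ?thesis using VCat assms(2-4) VCat_expn(3-6) [OF assms(1) VCat] d
      by (auto simp: kid_step_def here_def endr_Some endc_Some offr_def offc_def split: if_splits)
  next
    case (HRun k B)
    have "sc v = None" using HRun by (simp add: sc_def)
    then show ?thesis using HRun assms(2-4) HRun_expn [OF assms(1) HRun] nc_pos [of B]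
      by (auto simp: kid_step_def)
  next
    case (VRun k B)
    have "sc v = None" using VRun by (simp add: sc_def)
    then show ?thesis using VRun assms(2-4) VRun_expn [OF assms(1) VRun] nr_pos [of B]
      by (auto simp: kid_step_def)
  qed (use assms(5) in auto)
  then show "c \<in> set (kids (rl v))" "i' < nr c" "j' < nc c" "expn c $$ (i', j') = expn v $$ (i, j)"
    "sc v = Some c \<Longrightarrow> here c i' j' = here v i j" by auto
qed

definition path_step :: "nat \<Rightarrow> nat \<Rightarrow> nat \<Rightarrow> nat \<Rightarrow> nat \<times> nat \<times> nat" where
  "path_step x v i j = (x, i - (endr v - endr x), j - (endc v - endc x))"

definition query_step :: "nat \<Rightarrow> nat \<Rightarrow> nat \<Rightarrow> nat \<times> nat \<times> nat" where
  "query_step v i j =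
    (if depth v \<noteq> 0 \<and> inside (here v i j) (jp v) then path_step (jp v) v i j
     else if depth v \<noteq> 0 \<and> inside (here v i j) (nx v) then path_step (nx v) v i j
     else kid_step v i j)"

definition run_bound :: nat where
  "run_bound = 3 * floor_log (Suc (floor_log cells)) + 2"

text \<open>The lexicographic order of the potential and the remaining chain steps, coded as a
  number in base \<open>run_bound\<close>, which exceeds every count of remaining chain steps. A
  step to a child lowers the high part and may reset the low one.\<close>

definition query_measure :: "nat \<Rightarrow> nat \<Rightarrow> nat \<Rightarrow> nat" where
  "query_measure v i j = (top_prio (here v i j) v + lev v) * run_bound +
     jump_steps (depth v) (outer (here v i j) v)"

lemma depth_le: "v \<in> V \<Longrightarrow> depth v \<le> floor_log cells"
  using length_chain [of v] floor_log_le_iff [OF area_le_cells [of v]] by (simp add: depth_def)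

lemma jump_steps_run_bound:
  assumes "v \<in> V" "inside P v"
  shows "jump_steps (depth v) (outer P v) < run_bound"
proof -
  have "jump_steps (depth v) (outer P v) \<le> 3 * floor_log (Suc (depth v)) + 1"
    by (rule jump_steps_le) (use assms(2) in \<open>simp add: inside_iff_outer\<close>)
  moreover have "floor_log (Suc (depth v)) \<le> floor_log (Suc (floor_log cells))"
    by (intro floor_log_le_iff) (simp add: depth_le assms)
  ultimately show ?thesis by (simp add: run_bound_def)
qed

lemma path_step_correct:
  assumes v: "v \<in> V" and ij: "i < nr v" "j < nc v" and d: "d \<le> depth v"
    and x: "x = chain v ! (depth v - d)" and ins: "inside (here v i j) x"
    and st: "path_step x v i j = (v', i', j')"
  shows "v' = x" "x \<in> V" "i' < nr x" "j' < nc x" "expn x $$ (i', j') = expn v $$ (i, j)"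
    "depth x = d" "outer (here x i' j') x = outer (here v i j) v"
    "top_prio (here x i' j') x = top_prio (here v i j) v" "lev x = lev v"
proof -
  have xs: "x \<in> set (spath v)" using chain_at(3) [OF d] set_chain x by auto
  show vx: "v' = x" using st by (simp add: path_step_def)
  have h: "here x i' j' = here v i j" using here_move [OF xs ins] st by (auto simp: path_step_def)
  show "x \<in> V" "lev x = lev v" using spath_same(1) [OF xs v] lev_spath [OF xs v] by auto
  show "i' < nr x" "j' < nc x" using ins inside_here [of x i' j'] unfolding h by auto
  show "expn x $$ (i', j') = expn v $$ (i, j)"
    using inside_spath [OF xs ins] symbol_at_here [of x i' j'] symbol_at_here [of v i j] unfolding h by simp
  show "depth x = d" using chain_at(2) [OF d] x by simp
  show "outer (here x i' j') x = outer (here v i j) v" "top_prio (here x i' j') x = top_prio (here v i j) v"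
    using chain_move [OF d] ins x unfolding h by auto
qed

lemma query_step_correct:
  assumes v: "v \<in> V" and ij: "i < nr v" "j < nc v" and r: "\<nexists>a. rl v = Sym a"
    and st: "query_step v i j = (v', i', j')"
  shows "v' \<in> V \<and> i' < nr v' \<and> j' < nc v' \<and> expn v' $$ (i', j') = expn v $$ (i, j) \<and>
    query_measure v' i' j' < query_measure v i j"
proof -
  let ?P = "here v i j" and ?d = "depth v"
  have ins: "inside ?P v" using ij by (simp add: inside_here)
  have le: "outer ?P v \<le> ?d" using ins by (simp add: inside_iff_outer)
  have jd: "jump_depth ?d \<le> ?d" by (rule jump_depth_le)
  have ij_iff: "inside ?P (jp v) \<longleftrightarrow> outer ?P v \<le> jump_depth ?d"
    unfolding jp_def by (rule inside_chain_iff [OF jd])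
  have in_iff: "inside ?P (nx v) \<longleftrightarrow> outer ?P v \<le> ?d - 1" if "?d \<noteq> 0"
    unfolding nx_at [OF that] by (rule inside_chain_iff) simp
  consider (jump) "?d \<noteq> 0" "outer ?P v \<le> jump_depth ?d"
    | (step) "?d \<noteq> 0" "\<not> outer ?P v \<le> jump_depth ?d" "outer ?P v \<le> ?d - 1"
    | (kid) "outer ?P v = ?d" "\<not> (?d \<noteq> 0 \<and> inside ?P (jp v))" "\<not> (?d \<noteq> 0 \<and> inside ?P (nx v))"
  proof (cases "?d = 0")
    case True
    then show ?thesis using kid le by simp
  next
    case False
    show ?thesis
    proof (cases "outer ?P v \<le> ?d - 1")
      case True
      then show ?thesis using jump step False by blast
    next
      case n: False
      \<comment> \<open>If not even the next chain element covers the cell, the jump target, which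
        is at least as far, does not cover it either.\<close>
      then have "outer ?P v = ?d" "\<not> outer ?P v \<le> jump_depth ?d"
        using le False jump_depth_less [of ?d] by auto
      then show ?thesis using kid n ij_iff in_iff [OF False] by blast
    qed
  qed
  then show ?thesis
  proof cases
    case jump
    then have "path_step (jp v) v i j = (v', i', j')" using st ij_iff by (simp add: query_step_def)
    note p = path_step_correct [OF v ij jd jp_def [of v] _ this]
    have "jump_steps ?d (outer ?P v) = Suc (jump_steps (jump_depth ?d) (outer ?P v))"
      using jump jump_depth_less [of ?d] by (subst jump_steps.simps) auto
    then show ?thesis using p jump ij_iff by (simp add: query_measure_def)
  next
    case step
    then have "path_step (nx v) v i j = (v', i', j')" using st ij_iff in_iff by (simp add: query_step_def)
    note p = path_step_correct [OF v ij _ nx_at [OF step(1)] _ this]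
    have "jump_steps ?d (outer ?P v) = Suc (jump_steps (?d - 1) (outer ?P v))"
      using step by (subst jump_steps.simps) auto
    then show ?thesis using p step in_iff by (simp add: query_measure_def)
  next
    case kid
    then have ks: "kid_step v i j = (v', i', j')" using st by (auto simp: query_step_def)
    note k = kid_step [OF v ij ks r]
    let ?P' = "here v' i' j'"
    have v': "v' \<in> V" by (rule V.kid [OF v k(1)])
    have ins': "inside ?P' v'" using k(2,3) by (simp add: inside_here)
    have tp: "top_prio ?P v = prio v" using kid(1) by (simp add: top_prio_def)
    have "top_prio ?P' v' + lev v' < top_prio ?P v + lev v"
    proof (cases "sc v = Some v'")
      case True
      then have h: "?P' = ?P" by (rule k(5))
      have "top_prio ?P v' < top_prio ?P v"
        using True ins' kid(1) unfolding h by (rule top_prio_sc)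
      moreover have "lev v' = lev v" using scD(5) [OF True] by (simp add: lev_def same_def)
      ultimately show ?thesis by (simp add: h)
    next
      case False
      \<comment> \<open>The new path may begin with the largest priority that its area admits. This
        is still at most \<open>prio v\<close>, and the strict decrease comes from
        \<open>lev\<close>.\<close>
      have "top_prio ?P' v' \<le> floor_log (area v')" by (rule top_prio_le [OF v' ins'])
      also have "\<dots> \<le> prio v"
      proof (cases "sc v")
        case None
        then show ?thesis using area_kid [OF v k(1)] by (simp add: prio_def key_def floor_log_le_iff)
      next
        case (Some u)
        then show ?thesis using light_sibling_level [OF Some k(1)] False by simp
      qed
      finally show ?thesis using lev_kid [OF v k(1) False] tp by simp
    qed
    then have "(top_prio ?P' v' + lev v') * run_bound + run_bound \<le> (top_prio ?P v + lev v) * run_bound"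
      by (metis Suc_leI add.commute mult_Suc mult_le_mono1)
    then have "query_measure v' i' j' < query_measure v i j"
      using jump_steps_run_bound [OF v' ins'] by (simp add: query_measure_def)
    then show ?thesis using v' k(2-4) by simp
  qed
qed

lemma query_measure_le:
  assumes "v \<in> V" "i < nr v" "j < nc v"
  shows "query_measure v i j \<le> (2 * floor_log cells + floor_log (2 * cells) + 1) * run_bound"
proof -
  have ins: "inside (here v i j) v" using assms by (simp add: inside_here)
  have "floor_log (area v) \<le> floor_log cells" using area_le_cells [OF assms(1)] by (rule floor_log_le_iff)
  then have "top_prio (here v i j) v + lev v \<le> 2 * floor_log cells + floor_log (2 * cells)"
    using top_prio_le [OF assms(1) ins] by (simp add: lev_def)
  then have "(top_prio (here v i j) v + lev v) * run_bound \<le>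
      (2 * floor_log cells + floor_log (2 * cells)) * run_bound" by (rule mult_le_mono1)
  then have "query_measure v i j \<le> (2 * floor_log cells + floor_log (2 * cells)) * run_bound + run_bound"
    unfolding query_measure_def using jump_steps_run_bound [OF assms(1) ins] by linarith
  then show ?thesis by (simp add: algebra_simps)
qed

end

section \<open>Programs on the word RAM\<close>

text \<open>A total-correctness triple with a time bound, for a single initial state.\<close>

definition reaches :: "nat \<Rightarrow> com \<Rightarrow> state \<Rightarrow> nat \<Rightarrow> (state \<Rightarrow> bool) \<Rightarrow> bool" where
  "reaches w p s T P \<longleftrightarrow> (\<exists>t s'. exec w p s t s' \<and> t \<le> T \<and> P s')"

lemma reaches_mono: "reaches w p s T P \<Longrightarrow> T \<le> T' \<Longrightarrow> (\<And>s'. P s' \<Longrightarrow> P' s') \<Longrightarrow> reaches w p s T' P'"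
  unfolding reaches_def by (meson order_trans)

lemma reaches_seq:
  assumes "reaches w p s T R" "\<And>s'. R s' \<Longrightarrow> reaches w q s' T' P" "T + T' \<le> T''"
  shows "reaches w (Seq p q) s T'' P"
proof -
  obtain t s' where 1: "exec w p s t s'" "t \<le> T" "R s'" using assms(1) by (auto simp: reaches_def)
  obtain t' s'' where 2: "exec w q s' t' s''" "t' \<le> T'" "P s''" using assms(2) [OF 1(3)] by (auto simp: reaches_def)
  show ?thesis unfolding reaches_def using exec.seq [OF 1(1) 2(1)] 1 2 assms(3) by (meson add_mono order_trans)
qed

lemma reaches_cond:
  assumes "exp_val w e s \<noteq> 0 \<Longrightarrow> reaches w p s T P" "exp_val w e s = 0 \<Longrightarrow> reaches w q s T P"
    "1 + exp_time e + T \<le> T'"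
  shows "reaches w (Cond e p q) s T' P"
proof (cases "exp_val w e s = 0")
  case True
  then obtain t s' where 1: "exec w q s t s'" "t \<le> T" "P s'" using assms(2) by (auto simp: reaches_def)
  show ?thesis unfolding reaches_def using exec.cond_false [OF True 1(1)] 1 assms(3)
    by (meson add_left_mono order_trans)
next
  case False
  then obtain t s' where 1: "exec w p s t s'" "t \<le> T" "P s'" using assms(1) by (auto simp: reaches_def)
  show ?thesis unfolding reaches_def using exec.cond_true [OF False 1(1)] 1 assms(3)
    by (meson add_left_mono order_trans)
qed

text \<open>The number \<open>n\<close> of rounds is known in advance, and the budget
  \<open>T\<close> may depend on the round; the amortised count of stack pops needs the
  latter.\<close>

lemma reaches_while:
  assumes step: "\<And>k s. k < n \<Longrightarrow> I k s \<Longrightarrow> exp_val w e s \<noteq> 0 \<and> reaches w p s (T k) (I (Suc k))"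
    and stop: "\<And>s. I n s \<Longrightarrow> exp_val w e s = 0" and init: "I 0 s"
  shows "reaches w (While e p) s ((\<Sum>k<n. T k) + Suc n * (1 + exp_time e)) (I n)"
proof -
  have "reaches w (While e p) s ((\<Sum>k\<in>{k..<n}. T k) + Suc (n - k) * (1 + exp_time e)) (I n)"
    if "k \<le> n" "I k s" for k s
    using that
  proof (induction k arbitrary: s rule: inc_induct)
    case base
    then show ?case unfolding reaches_def using exec.while_false [OF stop] by force
  next
    case (step k)
    note st = assms(1) [OF step.hyps(2) step.prems]
    from st obtain t s' where 1: "exec w p s t s'" "t \<le> T k" "I (Suc k) s'"
      by (auto simp: reaches_def)
    obtain t' s'' where 2: "exec w (While e p) s' t' s''"
      "t' \<le> (\<Sum>k\<in>{Suc k..<n}. T k) + Suc (n - Suc k) * (1 + exp_time e)" "I n s''"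
      using step.IH [OF 1(3)] by (auto simp: reaches_def)
    have "(\<Sum>k\<in>{k..<n}. T k) = T k + (\<Sum>k\<in>{Suc k..<n}. T k)"
      using step.hyps by (simp add: sum.atLeast_Suc_lessThan)
    moreover have "Suc (n - k) = Suc (Suc (n - Suc k))" using step.hyps by simp
    ultimately have "1 + exp_time e + t + t' \<le> (\<Sum>k\<in>{k..<n}. T k) + Suc (n - k) * (1 + exp_time e)"
      using 1(2) 2(2) by (simp only: mult_Suc)
    then show ?case unfolding reaches_def
      using exec.while_true [OF conjunct1 [OF st] 1(1) 2(1)] 2(3) by blast
  qed
  from this [of 0 s] init show ?thesis by (simp add: lessThan_atLeast0)
qed

text \<open>Only a decreasing measure limits the rounds, as in a query, whose length depends on the
  cell.\<close>

lemma reaches_while_measure: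
  fixes f :: "state \<Rightarrow> nat"
  assumes step: "\<And>s. I s \<Longrightarrow> exp_val w e s \<noteq> 0 \<Longrightarrow> reaches w p s T (\<lambda>s'. I s' \<and> f s' < f s)"
    and "I s" "f s \<le> n"
  shows "reaches w (While e p) s (Suc n * (1 + exp_time e + T)) (\<lambda>s'. I s' \<and> exp_val w e s' = 0)"
  using assms(2,3)
proof (induction n arbitrary: s rule: less_induct)
  case (less n)
  show ?case
  proof (cases "exp_val w e s = 0")
    case True
    then show ?thesis unfolding reaches_def using exec.while_false [OF True] less.prems by force
  next
    case False
    obtain t s' where 1: "exec w p s t s'" "t \<le> T" "I s'" "f s' < f s"
      using step [OF less.prems(1) False] by (auto simp: reaches_def)
    then have "f s' < n" "f s' \<le> f s'" using less.prems by auto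
    from less.IH [OF this(1) 1(3) this(2)] obtain t' s'' where 2: "exec w (While e p) s' t' s''"
      "t' \<le> Suc (f s') * (1 + exp_time e + T)" "I s''" "exp_val w e s'' = 0"
      by (auto simp: reaches_def)
    have "Suc (f s') * (1 + exp_time e + T) \<le> n * (1 + exp_time e + T)"
      using \<open>f s' < n\<close> by (intro mult_le_mono1) simp
    then have "1 + exp_time e + t + t' \<le> Suc n * (1 + exp_time e + T)"
      using 1(2) 2(2) by (simp only: mult_Suc)
    then show ?thesis unfolding reaches_def using exec.while_true [OF False 1(1) 2(1)] 2(3,4) by blast
  qed
qed

section \<open>Symbolic execution of loop-free programs\<close>

fun straight :: "com \<Rightarrow> bool" where
  "straight (Seq p q) = (straight p \<and> straight q)"
| "straight (Cond e p q) = (straight p \<and> straight q)"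
| "straight (While e p) = False"
| "straight _ = True"

fun run :: "nat \<Rightarrow> com \<Rightarrow> state \<Rightarrow> state" where
  "run w (Assign r e) s = s\<lparr>reg := (reg s)(r := exp_val w e s)\<rparr>"
| "run w (Store e e') s = s\<lparr>mem := (mem s)(exp_val w e s := exp_val w e' s)\<rparr>"
| "run w (Seq p q) s = run w q (run w p s)"
| "run w (Cond e p q) s = (if exp_val w e s = 0 then run w q s else run w p s)"
| "run w _ s = s"

fun cost :: "com \<Rightarrow> nat" where
  "cost (Assign r e) = 1 + exp_time e"
| "cost (Store e e') = 1 + exp_time e + exp_time e'"
| "cost (Seq p q) = cost p + cost q"
| "cost (Cond e p q) = 1 + exp_time e + max (cost p) (cost q)"
| "cost _ = 1"

lemma reaches_straight: "straight p \<Longrightarrow> cost p \<le> T \<Longrightarrow> P (run w p s) \<Longrightarrow> reaches w p s T P"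
proof (induction p arbitrary: s T P)
  case Skip
  then show ?case unfolding reaches_def using exec.skip by force
next
  case (Assign r e)
  then show ?case unfolding reaches_def using exec.assign by force
next
  case (Store e e')
  then show ?case unfolding reaches_def using exec.store by force
next
  case (Seq p q)
  have "reaches w p s (cost p) (\<lambda>s'. s' = run w p s)" using Seq by simp
  then show ?case by (rule reaches_seq [where T' = "cost q"]) (use Seq in auto)
next
  case (Cond e p q)
  then show ?case by (intro reaches_cond [where T = "max (cost p) (cost q)"]) auto
qed simp

fun seqs :: "com list \<Rightarrow> com" where
  "seqs [] = Skip"
| "seqs [p] = p"
| "seqs (p # ps) = Seq p (seqs ps)"

text \<open>The \<open>3 * N\<close> input words are followed by \<open>N\<close> scratch records
  and \<open>N\<close> output records of 16 words each, so all addresses lie below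
  \<open>35 * N\<close>. This is covered by the factor 64 in the assumptions on the word
  length.\<close>

definition inp :: "nat \<Rightarrow> nat \<Rightarrow> nat" where "inp v f = 3 * v + f"
definition fld :: "nat \<Rightarrow> nat \<Rightarrow> nat \<Rightarrow> nat" where "fld N v f = 3 * N + 16 * v + f"
definition out :: "nat \<Rightarrow> nat \<Rightarrow> nat \<Rightarrow> nat" where "out N v f = 19 * N + 16 * v + f"

text \<open>Preprocessing keeps the base addresses \<open>3 * N\<close> of the scratch records and \<open>19 * N\<close> of the
  output records, \<open>N\<close> being the number of rules, in registers 2 and 3. The scratch record of a variable:
  0 number of incoming edges not yet processed, 1 path count, 2 position in the topological order,
  4 rows, 5 columns, 6 key, 7 next chain element, 8 depth of the chain, 9 jump pointer, 10 and 11 offset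
  of the end of the path. Fields 3 and 12 of the record with index \<open>i\<close> are entry \<open>i\<close> of the two queues.\<close>

definition e_inp :: "exp \<Rightarrow> nat \<Rightarrow> exp" where
  "e_inp e f = Load (Bin Add (Bin Mul (Const 3) e) (Const f))"
definition e_fld :: "exp \<Rightarrow> nat \<Rightarrow> exp" where
  "e_fld e f = Load (Bin Add (Reg 2) (Bin Add (Bin Mul (Const 16) e) (Const f)))"
definition s_fld :: "exp \<Rightarrow> nat \<Rightarrow> exp \<Rightarrow> com" where
  "s_fld e f x = Store (Bin Add (Reg 2) (Bin Add (Bin Mul (Const 16) e) (Const f))) x"
definition s_out :: "exp \<Rightarrow> nat \<Rightarrow> exp \<Rightarrow> com" where
  "s_out e f x = Store (Bin Add (Reg 3) (Bin Add (Bin Mul (Const 16) e) (Const f))) x"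

lemma fld_eq_iff [simp]: "f < 16 \<Longrightarrow> g < 16 \<Longrightarrow> fld N v f = fld N u g \<longleftrightarrow> v = u \<and> f = g"
  unfolding fld_def by (cases v u rule: linorder_cases) auto
lemma out_eq_iff [simp]: "f < 16 \<Longrightarrow> g < 16 \<Longrightarrow> out N v f = out N u g \<longleftrightarrow> v = u \<and> f = g"
  unfolding out_def by (cases v u rule: linorder_cases) auto
lemma fld_neq_out [simp]: "v < N \<Longrightarrow> f < 16 \<Longrightarrow> fld N v f \<noteq> out N u g"
    "v < N \<Longrightarrow> f < 16 \<Longrightarrow> out N u g \<noteq> fld N v f"
  unfolding fld_def out_def by linarith+
lemma inp_neq [simp]: "v < N \<Longrightarrow> f < 3 \<Longrightarrow> inp v f \<noteq> fld N u g" "v < N \<Longrightarrow> f < 3 \<Longrightarrow> fld N u g \<noteq> inp v f"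
    "v < N \<Longrightarrow> f < 3 \<Longrightarrow> inp v f \<noteq> out N u g" "v < N \<Longrightarrow> f < 3 \<Longrightarrow> out N u g \<noteq> inp v f"
  unfolding fld_def out_def inp_def by linarith+

lemma time_simps [simp]: "exp_time (e_inp e f) = 5 + exp_time e" "exp_time (e_fld e f) = 7 + exp_time e"
    "cost (s_fld e f x) = 7 + exp_time e + exp_time x" "cost (s_out e f x) = 7 + exp_time e + exp_time x"
    "straight (s_fld e f x)" "straight (s_out e f x)"
  by (simp_all add: e_inp_def e_fld_def s_fld_def s_out_def)

text \<open>The modular equations are removed from the simplifier below, so exactness of a sum,
  difference or product has to come from a bound on its operands.\<close>

lemma binop_val_exact:
  "x + y < 2 ^ w \<Longrightarrow> binop_val w Add x y = x + y"
  "y \<le> x \<Longrightarrow> x < 2 ^ w \<Longrightarrow> binop_val w Sub x y = x - y"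
  "x * y < 2 ^ w \<Longrightarrow> binop_val w Mul x y = x * y"
  "1 < w \<Longrightarrow> binop_val w Less x y = of_bool (x < y)"
  "1 < w \<Longrightarrow> binop_val w Eq x y = of_bool (x = y)"
proof -
  show "binop_val w Sub x y = x - y" if "y \<le> x" "x < 2 ^ w"
  proof -
    have "2 ^ w + x - y = x - y + 2 ^ w" "x - y < 2 ^ w" using that by linarith+
    then show ?thesis by (simp only: binop_val.simps mod_add_self2 mod_less)
  qed
  have "1 < w \<Longrightarrow> (1::nat) mod 2 ^ w = 1"
    using power_gt1 [of "2::nat" "w - 1"] by (intro mod_less) simp
  then show "1 < w \<Longrightarrow> binop_val w Less x y = of_bool (x < y)"
    "1 < w \<Longrightarrow> binop_val w Eq x y = of_bool (x = y)" by simp_all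
qed simp_all

declare binop_val.simps(1-3,11,12) [simp del] exp_val.simps(1) [simp del]

fun tag :: "rule \<Rightarrow> nat" where
  "tag (Sym a) = 0" | "tag (HCat B C) = 1" | "tag (VCat B C) = 2" | "tag (HRun k B) = 3" | "tag (VRun k B) = 4"
fun arg1 :: "rule \<Rightarrow> nat" where
  "arg1 (Sym a) = a" | "arg1 (HCat B C) = B" | "arg1 (VCat B C) = B" | "arg1 (HRun k B) = k" | "arg1 (VRun k B) = k"
fun arg2 :: "rule \<Rightarrow> nat" where
  "arg2 (Sym a) = 0" | "arg2 (HCat B C) = C" | "arg2 (VCat B C) = C" | "arg2 (HRun k B) = B" | "arg2 (VRun k B) = B"

lemma encode_rule_eq: "encode_rule r = [tag r, arg1 r, arg2 r]"
  by (cases r) auto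

lemma length_encode: "length (encode G) = 3 * length (rules G)"
  unfolding encode_def by (induction "rules G" arbitrary: G rule: list.induct)
    (simp_all add: length_concat comp_def encode_rule_eq sum_list_triv)

lemma encode_nth:
  assumes "v < length (rules G)" "f < 3"
  shows "encode G ! inp v f = [tag (rules G ! v), arg1 (rules G ! v), arg2 (rules G ! v)] ! f"
proof -
  have "concat (map encode_rule rs) ! (3 * v + f) = encode_rule (rs ! v) ! f" if "v < length rs" for rs
    using that
  proof (induction rs arbitrary: v)
    case (Cons r rs)
    have "f = 0 \<or> f = 1 \<or> f = 2" using assms(2) by linarith
    with Cons show ?case by (cases v) (auto simp: encode_rule_eq)
  qed simp
  then show ?thesis using assms by (simp add: encode_def inp_def encode_rule_eq)
qed

text \<open>Registers 6 and 7 hold the variable and the kind of its rule.\<close>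

definition each_kid :: "com \<Rightarrow> com" where
  "each_kid p = Cond (Reg 7)
     (seqs [Assign 8 (e_inp (Reg 6) 2), p,
        Cond (Bin Less (Reg 7) (Const 3)) (Seq (Assign 8 (e_inp (Reg 6) 1)) p) Skip])
     Skip"

locale slp2d_machine = slp2d +
  fixes w :: nat
  assumes word_rules: "64 * N \<le> 2 ^ w" and word_cells: "64 * cells \<le> 2 ^ w"
begin

lemma N_pos: "0 < N"
  using rlslp by (auto simp: rlslp_def)

lemma word_64: "64 \<le> (2::nat) ^ w"
  using word_rules N_pos by linarith

lemma w_gt_1: "1 < w"
proof (rule ccontr)
  assume "\<not> 1 < w"
  then have "(2::nat) ^ w \<le> 2 ^ 1" by (intro power_increasing) auto
  then show False using word_64 by simp
qed

lemma val_Const [simp]: "k < 64 \<Longrightarrow> exp_val w (Const k) s = k"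
  using word_64 by (simp add: exp_val.simps(1))

lemmas val_compare [simp] = binop_val_exact(4,5) [OF w_gt_1]

lemma val_inp [simp]:
  assumes "exp_val w e s < N" "f < 3"
  shows "exp_val w (e_inp e f) s = mem s (inp (exp_val w e s) f)"
  using assms word_rules by (simp add: e_inp_def inp_def binop_val_exact)

lemma val_fld [simp]:
  assumes "reg s 2 = 3 * N" "exp_val w e s < N" "f < 16"
  shows "exp_val w (e_fld e f) s = mem s (fld N (exp_val w e s) f)"
  using assms word_rules by (simp add: e_fld_def fld_def binop_val_exact add.assoc)

lemma run_s_fld [simp]:
  assumes "reg s 2 = 3 * N" "exp_val w e s < N" "f < 16"
  shows "run w (s_fld e f x) s = s\<lparr>mem := (mem s)(fld N (exp_val w e s) f := exp_val w x s)\<rparr>"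
  using assms word_rules by (simp add: s_fld_def fld_def binop_val_exact add.assoc)

lemma run_s_out [simp]:
  assumes "reg s 3 = 19 * N" "exp_val w e s < N" "f < 16"
  shows "run w (s_out e f x) s = s\<lparr>mem := (mem s)(out N (exp_val w e s) f := exp_val w x s)\<rparr>"
  using assms word_rules by (simp add: s_out_def out_def binop_val_exact add.assoc)

lemma card_V: "card V \<le> N"
  using card_mono [of "{..<N}" V] V_less by auto

definition holds_rules :: "state \<Rightarrow> bool" where
  "holds_rules s \<longleftrightarrow> reg s 0 = N \<and> reg s 1 = start G \<and> reg s 2 = 3 * N \<and> reg s 3 = 19 * N \<and>
     (\<forall>v<N. mem s (inp v 0) = tag (rl v) \<and> mem s (inp v 1) = arg1 (rl v) \<and> mem s (inp v 2) = arg2 (rl v))"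

text \<open>The invariant is indexed by the children visited so far. Register 8 is overwritten
  between the visits, so the invariant has to be insensitive to it. There are at most two visits,
  hence \<open>2 * T\<close>.\<close>

lemma each_kid:
  assumes v: "v < N"
    and J: "\<And>E s. J E s \<Longrightarrow> holds_rules s \<and> reg s 6 = v \<and> reg s 7 = tag (rl v)"
    and J8: "\<And>E s c. J E s \<Longrightarrow> J E (s\<lparr>reg := (reg s)(8 := c)\<rparr>)"
    and visit: "\<And>E E' c s. kids (rl v) = E @ c # E' \<Longrightarrow> J E s \<Longrightarrow> reg s 8 = c \<Longrightarrow> reaches w p s T (J (E @ [c]))"
    and init: "J [] s"
  shows "reaches w (each_kid p) s (2 * T + 30) (J (kids (rl v)))"
proof -
  have val: "exp_val w (e_inp (Reg 6) f) s = (if f = 1 then arg1 (rl v) else if f = 2 then arg2 (rl v) else tag (rl v))"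
    if "J E s" "f < 3" for E s f
    using J [OF that(1)] that(2) v by (cases f; cases "f - 1") (auto simp: holds_rules_def numeral_2_eq_2 less_Suc_eq)
  have asg: "reaches w (Assign 8 (e_inp (Reg 6) f)) s 7
      (\<lambda>s'. J E s' \<and> reg s' 8 = (if f = 1 then arg1 (rl v) else arg2 (rl v)))"
    if "J E s" "f = 1 \<or> f = 2" for E s f
    using that val [OF that(1), of f] by (intro reaches_straight) (auto intro: J8)
  have skip: "reaches w Skip s 1 (J E)" if "J E s" for E s
    using that by (intro reaches_straight) auto
  have two: ?thesis if k: "kids (rl v) = [c2, c1]" "arg1 (rl v) = c1" "arg2 (rl v) = c2" "tag (rl v) \<noteq> 0" "tag (rl v) < 3" for c1 c2
    unfolding each_kid_def seqs.simps
  proof (rule reaches_cond [where T = "2 * T + 20"])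
    show "reaches w (Seq (Assign 8 (e_inp (Reg 6) 2)) (Seq p (Cond (Bin Less (Reg 7) (Const 3))
       (Seq (Assign 8 (e_inp (Reg 6) 1)) p) Skip))) s (2 * T + 20) (J (kids (rl v)))"
      apply (rule reaches_seq [OF asg [OF init], where T' = "2 * T + 13"])
        apply simp
       apply (rule reaches_seq [where T = T and T' = "T + 13" and R = "J [c2]"])
         apply (use visit [of "[]" c2 "[c1]"] k in simp)
        apply (rule reaches_cond [where T = "T + 7"])
          apply (rule reaches_seq [OF asg [where E = "[c2]"], where T' = T])
             apply simp
            apply simp
           apply (use visit [of "[c2]" c1 "[]"] k in simp)
          apply simp
         apply (use J [of "[c2]"] k in force)
        apply simp
       apply simp
      apply simp
      done
  qed (use J [OF init] k in auto)
  have one: ?thesis if k: "kids (rl v) = [c2]" "arg2 (rl v) = c2" "tag (rl v) \<noteq> 0" "\<not> tag (rl v) < 3" for c2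
    unfolding each_kid_def seqs.simps
  proof (rule reaches_cond [where T = "2 * T + 20"])
    show "reaches w (Seq (Assign 8 (e_inp (Reg 6) 2)) (Seq p (Cond (Bin Less (Reg 7) (Const 3))
       (Seq (Assign 8 (e_inp (Reg 6) 1)) p) Skip))) s (2 * T + 20) (J (kids (rl v)))"
      apply (rule reaches_seq [OF asg [OF init], where T' = "T + 10"])
        apply simp
       apply (rule reaches_seq [where T = T and T' = 10 and R = "J [c2]"])
         apply (use visit [of "[]" c2 "[]"] k in simp)
        apply (rule reaches_cond [where T = 1])
          apply (use J [of "[c2]"] k in force)
         apply (use skip [of "[c2]"] k in simp)
        apply simp
       apply simp
      apply simp
      done
  qed (use J [OF init] k in auto)
  have none: ?thesis if k: "kids (rl v) = []" "tag (rl v) = 0"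
    unfolding each_kid_def
    by (rule reaches_cond [where T = 1]) (use J [OF init] k skip [OF init] in auto)
  show ?thesis
    by (cases "rl v") (use none one two in auto)
qed

end

section \<open>Reachable variables\<close>

text \<open>The counter of incoming edges doubles as the visited mark. The start variable carries no
  mark, but its area is maximal and areas decrease along edges, so it is no child of a reachable
  variable. The final counters are those that the topological sort counts down.\<close>

definition bfs_visit :: com where
  "bfs_visit = Seq (Cond (e_fld (Reg 8) 0) Skip
       (Seq (s_fld (Reg 5) 3 (Reg 8)) (Assign 5 (Bin Add (Reg 5) (Const 1)))))
     (s_fld (Reg 8) 0 (Bin Add (e_fld (Reg 8) 0) (Const 1)))"

definition bfs_setup :: com where
  "bfs_setup = seqs [Assign 2 (Bin Mul (Const 3) (Reg 0)), Assign 3 (Bin Mul (Const 19) (Reg 0)),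
     Assign 5 (Const 1), s_fld (Const 0) 3 (Reg 1)]"

definition bfs_body :: com where
  "bfs_body = seqs [Assign 6 (e_fld (Reg 4) 3), Assign 7 (e_inp (Reg 6) 0), each_kid bfs_visit,
     Assign 4 (Bin Add (Reg 4) (Const 1))]"

definition bfs :: com where
  "bfs = Seq bfs_setup (While (Bin Less (Reg 4) (Reg 5)) bfs_body)"

lemma count_list_concat: "count_list (concat xss) x = (\<Sum>xs\<leftarrow>xss. count_list xs x)"
  by (induction xss) auto

context slp2d_machine
begin

text \<open>The edges scanned so far with multiplicity, in visiting order; the machine counters are
  occurrence counts in this list.\<close>

definition qkids :: "nat list \<Rightarrow> nat \<Rightarrow> nat list" where
  "qkids Q k = concat (map (\<lambda>v. kids (rl v)) (take k Q))"

lemma qkids_0 [simp]: "qkids Q 0 = []"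
  by (simp add: qkids_def)

lemma qkids_Suc: "k < length Q \<Longrightarrow> qkids Q (Suc k) = qkids Q k @ kids (rl (Q ! k))"
  by (simp add: qkids_def take_Suc_conv_app_nth)

lemma qkids_append: "k \<le> length Q \<Longrightarrow> qkids (Q @ Q') k = qkids Q k"
  by (simp add: qkids_def)

lemma length_kids: "length (kids r) \<le> 2"
  by (cases r) auto

lemma length_qkids: "k \<le> length Q \<Longrightarrow> length (qkids Q k) \<le> 2 * k"
proof (induction k)
  case (Suc k)
  then show ?case using length_kids [of "rl (Q ! k)"] by (simp add: qkids_Suc)
qed simp

definition total_in :: "nat \<Rightarrow> nat" where
  "total_in c = (\<Sum>v\<in>V. count_list (kids (rl v)) c)"

lemma count_qkids:
  assumes "distinct Q" "k \<le> length Q"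
  shows "count_list (qkids Q k) c = (\<Sum>v\<in>set (take k Q). count_list (kids (rl v)) c)"
  using assms sum_list_distinct_conv_sum_set [of "take k Q" "\<lambda>v. count_list (kids (rl v)) c"]
  by (simp add: qkids_def count_list_concat comp_def)

lemma kid_neq_start: "v \<in> V \<Longrightarrow> c \<in> set (kids (rl v)) \<Longrightarrow> c \<noteq> start G"
  using area_kid area_le_cells area_start by fastforce

definition scratch_clear :: "nat set \<Rightarrow> state \<Rightarrow> bool" where
  "scratch_clear F s \<longleftrightarrow> (\<forall>v<N. \<forall>f<16. f \<notin> F \<longrightarrow> mem s (fld N v f) = 0) \<and> (\<forall>i<N. \<forall>f<16. mem s (out N i f) = 0)"

definition bfs_state :: "nat list \<Rightarrow> nat list \<Rightarrow> state \<Rightarrow> bool" where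
  "bfs_state E Q s \<longleftrightarrow> holds_rules s \<and> reg s 5 = length Q \<and> (\<forall>i<length Q. mem s (fld N i 3) = Q ! i) \<and>
     (\<forall>c<N. mem s (fld N c 0) = count_list E c) \<and> scratch_clear {0, 3} s \<and>
     distinct Q \<and> set Q = insert (start G) (set E) \<and> set Q \<subseteq> V \<and> Q \<noteq> []"

lemma length_less_N:
  assumes "distinct Q" "set Q \<subseteq> V" "c \<in> V" "c \<notin> set Q"
  shows "length Q < N"
proof -
  have "card (set Q) < card V" using assms finite_V by (intro psubset_card_mono) auto
  then show ?thesis using card_V assms(1) by (simp add: distinct_card)
qed

lemma bfs_visit:
  assumes st: "bfs_state E Q s" and c: "reg s 8 = c" "c \<in> V" "c \<noteq> start G" and len: "length E \<le> 2 * N + 2"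
  shows "reaches w bfs_visit s 60 (\<lambda>s'. \<exists>Q'. bfs_state (E @ [c]) (Q @ Q') s' \<and>
    reg s' 4 = reg s 4 \<and> reg s' 6 = reg s 6 \<and> reg s' 7 = reg s 7)"
proof (rule reaches_straight)
  have cN: "c < N" by (rule V_less [OF c(2)])
  have m0: "mem s (fld N c 0) = count_list E c" and r2: "reg s 2 = 3 * N"
    using st cN by (auto simp: bfs_state_def holds_rules_def)
  have cl: "count_list E c + 1 < 2 ^ w"
    using count_le_length [of E c] len word_rules N_pos by linarith
  have inQ: "c \<in> set Q \<longleftrightarrow> count_list E c \<noteq> 0"
    using st c(3) by (auto simp: bfs_state_def count_list_0_iff)
  show "\<exists>Q'. bfs_state (E @ [c]) (Q @ Q') (run w bfs_visit s) \<and> reg (run w bfs_visit s) 4 = reg s 4 \<and>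
    reg (run w bfs_visit s) 6 = reg s 6 \<and> reg (run w bfs_visit s) 7 = reg s 7"
  proof (cases "count_list E c = 0")
    case False
    then have "run w bfs_visit s = s\<lparr>mem := (mem s)(fld N c 0 := count_list E c + 1)\<rparr>"
      using c(1) cN m0 r2 cl by (simp add: bfs_visit_def binop_val_exact)
    then show ?thesis using st cN c False inQ
      by (intro exI [of _ "[]"]) (auto simp: bfs_state_def holds_rules_def scratch_clear_def)
  next
    case True
    have cQ: "c \<notin> set Q" using True inQ by simp
    have lq: "length Q < N" using length_less_N [of Q c] st c cQ by (auto simp: bfs_state_def)
    have r5: "reg s 5 = length Q" using st by (simp add: bfs_state_def)
    have "length Q + 1 < 2 ^ w" using lq word_rules by linarith
    then have "run w bfs_visit s = s\<lparr>reg := (reg s)(5 := length Q + 1),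
        mem := (mem s)(fld N (length Q) 3 := c, fld N c 0 := 1)\<rparr>"
      using c(1) cN m0 r2 r5 cl lq True by (simp add: bfs_visit_def binop_val_exact)
    then show ?thesis using st cN c True cQ lq
      by (intro exI [of _ "[c]"]) (auto simp: bfs_state_def holds_rules_def scratch_clear_def nth_append less_Suc_eq)
  qed
qed (simp_all add: bfs_visit_def)

definition bfs_inv :: "nat \<Rightarrow> state \<Rightarrow> bool" where
  "bfs_inv k s \<longleftrightarrow> reg s 4 = k \<and> (\<exists>Q. k \<le> length Q \<and> bfs_state (qkids Q k) Q s)"

lemma bfs_closed:
  assumes "set Q = insert (start G) (set (qkids Q (length Q)))" "set Q \<subseteq> V"
  shows "set Q = V"
proof -
  have "v \<in> set Q" if "v \<in> V" for v
    using that
  proof induction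
    case (kid v c)
    then show ?case by (subst assms(1)) (auto simp: qkids_def)
  qed (subst assms(1), simp)
  then show ?thesis using assms(2) by auto
qed

lemma bfs_body:
  assumes k: "k < card V" and inv: "bfs_inv k s"
  shows "exp_val w (Bin Less (Reg 4) (Reg 5)) s \<noteq> 0 \<and> reaches w bfs_body s 200 (bfs_inv (Suc k))"
proof -
  obtain Q where Q: "k \<le> length Q" "bfs_state (qkids Q k) Q s" and r4: "reg s 4 = k"
    using inv by (auto simp: bfs_inv_def)
  have r5: "reg s 5 = length Q" and QV: "set Q \<subseteq> V" and dQ: "distinct Q"
    using Q(2) by (auto simp: bfs_state_def)
  \<comment> \<open>A queue that ran dry would be closed under children and hence contain all of
    \<open>V\<close>, so the loop makes exactly \<open>card V\<close> rounds.\<close>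
  have "k \<noteq> length Q"
  proof
    assume "k = length Q"
    then have "set Q = V" using Q(2) by (intro bfs_closed) (auto simp: bfs_state_def)
    then show False using k \<open>k = length Q\<close> distinct_card [OF dQ] by simp
  qed
  then have kl: "k < length Q" using Q(1) by simp
  define v where "v = Q ! k"
  have v: "v \<in> V" using QV kl by (auto simp: v_def)
  note v = v V_less [OF v]
  have kN: "k < N" using k card_V by simp
  let ?J = "\<lambda>E s. \<exists>Q'. bfs_state (qkids Q k @ E) (Q @ Q') s \<and> reg s 4 = k \<and> reg s 6 = v \<and> reg s 7 = tag (rl v)"
  have "reaches w bfs_body s 200 (bfs_inv (Suc k))"
    unfolding bfs_body_def seqs.simps
  proof (rule reaches_seq [where T = 9 and T' = 190 and R = "\<lambda>s. bfs_state (qkids Q k) Q s \<and> reg s 4 = k \<and> reg s 6 = v"])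
    show "reaches w (Assign 6 (e_fld (Reg 4) 3)) s 9 (\<lambda>s. bfs_state (qkids Q k) Q s \<and> reg s 4 = k \<and> reg s 6 = v)"
      by (rule reaches_straight)
        (use Q(2) r4 kN kl in \<open>auto simp: bfs_state_def holds_rules_def scratch_clear_def v_def\<close>)
  next
    fix s1
    assume s1: "bfs_state (qkids Q k) Q s1 \<and> reg s1 4 = k \<and> reg s1 6 = v"
    show "reaches w (Seq (Assign 7 (e_inp (Reg 6) 0)) (Seq (each_kid bfs_visit)
        (Assign 4 (Bin Add (Reg 4) (Const 1))))) s1 190 (bfs_inv (Suc k))"
    proof (rule reaches_seq [where T = 7 and T' = 170 and R = "?J []"])
      show "reaches w (Assign 7 (e_inp (Reg 6) 0)) s1 7 (?J [])"
        by (rule reaches_straight)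
          (use s1 v in \<open>auto simp: bfs_state_def holds_rules_def scratch_clear_def intro!: exI [of _ "[]"]\<close>)
    next
      fix s2
      assume s2: "?J [] s2"
      show "reaches w (Seq (each_kid bfs_visit) (Assign 4 (Bin Add (Reg 4) (Const 1)))) s2 170 (bfs_inv (Suc k))"
      proof (rule reaches_seq [where T' = 10])
        show "reaches w (each_kid bfs_visit) s2 (2 * 60 + 30) (?J (kids (rl v)))"
        proof (rule each_kid [OF v(2), where J = ?J])
          fix E s
          assume "?J E s"
          then show "holds_rules s \<and> reg s 6 = v \<and> reg s 7 = tag (rl v)" by (auto simp: bfs_state_def)
        next
          fix E s c
          assume "?J E s"
          then show "?J E (s\<lparr>reg := (reg s)(8 := c)\<rparr>)"
            by (auto simp: bfs_state_def holds_rules_def scratch_clear_def)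
        next
          fix E E' c s
          assume kd: "kids (rl v) = E @ c # E'" and J: "?J E s" and c: "reg s 8 = c"
          then obtain Q' where Q': "bfs_state (qkids Q k @ E) (Q @ Q') s" "reg s 4 = k" "reg s 6 = v" "reg s 7 = tag (rl v)"
            by blast
          have cV: "c \<in> V" "c \<noteq> start G" using V.kid [OF v(1)] kid_neq_start [OF v(1)] kd by auto
          have "length (qkids Q k @ E) \<le> 2 * N + 2"
            using length_qkids [OF Q(1)] length_kids [of "rl v"] kd kN by simp
          then show "reaches w bfs_visit s 60 (?J (E @ [c]))"
            by (rule reaches_mono [OF bfs_visit [OF Q'(1) c cV]]) (use Q' in auto)
        qed (use s2 in auto)
      next
        fix s3
        assume "?J (kids (rl v)) s3"
        then obtain Q' where Q': "bfs_state (qkids Q k @ kids (rl v)) (Q @ Q') s3" "reg s3 4 = k" by blast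
        have "qkids (Q @ Q') (Suc k) = qkids Q k @ kids (rl v)"
          using kl qkids_append [of "Suc k" Q Q'] by (simp add: qkids_Suc v_def)
        moreover have "k + 1 < 2 ^ w" using kN word_rules by linarith
        ultimately show "reaches w (Assign 4 (Bin Add (Reg 4) (Const 1))) s3 10 (bfs_inv (Suc k))"
          using Q' kl by (intro reaches_straight)
            (auto simp: bfs_inv_def bfs_state_def holds_rules_def scratch_clear_def binop_val_exact intro!: exI [of _ "Q @ Q'"])
      qed simp
    qed simp
  qed simp
  then show ?thesis using r4 r5 kl by simp
qed

definition bfs_post :: "state \<Rightarrow> bool" where
  "bfs_post s \<longleftrightarrow> holds_rules s \<and> (\<forall>c<N. mem s (fld N c 0) = total_in c) \<and> scratch_clear {0, 3} s"

lemma bfs_final: "bfs_inv (card V) s \<Longrightarrow> exp_val w (Bin Less (Reg 4) (Reg 5)) s = 0 \<and> bfs_post s"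
proof -
  assume "bfs_inv (card V) s"
  then obtain Q where Q: "card V \<le> length Q" "bfs_state (qkids Q (card V)) Q s" and r4: "reg s 4 = card V"
    by (auto simp: bfs_inv_def)
  have QV: "set Q \<subseteq> V" and dQ: "distinct Q" using Q(2) by (auto simp: bfs_state_def)
  have "length Q \<le> card V" using card_mono [OF finite_V QV] distinct_card [OF dQ] by simp
  then have l: "length Q = card V" using Q(1) by simp
  then have s: "set Q = V" using card_subset_eq [OF finite_V QV] distinct_card [OF dQ] by simp
  have "count_list (qkids Q (card V)) c = total_in c" for c
    using count_qkids [OF dQ, of "card V"] l s by (simp add: total_in_def)
  then show ?thesis using Q(2) r4 l by (auto simp: bfs_state_def bfs_post_def)
qed

lemma bfs_setup: "reaches w bfs_setup (input_state G) 40 (bfs_inv 0)"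
proof (rule reaches_straight)
  let ?s = "input_state G"
  have r: "reg ?s 0 = N" "reg ?s 1 = start G" "\<And>r. 1 < r \<Longrightarrow> reg ?s r = 0"
    by (auto simp: input_state_def)
  have m: "mem ?s (inp v f) = [tag (rl v), arg1 (rl v), arg2 (rl v)] ! f" if "v < N" "f < 3" for v f
    using that encode_nth [OF that] by (simp add: input_state_def length_encode inp_def)
  have z: "mem ?s (fld N v f) = 0" "mem ?s (out N v f) = 0" for v f
    by (simp_all add: input_state_def length_encode fld_def out_def)
  have run: "run w bfs_setup ?s = ?s\<lparr>reg := (reg ?s)(2 := 3 * N, 3 := 19 * N, 5 := 1),
      mem := (mem ?s)(fld N 0 3 := start G)\<rparr>"
  proof -
    have "3 * N < 2 ^ w" "19 * N < 2 ^ w" using word_rules N_pos by linarith+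
    then have "binop_val w Mul 3 N = 3 * N" "binop_val w Mul 19 N = 19 * N"
      by (simp_all only: binop_val_exact)
    then show ?thesis using r N_pos by (simp add: bfs_setup_def)
  qed
  have "bfs_state [] [start G] (run w bfs_setup ?s)"
    unfolding run using r m [of _ 0] m [of _ 1] m [of _ 2] z N_pos V.start
    by (auto simp: bfs_state_def holds_rules_def scratch_clear_def)
  then show "bfs_inv 0 (run w bfs_setup ?s)"
    using r(3) [of 4] by (auto simp: bfs_inv_def run intro!: exI [of _ "[start G]"])
qed (simp_all add: bfs_setup_def)

lemma bfs_correct: "reaches w bfs (input_state G) (250 * N) bfs_post"
  unfolding bfs_def
proof (rule reaches_seq [OF bfs_setup])
  fix s
  assume "bfs_inv 0 s"
  from reaches_while [of "card V" bfs_inv w "Bin Less (Reg 4) (Reg 5)" bfs_body "\<lambda>_. 200", OF bfs_body _ this]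
  show "reaches w (While (Bin Less (Reg 4) (Reg 5)) bfs_body) s (204 * card V + 4) bfs_post"
    using bfs_final by (auto elim!: reaches_mono)
next
  show "40 + (204 * card V + 4) \<le> 250 * N" using card_V N_pos by linarith
qed

end

section \<open>Topological order and path counts\<close>

text \<open>A variable enters the queue when its last incoming edge has been scanned; its path count
  is final by then and can be passed on to its children.\<close>

definition kahn_visit :: com where
  "kahn_visit = seqs [s_fld (Reg 8) 1 (Bin Add (e_fld (Reg 8) 1) (e_fld (Reg 6) 1)),
     s_fld (Reg 8) 0 (Bin Sub (e_fld (Reg 8) 0) (Const 1)),
     Cond (e_fld (Reg 8) 0) Skip
       (seqs [s_fld (Reg 5) 12 (Reg 8), s_fld (Reg 8) 2 (Reg 5), Assign 5 (Bin Add (Reg 5) (Const 1))])]"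

definition kahn_setup :: com where
  "kahn_setup = seqs [Assign 4 (Const 0), Assign 5 (Const 1), s_fld (Const 0) 12 (Reg 1),
     s_fld (Reg 1) 1 (Const 1)]"

definition kahn_body :: com where
  "kahn_body = seqs [Assign 6 (e_fld (Reg 4) 12), Assign 7 (e_inp (Reg 6) 0), each_kid kahn_visit,
     Assign 4 (Bin Add (Reg 4) (Const 1))]"

definition kahn :: com where
  "kahn = Seq kahn_setup (While (Bin Less (Reg 4) (Reg 5)) kahn_body)"

context slp2d_machine
begin

text \<open>The credit \<open>rho c * (2 * area c - 1)\<close> of the variables not yet processed pays for the rest of
  the derivation tree; it bounds both the path counts and the number of variables.\<close>

definition credit :: "nat list \<Rightarrow> nat \<Rightarrow> (nat \<Rightarrow> nat) \<Rightarrow> nat" where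
  "credit Q k rho = (\<Sum>c\<in>V - set (take k Q). rho c * (2 * area c - 1))"

definition queue_ok :: "nat list \<Rightarrow> nat \<Rightarrow> nat list \<Rightarrow> (nat \<Rightarrow> nat) \<Rightarrow> bool" where
  "queue_ok Q k E rho \<longleftrightarrow> distinct Q \<and> set Q \<subseteq> V \<and> Q \<noteq> [] \<and> Q ! 0 = start G \<and> k \<le> length Q \<and>
     set Q = insert (start G) {c \<in> V. 0 < total_in c \<and> count_list E c = total_in c} \<and>
     (\<forall>i<k. \<forall>c \<in> set (kids (rl (Q ! i))). c \<notin> set (take (Suc i) Q)) \<and>
     (\<forall>c\<in>V. rho c \<le> 2 * cells) \<and> (\<forall>c\<in>set Q. 1 \<le> rho c)"

definition paths_upto :: "nat list \<Rightarrow> nat \<Rightarrow> (nat \<Rightarrow> nat) \<Rightarrow> nat \<Rightarrow> nat" where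
  "paths_upto Q k rho c = of_bool (c = start G) + (\<Sum>i<k. count_list (kids (rl (Q ! i))) c * rho (Q ! i))"

definition between :: "nat list \<Rightarrow> nat \<Rightarrow> (nat \<Rightarrow> nat) \<Rightarrow> bool" where
  "between Q k rho \<longleftrightarrow> queue_ok Q k (qkids Q k) rho \<and> (\<forall>c\<in>V. rho c = paths_upto Q k rho c) \<and>
     k + credit Q k rho \<le> 2 * cells"

text \<open>The state amid the children of \<open>Q ! k\<close>: the edges to \<open>R\<close> are
  not scanned yet, and their credit has been taken from the parent but not given to the
  children.\<close>

definition during :: "nat list \<Rightarrow> nat \<Rightarrow> nat list \<Rightarrow> nat list \<Rightarrow> (nat \<Rightarrow> nat) \<Rightarrow> bool" where
  "during Q k E R rho \<longleftrightarrow> k < length Q \<and> kids (rl (Q ! k)) = E @ R \<and>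
     queue_ok Q (Suc k) (qkids Q k @ E) rho \<and>
     (\<forall>c\<in>V. rho c = paths_upto Q k rho c + count_list E c * rho (Q ! k)) \<and>
     Suc k + credit Q (Suc k) rho + rho (Q ! k) * (\<Sum>c\<leftarrow>R. 2 * area c - 1) \<le> 2 * cells"

lemma count_less_total:
  assumes "distinct Q" "set Q \<subseteq> V" "k < length Q" "kids (rl (Q ! k)) = E @ c # R"
  shows "count_list (qkids Q k @ E) c < total_in c"
proof -
  have "count_list (qkids Q (Suc k)) c = (\<Sum>v\<in>set (take (Suc k) Q). count_list (kids (rl v)) c)"
    using assms(1,3) by (intro count_qkids) auto
  also have "\<dots> \<le> total_in c"
    unfolding total_in_def by (intro sum_mono2 finite_V) (use assms(2) set_take_subset in fast, simp)
  finally show ?thesis using assms(3,4) by (simp add: qkids_Suc)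
qed

text \<open>Taking \<open>v = Q ! k\<close> off the unprocessed variables frees
  \<open>rho v * (2 * area v - 1)\<close>. By \<open>area_kids\<close> its children claim at least
  \<open>rho v\<close> less than this, and that surplus of at least 1 pays for the increment of
  \<open>k\<close>.\<close>

lemma between_during:
  assumes b: "between Q k rho" and k: "k < length Q"
  shows "during Q k [] (kids (rl (Q ! k))) rho"
proof -
  let ?v = "Q ! k"
  have q: "queue_ok Q k (qkids Q k) rho" using b by (simp add: between_def)
  then have d: "distinct Q" "set Q \<subseteq> V" by (auto simp: queue_ok_def)
  have v: "?v \<in> V" using d k by auto
  have r: "1 \<le> rho ?v" using q k by (auto simp: queue_ok_def)
  have new: "c \<notin> set Q" if "c \<in> set (kids (rl ?v))" for c
  proof -
    obtain E R where "kids (rl ?v) = E @ c # R" using \<open>c \<in> _\<close> by (meson split_list)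
    from count_less_total [OF d k this] have "count_list (qkids Q k) c \<noteq> total_in c" by simp
    then show ?thesis using q kid_neq_start [OF v that] by (auto simp: queue_ok_def)
  qed
  have nv: "?v \<notin> set (take k Q)"
    using d(1) k by (metis id_take_nth_drop disjoint_iff distinct_append list.set_intros(1))
  have t: "V - set (take k Q) = insert ?v (V - set (take (Suc k) Q))"
    using v k nv by (auto simp: take_Suc_conv_app_nth)
  have "credit Q k rho = rho ?v * (2 * area ?v - 1) + credit Q (Suc k) rho"
    unfolding credit_def t by (subst sum.insert) (use k finite_V in \<open>auto simp: take_Suc_conv_app_nth\<close>)
  moreover have "rho ?v * ((\<Sum>c\<leftarrow>kids (rl ?v). 2 * area c - 1) + 1) \<le> rho ?v * (2 * area ?v - 1)"
    using area_kids [OF v] by (intro mult_le_mono2) simp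
  moreover have "k + credit Q k rho \<le> 2 * cells" using b by (simp add: between_def)
  ultimately have "Suc k + credit Q (Suc k) rho + rho ?v * (\<Sum>c\<leftarrow>kids (rl ?v). 2 * area c - 1) \<le> 2 * cells"
    using r unfolding distrib_left by linarith
  moreover have "queue_ok Q (Suc k) (qkids Q k) rho"
  proof -
    have "\<forall>i<Suc k. \<forall>c \<in> set (kids (rl (Q ! i))). c \<notin> set (take (Suc i) Q)"
      using q new unfolding queue_ok_def by (metis in_set_takeD less_Suc_eq)
    then show ?thesis using q Suc_leI [OF k] unfolding queue_ok_def by blast
  qed
  ultimately show ?thesis using b k by (simp add: during_def between_def)
qed

lemma during_between:
  assumes "during Q k E [] rho"
  shows "between Q (Suc k) rho"
  using assms by (auto simp: during_def between_def qkids_Suc paths_upto_def)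

text \<open>Credit moves along the edge from \<open>Q ! k\<close> to \<open>c\<close>. As areas are
  positive, the new path count of \<open>c\<close> is at most its credit and so at most
  \<open>2 * cells\<close>; with this bound the machine addition is exact.\<close>

lemma during_step:
  assumes d: "during Q k E (c # R) rho"
  defines "rho' \<equiv> rho(c := rho c + rho (Q ! k))"
  defines "Q' \<equiv> (if count_list (qkids Q k @ E @ [c]) c = total_in c then [c] else [])"
  shows "during (Q @ Q') k (E @ [c]) R rho'" "c \<in> V" "c \<notin> set Q" "rho' c \<le> 2 * cells"
    "count_list (qkids Q k @ E) c < total_in c"
proof -
  let ?v = "Q ! k"
  have k: "k < length Q" and kd: "kids (rl ?v) = E @ c # R" and q: "queue_ok Q (Suc k) (qkids Q k @ E) rho"
    and eq: "\<forall>c\<in>V. rho c = paths_upto Q k rho c + count_list E c * rho ?v"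
    and cr: "Suc k + credit Q (Suc k) rho + rho ?v * (\<Sum>c\<leftarrow>c # R. 2 * area c - 1) \<le> 2 * cells"
    using d by (auto simp: during_def)
  have dq: "distinct Q" "set Q \<subseteq> V" using q by (auto simp: queue_ok_def)
  have v: "?v \<in> V" using dq k by auto
  show c: "c \<in> V" using V.kid [OF v] kd by auto
  have cs: "c \<noteq> start G" using kid_neq_start [OF v] kd by auto
  show lt: "count_list (qkids Q k @ E) c < total_in c" by (rule count_less_total [OF dq k kd])
  then show cQ: "c \<notin> set Q" using q cs by (auto simp: queue_ok_def)
  have take: "take i (Q @ Q') = take i Q" if "i \<le> Suc k" for i using that k by simp
  have nth: "(Q @ Q') ! i = Q ! i" if "i \<le> k" for i using that k by (simp add: nth_append)
  have rnth: "rho' (Q ! i) = rho (Q ! i)" if "i \<le> k" for i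
  proof -
    have "Q ! i \<in> set Q" using that k by simp
    then show ?thesis using cQ by (auto simp: rho'_def)
  qed
  have cin: "c \<in> V - set (take (Suc k) Q)" using c cQ set_take_subset [of "Suc k" Q] by auto
  have fin: "finite (V - set (take (Suc k) Q))" using finite_V by simp
  have "credit (Q @ Q') (Suc k) rho' = (\<Sum>d\<in>V - set (take (Suc k) Q). rho' d * (2 * area d - 1))"
    by (simp only: credit_def take [OF order_refl])
  also have "\<dots> = rho' c * (2 * area c - 1) + (\<Sum>d\<in>V - set (take (Suc k) Q) - {c}. rho' d * (2 * area d - 1))"
    by (rule sum.remove [OF fin cin])
  also have "(\<Sum>d\<in>V - set (take (Suc k) Q) - {c}. rho' d * (2 * area d - 1)) =
      (\<Sum>d\<in>V - set (take (Suc k) Q) - {c}. rho d * (2 * area d - 1))"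
    by (intro sum.cong) (auto simp: rho'_def)
  also have "rho' c * (2 * area c - 1) = rho ?v * (2 * area c - 1) + rho c * (2 * area c - 1)"
    by (simp add: rho'_def add_mult_distrib)
  finally have cred: "credit (Q @ Q') (Suc k) rho' = rho ?v * (2 * area c - 1) + credit Q (Suc k) rho"
    unfolding credit_def sum.remove [OF fin cin] by simp
  then have cr': "Suc k + credit (Q @ Q') (Suc k) rho' + rho' ((Q @ Q') ! k) * (\<Sum>c\<leftarrow>R. 2 * area c - 1) \<le> 2 * cells"
    using cr by (simp add: nth rnth distrib_left)
  have "rho' c * 1 \<le> rho' c * (2 * area c - 1)" using area_pos [OF c] by (intro mult_le_mono2) simp
  also have "\<dots> \<le> credit (Q @ Q') (Suc k) rho'"
    unfolding credit_def take [OF order_refl]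
    by (rule member_le_sum [of c _ "\<lambda>c. rho' c * (2 * area c - 1)"]) (use cin fin in auto)
  finally show rc: "rho' c \<le> 2 * cells" using cr' by simp
  have rv: "1 \<le> rho ?v" using q k by (auto simp: queue_ok_def)
  have cnt: "count_list (qkids Q k @ E @ [c]) x = count_list (qkids Q k @ E) x + of_bool (x = c)" for x
    by simp
  have setQ: "set (Q @ Q') = insert (start G) {x \<in> V. 0 < total_in x \<and> count_list (qkids Q k @ E @ [c]) x = total_in x}"
  proof (rule Set.set_eqI)
    fix x
    have "x \<in> set Q \<longleftrightarrow> x = start G \<or> x \<in> V \<and> 0 < total_in x \<and> count_list (qkids Q k @ E) x = total_in x"
      using q by (auto simp: queue_ok_def)
    then show "x \<in> set (Q @ Q') \<longleftrightarrow> x \<in> insert (start G) {x \<in> V. 0 < total_in x \<and> count_list (qkids Q k @ E @ [c]) x = total_in x}"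
      unfolding cnt using c cs lt cQ by (cases "x = c") (auto simp: Q'_def)
  qed
  have qk: "qkids (Q @ Q') k = qkids Q k" using k by (simp add: qkids_append)
  have "queue_ok (Q @ Q') (Suc k) (qkids (Q @ Q') k @ E @ [c]) rho'"
    unfolding queue_ok_def qk
  proof (intro conjI)
    show "distinct (Q @ Q')" "set (Q @ Q') \<subseteq> V" "Q @ Q' \<noteq> []" "(Q @ Q') ! 0 = start G" "Suc k \<le> length (Q @ Q')"
      using dq cQ c k q by (auto simp: Q'_def queue_ok_def nth_append)
    show "set (Q @ Q') = insert (start G) {x \<in> V. 0 < total_in x \<and> count_list (qkids Q k @ E @ [c]) x = total_in x}"
      by (rule setQ)
    show "\<forall>i<Suc k. \<forall>c\<in>set (kids (rl ((Q @ Q') ! i))). c \<notin> set (take (Suc i) (Q @ Q'))"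
      using q k by (auto simp: queue_ok_def nth take less_Suc_eq_le)
    show "\<forall>c\<in>V. rho' c \<le> 2 * cells" using q rc by (auto simp: queue_ok_def rho'_def)
    show "\<forall>c\<in>set (Q @ Q'). 1 \<le> rho' c" using q rv by (auto simp: queue_ok_def rho'_def Q'_def split: if_splits)
  qed
  moreover have "\<forall>x\<in>V. rho' x = paths_upto (Q @ Q') k rho' x + count_list (E @ [c]) x * rho' ((Q @ Q') ! k)"
  proof
    fix x
    assume x: "x \<in> V"
    have "paths_upto (Q @ Q') k rho' x = paths_upto Q k rho x"
      by (simp add: paths_upto_def nth rnth)
    moreover have "rho x = paths_upto Q k rho x + count_list E x * rho ?v" using eq x by blast
    moreover have "rho' x = rho x + of_bool (x = c) * rho ?v" by (simp add: rho'_def)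
    moreover have "count_list (E @ [c]) x = count_list E x + of_bool (x = c)" by simp
    moreover have "rho' ((Q @ Q') ! k) = rho ?v" using nth [of k] rnth [of k] by simp
    ultimately show "rho' x = paths_upto (Q @ Q') k rho' x + count_list (E @ [c]) x * rho' ((Q @ Q') ! k)"
      by (metis add.assoc add_mult_distrib)
  qed
  ultimately show "during (Q @ Q') k (E @ [c]) R rho'"
    unfolding during_def using k kd cr' by (simp add: nth)
qed

text \<open>A missing variable of largest area would have all its parents in the queue, because
  parents have larger areas. All its incoming edges would then have been scanned, and it would have
  been enqueued.\<close>

lemma between_complete:
  assumes b: "between Q (length Q) rho"
  shows "set Q = V"
proof (rule ccontr)
  assume ne: "set Q \<noteq> V"
  have q: "distinct Q" "set Q \<subseteq> V" "start G \<in> set Q"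
    and sQ: "set Q = insert (start G) {c \<in> V. 0 < total_in c \<and> count_list (qkids Q (length Q)) c = total_in c}"
    using b by (auto simp: between_def queue_ok_def)
  have f: "finite (area ` (V - set Q))" "area ` (V - set Q) \<noteq> {}" using finite_V ne q(2) by auto
  obtain u where u: "u \<in> V - set Q" "area u = Max (area ` (V - set Q))" using Max_in [OF f] by auto
  have par: "v \<in> set Q" if "v \<in> V" "u \<in> set (kids (rl v))" for v
  proof (rule ccontr)
    assume "v \<notin> set Q"
    then have "area v \<le> area u" unfolding u(2) using f(1) that(1) by (intro Max_ge) auto
    then show False using area_kid [OF that] by simp
  qed
  have "u \<noteq> start G" using u q by auto
  then obtain v where v: "v \<in> V" "u \<in> set (kids (rl v))" using u(1) by (auto elim: V.cases)
  have "0 < count_list (kids (rl v)) u" using v(2) by (simp add: count_list_0_iff flip: neq0_conv)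
  also have "\<dots> \<le> total_in u"
    unfolding total_in_def by (rule member_le_sum) (use v finite_V in auto)
  finally have pos: "0 < total_in u" .
  have "total_in u = (\<Sum>v\<in>set Q. count_list (kids (rl v)) u)"
    unfolding total_in_def using q(2) finite_V par
    by (intro sum.mono_neutral_right) (auto simp: count_list_0_iff)
  also have "\<dots> = count_list (qkids Q (length Q)) u" using count_qkids [OF q(1), of "length Q"] by simp
  finally show False using u(1) pos sQ by auto
qed

lemma between_ordered:
  assumes b: "between Q (card V) rho"
  shows "ordered_slp2d \<Sigma> G M Q rho" "length Q = card V"
proof -
  have q: "distinct Q" "set Q \<subseteq> V" "card V \<le> length Q" using b by (auto simp: between_def queue_ok_def)
  have "length Q \<le> card V" using card_mono [OF finite_V q(2)] distinct_card [OF q(1)] by simp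
  then show l: "length Q = card V" using q(3) by simp
  then have s: "set Q = V" using b by (intro between_complete) simp
  have nth: "(\<Sum>i<length Q. f (Q ! i)) = (\<Sum>v\<in>V. f v)" for f :: "nat \<Rightarrow> nat"
  proof -
    have "bij_betw ((!) Q) {..<length Q} (set Q)" using q(1) by (rule bij_betw_nth) auto
    then show ?thesis unfolding s by (rule sum.reindex_bij_betw)
  qed
  show "ordered_slp2d \<Sigma> G M Q rho"
  proof unfold_locales
    show "distinct Q" "set Q = V" by (rule q s)+
    show "Q ! 0 = start G" using b by (simp add: between_def queue_ok_def)
    show "c \<notin> set (take (Suc i) Q)" if "i < length Q" "c \<in> set (kids (rl (Q ! i)))" for i c
      using b that unfolding l by (auto simp: between_def queue_ok_def)
    show "rho c = of_bool (c = start G) + (\<Sum>v\<in>V. count_list (kids (rl v)) c * rho v)" if "c \<in> V" for c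
      using b that nth [of "\<lambda>v. count_list (kids (rl v)) c * rho v"] unfolding l by (simp add: between_def paths_upto_def)
    show "rho c \<le> 2 * cells" if "c \<in> V" for c
      using b that unfolding between_def queue_ok_def by blast
    show "length Q \<le> 2 * cells" using b l by (simp add: between_def)
  qed
qed

definition kahn_state :: "nat list \<Rightarrow> nat list \<Rightarrow> (nat \<Rightarrow> nat) \<Rightarrow> state \<Rightarrow> bool" where
  "kahn_state E Q rho s \<longleftrightarrow> holds_rules s \<and> reg s 5 = length Q \<and>
     (\<forall>i<length Q. mem s (fld N i 12) = Q ! i \<and> mem s (fld N (Q ! i) 2) = i) \<and>
     (\<forall>c\<in>V. mem s (fld N c 0) = total_in c - count_list E c \<and> mem s (fld N c 1) = rho c) \<and>
     (\<forall>i<N. \<forall>f<16. mem s (out N i f) = 0)"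

lemma total_in_less: "total_in c < 2 ^ w"
proof -
  have "total_in c \<le> (\<Sum>v\<in>V. 2)"
    unfolding total_in_def by (intro sum_mono) (meson count_le_length length_kids order_trans)
  also have "\<dots> = 2 * card V" by simp
  finally show ?thesis using card_V word_rules N_pos by linarith
qed

lemma kahn_visit:
  assumes st: "kahn_state (qkids Q k @ E) Q rho s" and d: "during Q k E (c # R) rho"
    and r: "reg s 8 = c" "reg s 6 = Q ! k"
  shows "reaches w kahn_visit s 100 (\<lambda>s'. \<exists>Q' rho'. kahn_state (qkids Q k @ E @ [c]) (Q @ Q') rho' s' \<and>
    during (Q @ Q') k (E @ [c]) R rho' \<and> reg s' 4 = reg s 4 \<and> reg s' 6 = reg s 6 \<and> reg s' 7 = reg s 7)"
proof (rule reaches_straight)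
  note ds = during_step [OF d]
  let ?rho = "rho(c := rho c + rho (Q ! k))"
  have k: "k < length Q" and dq: "distinct Q" "set Q \<subseteq> V" using d by (auto simp: during_def queue_ok_def)
  have kV: "Q ! k \<in> V" using k dq by auto
  have N: "c < N" "Q ! k < N" using V_less ds(2) kV by auto
  have QN: "Q ! i < N" if "i < length Q" for i
    using V_less nth_mem [OF that] dq(2) by blast
  have ne: "c \<noteq> Q ! k" using ds(3) k by auto
  have qne: "Q ! i \<noteq> c" if "i < length Q" for i using ds(3) that by auto
  have r2: "reg s 2 = 3 * N" and r5: "reg s 5 = length Q" using st by (auto simp: kahn_state_def holds_rules_def)
  have m: "mem s (fld N c 0) = total_in c - count_list (qkids Q k @ E) c" "mem s (fld N c 1) = rho c"
    "mem s (fld N (Q ! k) 1) = rho (Q ! k)" using st ds(2) kV by (auto simp: kahn_state_def)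
  have rb: "rho c + rho (Q ! k) < 2 ^ w"
    using ds(4) word_cells word_64 by simp
  let ?t = "total_in c - count_list (qkids Q k @ E) c"
  have tb: "1 \<le> ?t" "?t < 2 ^ w" using ds(5) total_in_less [of c] by auto
  have lq: "length Q < N" by (rule length_less_N [OF dq ds(2,3)])
  have "length Q + 1 < 2 ^ w" using lq word_rules by linarith
  note bx = binop_val_exact(1) [OF this] binop_val_exact(1) [OF rb] binop_val_exact(2) [OF tb]
  have cV: "x = c \<Longrightarrow> x \<in> V" for x using ds(2) by simp
  show "\<exists>Q' rho'. kahn_state (qkids Q k @ E @ [c]) (Q @ Q') rho' (run w kahn_visit s) \<and>
    during (Q @ Q') k (E @ [c]) R rho' \<and> reg (run w kahn_visit s) 4 = reg s 4 \<and>
    reg (run w kahn_visit s) 6 = reg s 6 \<and> reg (run w kahn_visit s) 7 = reg s 7"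
  proof (cases "?t = 1")
    case False
    then have t: "?t - 1 \<noteq> 0" using tb by simp
    have run: "run w kahn_visit s = s\<lparr>mem := (mem s)(fld N c 1 := rho c + rho (Q ! k), fld N c 0 := ?t - 1)\<rparr>"
      using r r2 N m bx t by (simp add: kahn_visit_def del: count_list_append One_nat_def)
    have ct: "count_list (qkids Q k @ E @ [c]) c \<noteq> total_in c" using t by auto
    have "kahn_state (qkids Q k @ E @ [c]) (Q @ []) ?rho (run w kahn_visit s)"
      unfolding run using st N QN V_less ds(2,5) by (auto simp: kahn_state_def holds_rules_def)
    then show ?thesis using ds(1) ct unfolding run
      by (intro exI [of _ "[]"] exI [of _ ?rho]) auto
  next
    case True
    then have t: "?t - 1 = 0" by simp
    have run: "run w kahn_visit s = s\<lparr>reg := (reg s)(5 := length Q + 1),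
        mem := (mem s)(fld N c 1 := rho c + rho (Q ! k), fld N c 0 := 0, fld N (length Q) 12 := c,
          fld N c 2 := length Q)\<rparr>"
      using r r2 r5 N m bx t lq by (simp add: kahn_visit_def del: count_list_append One_nat_def)
    have ct: "count_list (qkids Q k @ E @ [c]) c = total_in c" using True by auto
    have "kahn_state (qkids Q k @ E @ [c]) (Q @ [c]) ?rho (run w kahn_visit s)"
      unfolding run using st N QN V_less ds(2,5) ct qne lq
      by (auto simp: kahn_state_def holds_rules_def nth_append less_Suc_eq)
    then show ?thesis using ds(1) ct unfolding run
      by (intro exI [of _ "[c]"] exI [of _ ?rho]) auto
  qed
qed (simp_all add: kahn_visit_def)

definition kahn_inv :: "nat \<Rightarrow> state \<Rightarrow> bool" where
  "kahn_inv k s \<longleftrightarrow> reg s 4 = k \<and> (\<exists>Q rho. between Q k rho \<and> kahn_state (qkids Q k) Q rho s)"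

lemma kahn_body:
  assumes k: "k < card V" and inv: "kahn_inv k s"
  shows "exp_val w (Bin Less (Reg 4) (Reg 5)) s \<noteq> 0 \<and> reaches w kahn_body s 300 (kahn_inv (Suc k))"
proof -
  obtain Q rho where b: "between Q k rho" and Q: "kahn_state (qkids Q k) Q rho s" and r4: "reg s 4 = k"
    using inv by (auto simp: kahn_inv_def)
  have r5: "reg s 5 = length Q" using Q by (auto simp: kahn_state_def)
  have QV: "set Q \<subseteq> V" and dQ: "distinct Q" and kle: "k \<le> length Q"
    using b by (auto simp: between_def queue_ok_def)
  have "k \<noteq> length Q"
  proof
    assume "k = length Q"
    then have "set Q = V" using b by (intro between_complete) auto
    then show False using k \<open>k = length Q\<close> distinct_card [OF dQ] by simp
  qed
  then have kl: "k < length Q" using kle by simp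
  define v where "v = Q ! k"
  have v: "v \<in> V" using QV kl by (auto simp: v_def)
  note v = v V_less [OF v]
  have kN: "k < N" using k card_V by simp
  let ?J = "\<lambda>E s. \<exists>Q' rho R. kahn_state (qkids Q k @ E) (Q @ Q') rho s \<and> during (Q @ Q') k E R rho \<and>
     reg s 4 = k \<and> reg s 6 = v \<and> reg s 7 = tag (rl v)"
  have "reaches w kahn_body s 300 (kahn_inv (Suc k))"
    unfolding kahn_body_def seqs.simps
  proof (rule reaches_seq [where T = 9 and T' = 290 and R = "\<lambda>s. kahn_state (qkids Q k) Q rho s \<and> reg s 4 = k \<and> reg s 6 = v"])
    show "reaches w (Assign 6 (e_fld (Reg 4) 12)) s 9 (\<lambda>s. kahn_state (qkids Q k) Q rho s \<and> reg s 4 = k \<and> reg s 6 = v)"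
      by (rule reaches_straight)
        (use Q r4 kN kl in \<open>auto simp: kahn_state_def holds_rules_def v_def\<close>)
  next
    fix s1
    assume s1: "kahn_state (qkids Q k) Q rho s1 \<and> reg s1 4 = k \<and> reg s1 6 = v"
    show "reaches w (Seq (Assign 7 (e_inp (Reg 6) 0)) (Seq (each_kid kahn_visit)
        (Assign 4 (Bin Add (Reg 4) (Const 1))))) s1 290 (kahn_inv (Suc k))"
    proof (rule reaches_seq [where T = 7 and T' = 280 and R = "?J []"])
      have "kahn_state (qkids Q k) Q rho (run w (Assign 7 (e_inp (Reg 6) 0)) s1) \<and>
          reg (run w (Assign 7 (e_inp (Reg 6) 0)) s1) 4 = k \<and>
          reg (run w (Assign 7 (e_inp (Reg 6) 0)) s1) 6 = v \<and>
          reg (run w (Assign 7 (e_inp (Reg 6) 0)) s1) 7 = tag (rl v)"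
        using s1 v by (auto simp: kahn_state_def holds_rules_def)
      then show "reaches w (Assign 7 (e_inp (Reg 6) 0)) s1 7 (?J [])"
        using between_during [OF b kl]
        by (intro reaches_straight exI [of _ "[]"] exI [of _ rho] exI [of _ "kids (rl v)"]) (auto simp: v_def)
    next
      fix s2
      assume s2: "?J [] s2"
      show "reaches w (Seq (each_kid kahn_visit) (Assign 4 (Bin Add (Reg 4) (Const 1)))) s2 280 (kahn_inv (Suc k))"
      proof (rule reaches_seq [where T' = 10])
        show "reaches w (each_kid kahn_visit) s2 (2 * 100 + 30) (?J (kids (rl v)))"
        proof (rule each_kid [OF v(2), where J = ?J])
          fix E s
          assume "?J E s"
          then show "holds_rules s \<and> reg s 6 = v \<and> reg s 7 = tag (rl v)" by (auto simp: kahn_state_def)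
        next
          fix E s c
          assume "?J E s"
          then show "?J E (s\<lparr>reg := (reg s)(8 := c)\<rparr>)"
            by (auto simp: kahn_state_def holds_rules_def)
        next
          fix E E' c s
          assume kd: "kids (rl v) = E @ c # E'" and J: "?J E s" and c: "reg s 8 = c"
          then obtain Q' rho R where Q': "kahn_state (qkids Q k @ E) (Q @ Q') rho s" "during (Q @ Q') k E R rho"
              "reg s 4 = k" "reg s 6 = v" "reg s 7 = tag (rl v)"
            by blast
          have vk: "(Q @ Q') ! k = v" using kl by (simp add: v_def nth_append)
          have R: "R = c # E'" using Q'(2) kd by (simp add: during_def vk)
          have qk: "qkids (Q @ Q') k = qkids Q k" using kl by (simp add: qkids_append)
          have "reaches w kahn_visit s 100 (\<lambda>s'. \<exists>Q'' rho'. kahn_state (qkids (Q @ Q') k @ E @ [c]) ((Q @ Q') @ Q'') rho' s' \<and>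
             during ((Q @ Q') @ Q'') k (E @ [c]) E' rho' \<and> reg s' 4 = reg s 4 \<and> reg s' 6 = reg s 6 \<and> reg s' 7 = reg s 7)"
            by (rule kahn_visit) (use Q' R qk vk c in auto)
          then show "reaches w kahn_visit s 100 (?J (E @ [c]))"
            by (rule reaches_mono [OF _ order_refl]) (use Q'(3-5) qk in \<open>force simp: append_assoc\<close>)
        qed (use s2 in auto)
      next
        fix s3
        assume "?J (kids (rl v)) s3"
        then obtain Q' rho R where Q': "kahn_state (qkids Q k @ kids (rl v)) (Q @ Q') rho s3"
            "during (Q @ Q') k (kids (rl v)) R rho" "reg s3 4 = k" by blast
        have vk: "(Q @ Q') ! k = v" using kl by (simp add: v_def nth_append)
        have R: "R = []" using Q'(2) by (simp add: during_def vk)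
        have b': "between (Q @ Q') (Suc k) rho" using during_between Q'(2) R by simp
        have "qkids (Q @ Q') (Suc k) = qkids Q k @ kids (rl v)"
          using kl qkids_append [of "Suc k" Q Q'] by (simp add: qkids_Suc v_def)
        moreover have "k + 1 < 2 ^ w" using kN word_rules by linarith
        ultimately show "reaches w (Assign 4 (Bin Add (Reg 4) (Const 1))) s3 10 (kahn_inv (Suc k))"
          using Q' b' by (intro reaches_straight)
            (auto simp: kahn_inv_def kahn_state_def holds_rules_def binop_val_exact
              intro!: exI [of _ "Q @ Q'"] exI [of _ rho])
      qed simp
    qed simp
  qed simp
  then show ?thesis using r4 r5 kl by simp
qed

definition kahn_post :: "nat list \<Rightarrow> (nat \<Rightarrow> nat) \<Rightarrow> state \<Rightarrow> bool" where
  "kahn_post Q rho s \<longleftrightarrow> holds_rules s \<and> reg s 4 = length Q \<and> reg s 5 = length Q \<and>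
     (\<forall>i<length Q. mem s (fld N i 12) = Q ! i \<and> mem s (fld N (Q ! i) 2) = i) \<and>
     (\<forall>c\<in>V. mem s (fld N c 1) = rho c) \<and> (\<forall>i<N. \<forall>f<16. mem s (out N i f) = 0)"

lemma kahn_final:
  "kahn_inv (card V) s \<Longrightarrow> exp_val w (Bin Less (Reg 4) (Reg 5)) s = 0 \<and>
    (\<exists>Q rho. ordered_slp2d \<Sigma> G M Q rho \<and> kahn_post Q rho s)"
proof -
  assume "kahn_inv (card V) s"
  then obtain Q rho where Q: "between Q (card V) rho" "kahn_state (qkids Q (card V)) Q rho s" "reg s 4 = card V"
    by (auto simp: kahn_inv_def)
  have "kahn_post Q rho s" "exp_val w (Bin Less (Reg 4) (Reg 5)) s = 0"
    using Q(2,3) between_ordered(2) [OF Q(1)] by (simp_all add: kahn_state_def kahn_post_def)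
  then show ?thesis using between_ordered(1) [OF Q(1)] by blast
qed

lemma kahn_setup:
  assumes "bfs_post s"
  shows "reaches w kahn_setup s 40 (kahn_inv 0)"
proof (rule reaches_straight)
  have r: "holds_rules s" and c: "\<And>c. c < N \<Longrightarrow> mem s (fld N c 0) = total_in c" and z: "scratch_clear {0, 3} s"
    using assms by (auto simp: bfs_post_def)
  let ?rho = "\<lambda>c. of_bool (c = start G) :: nat"
  have st: "start G \<in> V" "start G < N" using V.start V_less by auto
  have run: "run w kahn_setup s = s\<lparr>reg := (reg s)(4 := 0, 5 := 1),
      mem := (mem s)(fld N 0 12 := start G, fld N (start G) 1 := 1)\<rparr>"
    using r N_pos st by (simp add: kahn_setup_def holds_rules_def)
  have cells: "0 < cells" using area_pos [OF st(1)] area_start by simp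
  \<comment> \<open>Only the start variable has a path so far, so the initial credit is
    \<open>2 * cells - 1\<close>.\<close>
  have "credit [start G] 0 ?rho = (\<Sum>c\<in>{start G}. ?rho c * (2 * area c - 1))"
    unfolding credit_def by (intro sum.mono_neutral_right) (use finite_V st in auto)
  then have "credit [start G] 0 ?rho \<le> 2 * cells" by (simp add: area_start)
  moreover have "queue_ok [start G] 0 [] ?rho"
    using st(1) cells by (auto simp: queue_ok_def)
  ultimately have "between [start G] 0 ?rho" by (simp add: between_def paths_upto_def)
  moreover have "kahn_state [] [start G] ?rho (run w kahn_setup s)"
    unfolding run using r c z N_pos st V_less by (auto simp: kahn_state_def holds_rules_def scratch_clear_def)
  ultimately show "kahn_inv 0 (run w kahn_setup s)"
    by (auto simp: kahn_inv_def run intro!: exI [of _ "[start G]"] exI [of _ ?rho])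
qed (simp_all add: kahn_setup_def)

lemma kahn_correct:
  assumes "bfs_post s"
  shows "reaches w kahn s (350 * N) (\<lambda>s. \<exists>Q rho. ordered_slp2d \<Sigma> G M Q rho \<and> kahn_post Q rho s)"
  unfolding kahn_def
proof (rule reaches_seq [OF kahn_setup [OF assms]])
  fix s
  assume "kahn_inv 0 s"
  from reaches_while [of "card V" kahn_inv w "Bin Less (Reg 4) (Reg 5)" kahn_body "\<lambda>_. 300", OF kahn_body _ this]
  show "reaches w (While (Bin Less (Reg 4) (Reg 5)) kahn_body) s (304 * card V + 4)
      (\<lambda>s. \<exists>Q rho. ordered_slp2d \<Sigma> G M Q rho \<and> kahn_post Q rho s)"
    using kahn_final by (auto elim!: reaches_mono)
next
  show "40 + (304 * card V + 4) \<le> 350 * N" using card_V N_pos by linarith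
qed

end

section \<open>Building the data structure\<close>

text \<open>For positive words this tests equality of \<open>floor_log\<close>, by
  \<open>xor_less_and_iff\<close>.\<close>

definition e_level_eq :: "exp \<Rightarrow> exp \<Rightarrow> exp" where
  "e_level_eq a b = Bin Less (Bin Xor a b) (Bin And a b)"

definition e_same :: "exp \<Rightarrow> exp" where
  "e_same u = Bin And (e_level_eq (Bin Mul (Reg 10) (Reg 11)) (Bin Mul (e_fld u 4) (e_fld u 5)))
     (e_level_eq (e_fld (Reg 6) 1) (e_fld u 1))"

text \<open>Variables are handled from the end of the topological order, so the records of all
  children are complete. Register 4 is the position, 6 the variable, 10 and 11 become its
  dimensions; 13 tells whether it has a symmetric edge, 12 is the target of this edge, 14 and 15 the
  offset of the target; 16, 17 and 18 are the key, the next chain element and the jump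
  target.\<close>

definition fetch :: com where
  "fetch = seqs [Assign 4 (Bin Sub (Reg 4) (Const 1)), Assign 6 (e_fld (Reg 4) 12), Assign 7 (e_inp (Reg 6) 0),
     Assign 8 (e_inp (Reg 6) 1), Assign 9 (e_inp (Reg 6) 2), s_out (Reg 4) 0 (Reg 7), Assign 13 (Const 0)]"

definition choose_sc :: com where
  "choose_sc = Cond (e_same (Reg 8))
     (seqs [Assign 12 (Reg 8), Assign 13 (Const 1), Assign 14 (Const 0), Assign 15 (Const 0)])
     (Cond (e_same (Reg 9))
       (seqs [Assign 12 (Reg 9), Assign 13 (Const 1), Assign 14 (Bin Sub (Reg 10) (e_fld (Reg 9) 4)),
          Assign 15 (Bin Sub (Reg 11) (e_fld (Reg 9) 5))])
       Skip)"

definition rule_sym :: com where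
  "rule_sym = seqs [Assign 10 (Const 1), Assign 11 (Const 1), s_out (Reg 4) 1 (Reg 8)]"

definition cat_head :: com where
  "cat_head = seqs [s_out (Reg 4) 1 (Bin Mul (Const 16) (e_fld (Reg 8) 2)),
     s_out (Reg 4) 2 (Bin Mul (Const 16) (e_fld (Reg 9) 2)),
     Cond (Bin Eq (Reg 7) (Const 1))
       (seqs [Assign 10 (e_fld (Reg 8) 4), Assign 11 (Bin Add (e_fld (Reg 8) 5) (e_fld (Reg 9) 5)),
          s_out (Reg 4) 3 (e_fld (Reg 8) 5)])
       (seqs [Assign 10 (Bin Add (e_fld (Reg 8) 4) (e_fld (Reg 9) 4)), Assign 11 (e_fld (Reg 8) 5),
          s_out (Reg 4) 3 (e_fld (Reg 8) 4)])]"

definition rule_cat :: com where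
  "rule_cat = Seq cat_head choose_sc"

definition rule_run :: com where
  "rule_run = seqs [s_out (Reg 4) 2 (Bin Mul (Const 16) (e_fld (Reg 9) 2)),
     Cond (Bin Eq (Reg 7) (Const 3))
       (seqs [Assign 10 (e_fld (Reg 9) 4), Assign 11 (Bin Mul (Reg 8) (e_fld (Reg 9) 5)),
          s_out (Reg 4) 3 (e_fld (Reg 9) 5)])
       (seqs [Assign 10 (Bin Mul (Reg 8) (e_fld (Reg 9) 4)), Assign 11 (e_fld (Reg 9) 5),
          s_out (Reg 4) 3 (e_fld (Reg 9) 4)])]"

definition measure_rule :: com where
  "measure_rule = Cond (Reg 7) (Cond (Bin Less (Reg 7) (Const 3)) rule_cat rule_run) rule_sym"

definition path_end :: com where
  "path_end = seqs [s_fld (Reg 6) 4 (Reg 10), s_fld (Reg 6) 5 (Reg 11),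
     s_fld (Reg 6) 6 (Bin Mul (Reg 10) (Reg 11)), s_fld (Reg 6) 7 (Reg 6), s_fld (Reg 6) 8 (Const 0),
     s_fld (Reg 6) 9 (Reg 6), s_fld (Reg 6) 10 (Const 0), s_fld (Reg 6) 11 (Const 0)]"

text \<open>The stack is implicit in the \<open>nx\<close> pointers. The loop condition compares
  priorities by their keys, as justified by \<open>floor_log_le_iff_level\<close>, and the sentinel
  at the end of the path stops the loop.\<close>

definition climb :: com where
  "climb = seqs [
     Assign 16 (Bin Xor (Bin Mul (Reg 10) (Reg 11)) (Bin Mul (e_fld (Reg 12) 4) (e_fld (Reg 12) 5))),
     Assign 17 (Reg 12),
     While (Bin Or (e_level_eq (Reg 16) (e_fld (Reg 17) 6)) (Bin Less (e_fld (Reg 17) 6) (Reg 16)))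
       (Assign 17 (e_fld (Reg 17) 7))]"

text \<open>The condition compares the last two jump lengths, which is the rule of
  \<open>jp_Some\<close>.\<close>

definition store_path :: com where
  "store_path = seqs [
     Assign 18 (e_fld (Reg 17) 9),
     Cond (Bin Eq (Bin Sub (e_fld (Reg 17) 8) (e_fld (Reg 18) 8))
                  (Bin Sub (e_fld (Reg 18) 8) (e_fld (e_fld (Reg 18) 9) 8)))
       (Assign 18 (e_fld (Reg 18) 9)) (Assign 18 (Reg 17)),
     s_fld (Reg 6) 4 (Reg 10), s_fld (Reg 6) 5 (Reg 11), s_fld (Reg 6) 6 (Reg 16), s_fld (Reg 6) 7 (Reg 17),
     s_fld (Reg 6) 8 (Bin Add (e_fld (Reg 17) 8) (Const 1)), s_fld (Reg 6) 9 (Reg 18),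
     s_fld (Reg 6) 10 (Bin Add (Reg 14) (e_fld (Reg 12) 10)),
     s_fld (Reg 6) 11 (Bin Add (Reg 15) (e_fld (Reg 12) 11))]"

definition store_link :: "nat \<Rightarrow> nat \<Rightarrow> com" where
  "store_link r f = seqs [s_out (Reg 4) f (Bin Mul (Const 16) (e_fld (Reg r) 2)),
     s_out (Reg 4) (f + 1) (Bin Sub (e_fld (Reg 6) 10) (e_fld (Reg r) 10)),
     s_out (Reg 4) (f + 2) (Bin Sub (e_fld (Reg 6) 11) (e_fld (Reg r) 11)),
     s_out (Reg 4) (f + 3) (e_fld (Reg r) 4), s_out (Reg 4) (f + 4) (e_fld (Reg r) 5)]"

definition build_body :: com where
  "build_body = seqs [fetch, measure_rule,
     Cond (Reg 13) (seqs [climb, store_path, store_link 18 4, store_link 17 9]) path_end]"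

definition build :: com where
  "build = seqs [While (Reg 4) build_body, Assign 0 (Reg 3), Assign 1 (Bin Mul (Const 16) (Reg 5))]"

lemma and_of_bool: "semiring_bit_operations_class.and (of_bool a) (of_bool b :: nat) = of_bool (a \<and> b)"
  by (cases a; cases b) auto

lemma or_of_bool: "semiring_bit_operations_class.or (of_bool a) (of_bool b :: nat) = of_bool (a \<or> b)"
  by (cases a; cases b) auto

text \<open>As \<open>floor_log\<close> is monotone, the test for equal levels together with an
  ordinary comparison of the numbers decides the order of their levels.\<close>

lemma floor_log_le_iff_level:
  "floor_log b \<le> floor_log a \<longleftrightarrow> floor_log a = floor_log b \<or> b < a"
  by (metis floor_log_le_iff le_cases less_or_eq_imp_le linorder_not_less order_le_less)

section \<open>Output records and the state while a variable is processed\<close>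

locale slp2d_builder = slp2d_machine \<Sigma> G M w + ordered_slp2d \<Sigma> G M Q rho for \<Sigma> G M w Q rho
begin

definition pos :: "nat \<Rightarrow> nat" where "pos v = (THE i. i < length Q \<and> Q ! i = v)"

lemma pos_nth: "i < length Q \<Longrightarrow> pos (Q ! i) = i"
  unfolding pos_def using distinct_Q by (intro the_equality) (auto simp: nth_eq_iff_index_eq)

lemma pos: "v \<in> V \<Longrightarrow> pos v < length Q" "v \<in> V \<Longrightarrow> Q ! pos v = v"
  using set_Q pos_nth by (metis in_set_conv_nth)+

lemma length_Q_card: "length Q = card V"
  using distinct_Q set_Q distinct_card by metis

lemma length_Q_le_N: "length Q \<le> N"
  using length_Q_card card_V by simp

lemma pos_inject: "v \<in> V \<Longrightarrow> u \<in> V \<Longrightarrow> pos v = pos u \<longleftrightarrow> v = u"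
  using pos(2) by metis

lemma pos_less_N: "v \<in> V \<Longrightarrow> pos v < N"
  using pos(1) length_Q_le_N by fastforce

lemma pos_kid:
  assumes "v \<in> V" "c \<in> set (kids (rl v))"
  shows "pos v < pos c"
proof (rule ccontr)
  have c: "c \<in> V" by (rule V.kid [OF assms])
  assume "\<not> pos v < pos c"
  then have "c \<in> set (take (Suc (pos v)) Q)"
    using pos [OF c] by (auto simp: in_set_conv_nth intro!: exI [of _ "pos c"])
  then show False using Q_topological [of "pos v" c] pos [OF assms(1)] assms(2) by simp
qed

lemma pos_spath: "x \<in> set (spath v) \<Longrightarrow> pos v \<le> pos x"
proof (induction v rule: sc_induct)
  case (Some v u)
  then show ?case using pos_kid [OF scD(1,3) [OF Some(1)]] by (auto simp: spath_Some)
qed (simp add: spath_None)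

lemma nr_le_cells: "v \<in> V \<Longrightarrow> nr v \<le> cells" and nc_le_cells: "v \<in> V \<Longrightarrow> nc v \<le> cells"
proof -
  assume v: "v \<in> V"
  have "nr v * 1 \<le> nr v * nc v" "1 * nc v \<le> nr v * nc v"
    using nr_pos [OF v] nc_pos [OF v] by (intro mult_le_mono; simp)+
  then show "nr v \<le> cells" "nc v \<le> cells"
    using area_le_cells [OF v] unfolding area_def by linarith+
qed

lemma cells_pos: "0 < cells"
  using area_pos [OF V.start] area_start by simp

text \<open>Output records are ordered topologically, the start variable first, and refer to each other by
  address. Word 3 is the size of the first child along the direction of the rule. A variable without
  symmetric edge gets empty boxes as its links, which contain no cell, so queries need no test for it.\<close>

definition link :: "nat \<Rightarrow> nat \<Rightarrow> nat \<Rightarrow> nat" where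
  "link v x f = (if sc v = None then 0 else [16 * pos x, endr v - endr x, endc v - endc x, nr x, nc x] ! f)"

definition rule_word :: "nat \<Rightarrow> nat \<Rightarrow> nat" where
  "rule_word v f = (case rl v of
      Sym a \<Rightarrow> [0, a, 0, 0] ! f
    | HCat B C \<Rightarrow> [1, 16 * pos B, 16 * pos C, nc B] ! f
    | VCat B C \<Rightarrow> [2, 16 * pos B, 16 * pos C, nr B] ! f
    | HRun k B \<Rightarrow> [3, 0, 16 * pos B, nc B] ! f
    | VRun k B \<Rightarrow> [4, 0, 16 * pos B, nr B] ! f)"

definition word :: "nat \<Rightarrow> nat \<Rightarrow> nat" where
  "word v f = (if f < 4 then rule_word v f else if f < 9 then link v (jp v) (f - 4)
     else if f < 14 then link v (nx v) (f - 9) else 0)"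

definition scratch_ok :: "nat \<Rightarrow> state \<Rightarrow> bool" where
  "scratch_ok v s \<longleftrightarrow> mem s (fld N v 4) = nr v \<and> mem s (fld N v 5) = nc v \<and> mem s (fld N v 6) = key v \<and>
     mem s (fld N v 7) = nx v \<and> mem s (fld N v 8) = depth v \<and> mem s (fld N v 9) = jp v \<and>
     mem s (fld N v 10) = endr v \<and> mem s (fld N v 11) = endc v"

text \<open>Records at later positions are complete, and output at earlier ones is still zero.
  Because of these zeros, an output word whose value is 0 counts as written without a store.\<close>

definition at_var :: "nat \<Rightarrow> nat \<Rightarrow> state \<Rightarrow> bool" where
  "at_var v k s \<longleftrightarrow> holds_rules s \<and> reg s 4 = pos v \<and> reg s 5 = length Q \<and> reg s 6 = v \<and>
     (\<forall>i<length Q. mem s (fld N i 12) = Q ! i) \<and>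
     (\<forall>c\<in>V. mem s (fld N c 1) = rho c \<and> mem s (fld N c 2) = pos c) \<and>
     (\<forall>c\<in>V. pos v < pos c \<longrightarrow> scratch_ok c s) \<and>
     (\<forall>i<length Q. \<forall>f<16. i \<noteq> pos v \<longrightarrow> mem s (out N i f) = (if pos v < i then word (Q ! i) f else 0)) \<and>
     (\<forall>f<16. mem s (out N (pos v) f) = (if f < k then word v f else 0))"

lemma level_val:
  assumes "exp_val w a s = x" "exp_val w b s = y" "0 < x" "0 < y"
  shows "exp_val w (e_level_eq a b) s = of_bool (floor_log x = floor_log y)"
  using assms by (simp add: e_level_eq_def xor_less_and_iff)

lemma area_val: "v \<in> V \<Longrightarrow> binop_val w Mul (nr v) (nc v) = area v"
  using area_le_cells [of v] word_cells cells_pos by (simp add: area_def binop_val_exact)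

lemma same_val:
  assumes s: "at_var v k s" and v: "v \<in> V" and u: "u \<in> V" "pos v < pos u"
    and r: "reg s 10 = nr v" "reg s 11 = nc v" "exp_val w e s = u"
  shows "exp_val w (e_same e) s = of_bool (same v u)"
proof -
  have m: "mem s (fld N u 4) = nr u" "mem s (fld N u 5) = nc u" "mem s (fld N u 1) = rho u"
      "mem s (fld N v 1) = rho v" "reg s 6 = v" "reg s 2 = 3 * N"
    using s u v by (auto simp: at_var_def scratch_ok_def holds_rules_def)
  have uN: "u < N" "v < N" using u v V_less by auto
  have "exp_val w (e_level_eq (Bin Mul (Reg 10) (Reg 11)) (Bin Mul (e_fld e 4) (e_fld e 5))) s =
      of_bool (floor_log (area v) = floor_log (area u))"
    by (rule level_val) (use m uN r area_val area_pos u v in simp_all)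
  moreover have "exp_val w (e_level_eq (e_fld (Reg 6) 1) (e_fld e 1)) s = of_bool (floor_log (rho v) = floor_log (rho u))"
    by (rule level_val) (use m uN r rho_pos u v in simp_all)
  ultimately show ?thesis by (simp add: e_same_def and_of_bool same_def)
qed

definition measured :: "nat \<Rightarrow> state \<Rightarrow> bool" where
  "measured v s \<longleftrightarrow> at_var v 4 s \<and> reg s 10 = nr v \<and> reg s 11 = nc v \<and> reg s 13 = of_bool (sc v \<noteq> None) \<and>
     (\<forall>u. sc v = Some u \<longrightarrow> reg s 12 = u \<and> reg s 14 = offr v u \<and> reg s 15 = offc v u)"

lemma choose_sc:
  assumes s: "at_var v 4 s" and v: "v \<in> V" and r: "rl v = HCat B C \<or> rl v = VCat B C"
    and regs: "reg s 8 = B" "reg s 9 = C" "reg s 10 = nr v" "reg s 11 = nc v" "reg s 13 = 0"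
  shows "reaches w choose_sc s 200 (measured v)"
proof (rule reaches_straight)
  have B: "B \<in> V" "pos v < pos B" and C: "C \<in> V" "pos v < pos C"
    using V.kid [OF v] pos_kid [OF v] r by auto
  have sb: "exp_val w (e_same (Reg 8)) s = of_bool (same v B)"
    and sC: "exp_val w (e_same (Reg 9)) s = of_bool (same v C)"
    by (rule same_val [OF s v]; use B C regs in simp)+
  have e: "sc v = same_of v B C" using r v by (auto simp: sc_def)
  have m: "mem s (fld N C 4) = nr C" "mem s (fld N C 5) = nc C" "reg s 2 = 3 * N"
    using s C by (auto simp: at_var_def scratch_ok_def holds_rules_def)
  have CN: "C < N" by (rule V_less [OF C(1)])
  have le: "nr C \<le> nr v" "nc C \<le> nc v" using kid_dims [OF v, of C] r by auto
  have lt: "nr v < 2 ^ w" "nc v < 2 ^ w"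
    using nr_le_cells [OF v] nc_le_cells [OF v] word_cells cells_pos by linarith+
  have sub: "binop_val w Sub (nr v) (nr C) = nr v - nr C" "binop_val w Sub (nc v) (nc C) = nc v - nc C"
    using le lt by (simp_all add: binop_val_exact)
  have ld: "lead (rl v) = B" using r by auto
  have av: "at_var v 4 (s\<lparr>reg := (reg s)(12 := a, 13 := b, 14 := c, 15 := d)\<rparr>)" for a b c d
    using s by (auto simp: at_var_def holds_rules_def scratch_ok_def)
  consider "same v B" | "\<not> same v B" "same v C" | "\<not> same v B" "\<not> same v C" by blast
  then show "measured v (run w choose_sc s)"
  proof cases
    case 1
    then have "run w choose_sc s = s\<lparr>reg := (reg s)(12 := B, 13 := 1, 14 := 0, 15 := 0)\<rparr>"
      using sb regs by (simp add: choose_sc_def fun_upd_def)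
    then show ?thesis using 1 e av regs ld by (auto simp: measured_def same_of_def offr_def offc_def)
  next
    case 2
    then have "run w choose_sc s = s\<lparr>reg := (reg s)(12 := C, 13 := 1, 14 := nr v - nr C, 15 := nc v - nc C)\<rparr>"
      using sb sC regs m CN sub by (simp add: choose_sc_def)
    moreover have "C \<noteq> B" using 2 by auto
    ultimately show ?thesis using 2 e av regs ld by (auto simp: measured_def same_of_def offr_def offc_def)
  next
    case 3
    then have "run w choose_sc s = s" using sb sC by (simp add: choose_sc_def)
    then show ?thesis using 3 e s regs by (auto simp: measured_def same_of_def)
  qed
qed (simp_all add: choose_sc_def e_same_def e_level_eq_def)

definition fetched :: "nat \<Rightarrow> state \<Rightarrow> bool" where
  "fetched v s \<longleftrightarrow> at_var v 1 s \<and> reg s 7 = tag (rl v) \<and> reg s 8 = arg1 (rl v) \<and> reg s 9 = arg2 (rl v) \<and> reg s 13 = 0"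

lemma pos16: "v \<in> V \<Longrightarrow> binop_val w Mul 16 (pos v) = 16 * pos v"
  using pos_less_N [of v] word_rules by (simp add: binop_val_exact)

lemma less_4_cases: "(f::nat) < 4 \<longleftrightarrow> f = 0 \<or> f = 1 \<or> f = 2 \<or> f = 3"
  by auto

lemma rule_sym:
  assumes s: "fetched v s" and v: "v \<in> V" and r: "rl v = Sym a"
  shows "reaches w rule_sym s 300 (measured v)"
proof (rule reaches_straight)
  have a: "at_var v 1 s" "reg s 8 = a" "reg s 13 = 0" using s r by (auto simp: fetched_def)
  have regs: "reg s 3 = 19 * N" "reg s 4 = pos v" using a(1) by (auto simp: at_var_def holds_rules_def)
  have run: "run w rule_sym s = s\<lparr>reg := (reg s)(10 := 1, 11 := 1), mem := (mem s)(out N (pos v) 1 := a)\<rparr>"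
    using a regs pos_less_N [OF v] by (simp add: rule_sym_def)
  have wd: "word v f = [0, a, 0, 0] ! f" if "f < 4" for f using r that by (simp add: word_def rule_word_def)
  have "at_var v 4 (run w rule_sym s)"
    unfolding run using a(1) wd [of 0] wd [of 1] wd [of 2] wd [of 3] V_less length_Q_le_N pos_less_N [OF v]
    by (auto simp: at_var_def holds_rules_def scratch_ok_def less_4_cases)
  then show "measured v (run w rule_sym s)"
    using Sym_expn(1,2) [OF v r] a(3) r by (auto simp: measured_def run sc_def)
qed (simp_all add: rule_sym_def)

lemma rule_run:
  assumes s: "fetched v s" and v: "v \<in> V" and r: "rl v = HRun k B \<or> rl v = VRun k B"
  shows "reaches w rule_run s 300 (measured v)"
proof (rule reaches_straight)
  have a: "at_var v 1 s" "reg s 8 = k" "reg s 9 = B" "reg s 13 = 0" "reg s 7 = tag (rl v)"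
    using s r by (auto simp: fetched_def)
  have regs: "reg s 3 = 19 * N" "reg s 4 = pos v" "reg s 2 = 3 * N" using a(1) by (auto simp: at_var_def holds_rules_def)
  have B: "B \<in> V" "pos v < pos B" using V.kid [OF v] pos_kid [OF v] r by auto
  have m: "mem s (fld N B 4) = nr B" "mem s (fld N B 5) = nc B" "mem s (fld N B 2) = pos B"
    using a(1) B by (auto simp: at_var_def scratch_ok_def)
  have N: "B < N" "pos v < N" using V_less [OF B(1)] pos_less_N [OF v] by auto
  have nx: "sc v = None" using r by (auto simp: sc_def)
  let ?h = "tag (rl v) = 3"
  let ?w = "if ?h then nc B else nr B"
  have dims: "(if ?h then nr B else k * nr B) = nr v" "(if ?h then k * nc B else nc B) = nc v"
  proof -
    from r have "(if ?h then nr B else k * nr B) = nr v \<and> (if ?h then k * nc B else nc B) = nc v"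
    proof
      assume h: "rl v = HRun k B"
      then show ?thesis using HRun_expn(3,4) [OF v h] by simp
    next
      assume h: "rl v = VRun k B"
      then show ?thesis using VRun_expn(3,4) [OF v h] by simp
    qed
    then show "(if ?h then nr B else k * nr B) = nr v" "(if ?h then k * nc B else nc B) = nc v" by blast+
  qed
  have mul: "binop_val w Mul k (if ?h then nc B else nr B) = (if ?h then nc v else nr v)"
  proof -
    have e: "k * (if ?h then nc B else nr B) = (if ?h then nc v else nr v)" using dims by (auto split: if_splits)
    have "(if ?h then nc v else nr v) < 2 ^ w"
      using nr_le_cells [OF v] nc_le_cells [OF v] word_cells cells_pos by simp
    then show ?thesis using binop_val_exact(3) [of k "if ?h then nc B else nr B" w] unfolding e by blast
  qed
  have run: "run w rule_run s = s\<lparr>reg := (reg s)(10 := nr v, 11 := nc v),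
      mem := (mem s)(out N (pos v) 2 := 16 * pos B, out N (pos v) 3 := ?w)\<rparr>"
    using a regs N m pos16 [OF B(1)] mul dims by (cases ?h) (simp_all add: rule_run_def)
  have wd: "word v f = [tag (rl v), 0, 16 * pos B, ?w] ! f" if "f < 4" for f
    using r that by (auto simp: word_def rule_word_def)
  have "at_var v 4 (run w rule_run s)"
    unfolding run using a(1) wd [of 0] wd [of 1] wd [of 2] wd [of 3] V_less length_Q_le_N N
    by (auto simp: at_var_def holds_rules_def scratch_ok_def less_4_cases)
  then show "measured v (run w rule_run s)"
    using a nx by (auto simp: measured_def run)
qed (simp_all add: rule_run_def)

lemma rule_cat:
  assumes s: "fetched v s" and v: "v \<in> V" and r: "rl v = HCat B C \<or> rl v = VCat B C"
  shows "reaches w rule_cat s 400 (measured v)"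
proof -
  have a: "at_var v 1 s" "reg s 8 = B" "reg s 9 = C" "reg s 13 = 0" "reg s 7 = tag (rl v)"
    using s r by (auto simp: fetched_def)
  have regs: "reg s 3 = 19 * N" "reg s 4 = pos v" "reg s 2 = 3 * N" using a(1) by (auto simp: at_var_def holds_rules_def)
  have B: "B \<in> V" "pos v < pos B" and C: "C \<in> V" "pos v < pos C"
    using V.kid [OF v] pos_kid [OF v] r by auto
  have m: "mem s (fld N B 4) = nr B" "mem s (fld N B 5) = nc B" "mem s (fld N B 2) = pos B"
    "mem s (fld N C 4) = nr C" "mem s (fld N C 5) = nc C" "mem s (fld N C 2) = pos C"
    using a(1) B C by (auto simp: at_var_def scratch_ok_def)
  have N: "B < N" "C < N" "pos v < N" using V_less B C pos_less_N [OF v] by auto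
  let ?h = "tag (rl v) = 1"
  let ?w = "if ?h then nc B else nr B"
  have dims: "(if ?h then nr B else nr B + nr C) = nr v" "(if ?h then nc B + nc C else nc B) = nc v"
  proof -
    from r have "(if ?h then nr B else nr B + nr C) = nr v \<and> (if ?h then nc B + nc C else nc B) = nc v"
    proof
      assume h: "rl v = HCat B C"
      then show ?thesis using HCat_expn(3,5) [OF v h] by simp
    next
      assume h: "rl v = VCat B C"
      then show ?thesis using VCat_expn(3,5) [OF v h] by simp
    qed
    then show "(if ?h then nr B else nr B + nr C) = nr v" "(if ?h then nc B + nc C else nc B) = nc v" by blast+
  qed
  have add: "binop_val w Add ?w (if ?h then nc C else nr C) = (if ?h then nc v else nr v)"
  proof -
    have e: "?w + (if ?h then nc C else nr C) = (if ?h then nc v else nr v)" using dims by (auto split: if_splits)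
    have "(if ?h then nc v else nr v) < 2 ^ w"
      using nr_le_cells [OF v] nc_le_cells [OF v] word_cells cells_pos by simp
    then show ?thesis using binop_val_exact(1) [of ?w "if ?h then nc C else nr C" w] unfolding e by blast
  qed
  have run: "run w cat_head s = s\<lparr>reg := (reg s)(10 := nr v, 11 := nc v),
      mem := (mem s)(out N (pos v) 1 := 16 * pos B, out N (pos v) 2 := 16 * pos C, out N (pos v) 3 := ?w)\<rparr>"
    using a regs N m pos16 [OF B(1)] pos16 [OF C(1)] add dims by (cases ?h) (simp_all add: cat_head_def)
  have wd: "word v f = [tag (rl v), 16 * pos B, 16 * pos C, ?w] ! f" if "f < 4" for f
    using r that by (auto simp: word_def rule_word_def)
  have "at_var v 4 (run w cat_head s)"
    unfolding run using a(1) wd [of 0] wd [of 1] wd [of 2] wd [of 3] V_less length_Q_le_N N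
    by (auto simp: at_var_def holds_rules_def scratch_ok_def less_4_cases)
  then have "at_var v 4 (run w cat_head s) \<and> reg (run w cat_head s) 8 = B \<and> reg (run w cat_head s) 9 = C \<and>
      reg (run w cat_head s) 10 = nr v \<and> reg (run w cat_head s) 11 = nc v \<and> reg (run w cat_head s) 13 = 0"
    using a by (simp add: run)
  then have "reaches w cat_head s 150 (\<lambda>s. at_var v 4 s \<and> reg s 8 = B \<and> reg s 9 = C \<and> reg s 10 = nr v \<and>
      reg s 11 = nc v \<and> reg s 13 = 0)"
    by (intro reaches_straight) (simp_all add: cat_head_def)
  then show ?thesis
    unfolding rule_cat_def by (rule reaches_seq [where T' = 200]) (use choose_sc v r in auto)
qed

lemma jp_in_spath: "jp v \<in> set (spath v)"
  unfolding jp_def using subsetD [OF set_chain nth_mem] length_chain_depth [of v] by simp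

lemma nx_in_spath: "nx v \<in> set (spath v)"
  using subsetD [OF set_chain nth_mem, of 1 v] length_chain_depth [of v] by (simp add: nx_def)

lemma jp_V: "v \<in> V \<Longrightarrow> jp v \<in> V" and nx_V: "v \<in> V \<Longrightarrow> nx v \<in> V"
  using spath_same(1) jp_in_spath nx_in_spath by blast+

text \<open>Edges lead to later positions in the topological order. So the chain records that the
  construction reads while it handles \<open>v\<close> are complete.\<close>

lemma chain_sc_pos:
  assumes "sc v = Some u" "x \<in> set (chain u)"
  shows "x \<in> V" "pos v < pos x"
proof -
  have x: "x \<in> set (spath u)" using assms(2) set_chain by blast
  show "x \<in> V" by (rule spath_same(1) [OF x scD(2) [OF assms(1)]])
  show "pos v < pos x" using pos_spath [OF x] pos_kid [OF scD(1,3) [OF assms(1)]] by simp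
qed

lemma nx_sc_pos: "sc v = Some u \<Longrightarrow> nx v \<in> V \<and> pos v < pos (nx v)"
  using chain_sc_pos pops_Some(1,2) by simp

lemma jp_sc_pos: 
  assumes "sc v = Some u"
  shows "pos v < pos (jp (nx v))" "pos v < pos (jp (jp (nx v)))" "jp v \<in> V" "pos v < pos (jp v)"
proof -
  show 1: "pos v < pos (jp (nx v))" using nx_sc_pos [OF assms] pos_spath [OF jp_in_spath [of "nx v"]] by simp
  show 2: "pos v < pos (jp (jp (nx v)))" using 1 pos_spath [OF jp_in_spath [of "jp (nx v)"]] by simp
  show "jp v \<in> V" by (rule jp_V [OF scD(1) [OF assms]])
  show "pos v < pos (jp v)" using 1 2 nx_sc_pos [OF assms] unfolding jp_Some [OF assms] by simp
qed

lemma end_le: "endr v \<le> nr v \<and> endc v \<le> nc v"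
proof (induction v rule: sc_induct)
  case (Some v u)
  then show ?case using sc_place(1,2) [OF Some(1)] endr_Some [OF Some(1)] endc_Some [OF Some(1)] by linarith
qed (simp add: endr_None endc_None)

definition built :: "nat \<Rightarrow> state \<Rightarrow> bool" where
  "built k s \<longleftrightarrow> holds_rules s \<and> reg s 4 = k \<and> reg s 5 = length Q \<and>
     (\<forall>i<length Q. mem s (fld N i 12) = Q ! i) \<and>
     (\<forall>c\<in>V. mem s (fld N c 1) = rho c \<and> mem s (fld N c 2) = pos c) \<and>
     (\<forall>c\<in>V. k \<le> pos c \<longrightarrow> scratch_ok c s) \<and>
     (\<forall>i<length Q. \<forall>f<16. mem s (out N i f) = (if k \<le> i then word (Q ! i) f else 0))"

lemma built_at_var:
  assumes "at_var v 14 s" "scratch_ok v s" "v \<in> V"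
  shows "built (pos v) s"
proof -
  have "mem s (out N (pos v) f) = word v f" if "f < 16" for f
    using assms(1) that by (auto simp: at_var_def word_def)
  moreover have "scratch_ok c s" if "c \<in> V" "pos v \<le> pos c" for c
    using assms that pos_inject [of v c] by (cases "v = c") (auto simp: at_var_def)
  moreover have "mem s (out N i f) = (if pos v \<le> i then word (Q ! i) f else 0)" if "i < length Q" "f < 16" for i f
  proof (cases "i = pos v")
    case True
    then show ?thesis using calculation(1) [OF that(2)] pos(2) [OF assms(3)] by simp
  next
    case False
    then show ?thesis using assms(1) that unfolding at_var_def by (simp add: order_le_less)
  qed
  ultimately show ?thesis using assms(1) unfolding at_var_def built_def by simp
qed

lemma fetch:
  assumes b: "built (Suc (pos v)) s" and v: "v \<in> V"
  shows "reaches w fetch s 70 (fetched v)"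
proof (rule reaches_straight)
  have r: "reg s 2 = 3 * N" "reg s 3 = 19 * N" "reg s 4 = Suc (pos v)" using b by (auto simp: built_def holds_rules_def)
  have N: "v < N" "pos v < N" using V_less v pos_less_N by auto
  have m: "mem s (fld N (pos v) 12) = v" "mem s (inp v 0) = tag (rl v)" "mem s (inp v 1) = arg1 (rl v)"
    "mem s (inp v 2) = arg2 (rl v)"
    using b pos [OF v] N by (auto simp: built_def holds_rules_def)
  have "Suc (pos v) < 2 ^ w" using N(2) word_rules by linarith
  then have sub: "binop_val w Sub (Suc (pos v)) 1 = pos v" by (simp add: binop_val_exact)
  have wd: "word v 0 = tag (rl v)" by (cases "rl v") (simp_all add: word_def rule_word_def)
  have run: "run w fetch s = s\<lparr>reg := (reg s)(4 := pos v, 6 := v, 7 := tag (rl v), 8 := arg1 (rl v),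
      9 := arg2 (rl v), 13 := 0), mem := (mem s)(out N (pos v) 0 := tag (rl v))\<rparr>"
    using r m N sub by (simp add: fetch_def)
  have "at_var v 1 (run w fetch s)"
    unfolding run using b N V_less length_Q_le_N wd pos(1) [OF v]
    by (auto simp: at_var_def built_def holds_rules_def scratch_ok_def)
  then show "fetched v (run w fetch s)" by (simp add: fetched_def run)
qed (simp_all add: fetch_def)

lemma measure_rule:
  assumes f: "fetched v s" and v: "v \<in> V"
  shows "reaches w measure_rule s 450 (measured v)"
proof -
  have r7: "reg s 7 = tag (rl v)" using f by (simp add: fetched_def)
  have cat: "reaches w (Cond (Bin Less (Reg 7) (Const 3)) rule_cat rule_run) s 420 (measured v)"
    if "tag (rl v) \<noteq> 0"
  proof (rule reaches_cond [where T = 400])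
    assume "exp_val w (Bin Less (Reg 7) (Const 3)) s \<noteq> 0"
    then have "tag (rl v) < 3" using r7 by (simp split: if_splits)
    then have "\<exists>B C. rl v = HCat B C \<or> rl v = VCat B C" using that by (cases "rl v") auto
    then show "reaches w rule_cat s 400 (measured v)" using rule_cat [OF f v] by blast
  next
    assume "exp_val w (Bin Less (Reg 7) (Const 3)) s = 0"
    then have "\<not> tag (rl v) < 3" using r7 by (simp split: if_splits)
    then have "\<exists>k B. rl v = HRun k B \<or> rl v = VRun k B" by (cases "rl v") auto
    then have "reaches w rule_run s 300 (measured v)" using rule_run [OF f v] by blast
    then show "reaches w rule_run s 400 (measured v)" by (rule reaches_mono) auto
  qed simp
  have sym: "reaches w rule_sym s 420 (measured v)" if "tag (rl v) = 0"
  proof -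
    obtain a where "rl v = Sym a" using \<open>tag (rl v) = 0\<close> by (cases "rl v") auto
    from rule_sym [OF f v this] show ?thesis by (rule reaches_mono) auto
  qed
  show ?thesis unfolding measure_rule_def
    by (rule reaches_cond [where T = 420]) (use cat sym r7 in auto)
qed

lemma path_end:
  assumes m: "measured v s" and v: "v \<in> V" and n: "sc v = None"
  shows "reaches w path_end s 120 (built (pos v))"
proof (rule reaches_straight)
  have a: "at_var v 4 s" and r: "reg s 10 = nr v" "reg s 11 = nc v" "reg s 6 = v" "reg s 2 = 3 * N"
    using m by (auto simp: measured_def at_var_def holds_rules_def)
  have vN: "v < N" by (rule V_less [OF v])
  have run: "run w path_end s = s\<lparr>mem := (mem s)(fld N v 4 := nr v, fld N v 5 := nc v, fld N v 6 := area v,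
      fld N v 7 := v, fld N v 8 := 0, fld N v 9 := v, fld N v 10 := 0, fld N v 11 := 0)\<rparr>"
    using r vN area_val [OF v] by (simp add: path_end_def)
  \<comment> \<open>The empty links of the last variable of a path are all zero, as the output area
    already is.\<close>
  have z: "word v f = 0" if "4 \<le> f" "f < 14" for f
    using that n by (simp add: word_def link_def)
  have sv: "scratch_ok v (run w path_end s)"
    unfolding run scratch_ok_def
    by (simp add: key_def n nx_None jp_None depth_None endr_None endc_None)
  have "at_var v 14 (run w path_end s)"
    unfolding run using a vN V_less length_Q_le_N pos_less_N [OF v] z
    by (auto simp: at_var_def holds_rules_def scratch_ok_def)
  then show "built (pos v) (run w path_end s)" using sv v by (rule built_at_var)
qed (simp_all add: path_end_def)

definition climbed :: "nat \<Rightarrow> state \<Rightarrow> bool" where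
  "climbed v s \<longleftrightarrow> measured v s \<and> reg s 16 = key v \<and> reg s 17 = nx v"

text \<open>The loop passes the first \<open>pops v\<close> elements of the successor's chain and
  stops at the next one, which is \<open>nx v\<close>. The linear term is the one that
  \<open>sum_pops\<close> amortises.\<close>

lemma climb:
  assumes m: "measured v s" and sc: "sc v = Some u"
  shows "reaches w climb s (100 + 60 * pops v) (climbed v)"
proof -
  note v = scD(1) [OF sc] and u = scD(2) [OF sc]
  have a: "at_var v 4 s" and r: "reg s 10 = nr v" "reg s 11 = nc v" "reg s 12 = u" "reg s 6 = v" "reg s 2 = 3 * N"
    using m sc by (auto simp: measured_def at_var_def holds_rules_def)
  have uN: "u < N" by (rule V_less [OF u])
  have su: "scratch_ok u s" using a u pos_kid [OF v scD(3) [OF sc]] by (simp add: at_var_def)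
  have mu: "mem s (fld N u 4) = nr u" "mem s (fld N u 5) = nc u" using su by (auto simp: scratch_ok_def)
  let ?at = "\<lambda>k. s\<lparr>reg := (reg s)(16 := key v, 17 := chain u ! k)\<rparr>"
  let ?I = "\<lambda>k s'. s' = ?at k"
  let ?e = "Bin Or (e_level_eq (Reg 16) (e_fld (Reg 17) 6)) (Bin Less (e_fld (Reg 17) 6) (Reg 16))"
  let ?p = "Assign 17 (e_fld (Reg 17) 7)"
  have kv: "key v = semiring_bit_operations_class.xor (area v) (area u)" using sc by (simp add: key_def)
  have x: "chain u ! k \<in> V" "chain u ! k < N" "scratch_ok (chain u ! k) s" if "k < length (chain u)" for k
  proof -
    have "chain u ! k \<in> set (chain u)" using that by simp
    note c = chain_sc_pos [OF sc this]
    show "chain u ! k \<in> V" "chain u ! k < N" "scratch_ok (chain u ! k) s"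
      using c V_less [OF c(1)] a by (auto simp: at_var_def)
  qed
  have ev: "exp_val w ?e (?at k) = of_bool (prio (chain u ! k) \<le> prio v)" if k: "k < length (chain u)" for k
  proof -
    have f: "exp_val w (e_fld (Reg 17) 6) (?at k) = key (chain u ! k)"
      using r x [OF k] by (simp add: scratch_ok_def)
    have "exp_val w (e_level_eq (Reg 16) (e_fld (Reg 17) 6)) (?at k) =
        of_bool (floor_log (key v) = floor_log (key (chain u ! k)))"
      by (rule level_val) (use f key_pos v x [OF k] in simp_all)
    then show ?thesis using f
      by (simp add: or_of_bool prio_def floor_log_le_iff_level [of "key (chain u ! k)" "key v"])
  qed
  have "reaches w (Assign 16 (Bin Xor (Bin Mul (Reg 10) (Reg 11)) (Bin Mul (e_fld (Reg 12) 4) (e_fld (Reg 12) 5)))) s 27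
      (\<lambda>s'. s' = s\<lparr>reg := (reg s)(16 := key v)\<rparr>)"
    by (intro reaches_straight) (use r uN mu area_val [OF v] area_val [OF u] kv in simp_all)
  then show ?thesis unfolding climb_def seqs.simps
  proof (rule reaches_seq [where T' = "60 + 60 * pops v"])
    fix s1
    assume s1: "s1 = s\<lparr>reg := (reg s)(16 := key v)\<rparr>"
    show "reaches w (Seq (Assign 17 (Reg 12)) (While ?e ?p)) s1 (60 + 60 * pops v) (climbed v)"
    proof (rule reaches_seq [where T = 2 and R = "?I 0" and T' = "50 + 60 * pops v"])
      show "reaches w (Assign 17 (Reg 12)) s1 2 (?I 0)"
        by (rule reaches_straight) (use s1 r in simp_all)
    next
      fix s2
      assume s2: "?I 0 s2"
      have "reaches w (While ?e ?p) s2 ((\<Sum>k<pops v. 9) + Suc (pops v) * (1 + exp_time ?e)) (?I (pops v))"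
      proof (rule reaches_while [where I = ?I, OF _ _ s2])
        fix k s'
        assume k: "k < pops v" and s': "?I k s'"
        have l: "Suc k < length (chain u)" using k pops_Some(1) [OF sc] by simp
        have nx: "nx (chain u ! k) = chain u ! Suc k" by (rule chain_nth_nx [OF l])
        have "prio (chain u ! k) \<le> prio v" by (rule pops_Some(4) [OF sc k])
        then have "exp_val w ?e s' \<noteq> 0" using ev [of k] l s' by simp
        moreover have "reaches w ?p s' 9 (?I (Suc k))"
          by (rule reaches_straight) (use s' r x [of k] l nx in \<open>simp_all add: scratch_ok_def\<close>)
        ultimately show "exp_val w ?e s' \<noteq> 0 \<and> reaches w ?p s' 9 (?I (Suc k))" ..
      next
        fix s'
        assume "?I (pops v) s'"
        then show "exp_val w ?e s' = 0" using ev [OF pops_Some(1) [OF sc]] pops_Some(5) [OF sc] by simp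
      qed
      then show "reaches w (While ?e ?p) s2 (50 + 60 * pops v) (climbed v)"
      proof (rule reaches_mono)
        show "(\<Sum>k<pops v. 9) + Suc (pops v) * (1 + exp_time ?e) \<le> 50 + 60 * pops v"
          by (simp add: e_level_eq_def)
      next
        fix s'
        assume s': "?I (pops v) s'"
        then show "climbed v s'" using m pops_Some(2) [OF sc]
          by (auto simp: climbed_def measured_def at_var_def holds_rules_def scratch_ok_def)
      qed
    qed simp
  qed simp
qed

definition pathed :: "nat \<Rightarrow> nat \<Rightarrow> state \<Rightarrow> bool" where
  "pathed v k s \<longleftrightarrow> at_var v k s \<and> scratch_ok v s \<and> reg s 17 = nx v \<and> reg s 18 = jp v"

lemma depth_less_word: "v \<in> V \<Longrightarrow> depth v + 1 < 2 ^ w"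
proof -
  assume v: "v \<in> V"
  have "2 ^ floor_log cells \<le> cells" using cells_pos by (rule floor_log_exp2_le)
  moreover have "floor_log cells < 2 ^ floor_log cells" by (rule less_exp)
  ultimately show ?thesis using depth_le [OF v] word_cells cells_pos by linarith
qed

lemma store_path:
  assumes c: "climbed v s" and sc: "sc v = Some u"
  shows "reaches w store_path s 300 (pathed v 4)"
proof (rule reaches_straight)
  note v = scD(1) [OF sc] and u = scD(2) [OF sc]
  have a: "at_var v 4 s" and r: "reg s 10 = nr v" "reg s 11 = nc v" "reg s 12 = u" "reg s 6 = v" "reg s 2 = 3 * N"
    "reg s 14 = offr v u" "reg s 15 = offc v u" "reg s 16 = key v" "reg s 17 = nx v"
    using c sc by (auto simp: climbed_def measured_def at_var_def holds_rules_def)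
  define n where "n = nx v"
  define j where "j = jp n"
  define jj where "jj = jp j"
  have V: "n \<in> V" "j \<in> V" "jj \<in> V" using nx_V [OF v] jp_V by (auto simp: n_def j_def jj_def)
  have pos: "pos v < pos n" "pos v < pos j" "pos v < pos jj" "pos v < pos u"
    using nx_sc_pos [OF sc] jp_sc_pos [OF sc] pos_kid [OF v scD(3) [OF sc]] by (auto simp: n_def j_def jj_def)
  have N: "n < N" "j < N" "jj < N" "u < N" "v < N" using V_less V u v by auto
  have ok: "scratch_ok n s" "scratch_ok j s" "scratch_ok jj s" "scratch_ok u s"
    using a V u pos by (auto simp: at_var_def)
  then have m: "mem s (fld N n 9) = j" "mem s (fld N n 8) = depth n" "mem s (fld N j 8) = depth j"
      "mem s (fld N j 9) = jj" "mem s (fld N jj 8) = depth jj" "mem s (fld N u 10) = endr u" "mem s (fld N u 11) = endc u"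
    by (simp_all add: scratch_ok_def j_def jj_def)
  have ne: "n \<noteq> v" "u \<noteq> v" using pos by auto
  have "depth j \<le> depth n" "depth jj \<le> depth j" by (simp_all add: j_def jj_def depth_jp jump_depth_le)
  then have sub: "binop_val w Sub (depth n) (depth j) = depth n - depth j"
      "binop_val w Sub (depth j) (depth jj) = depth j - depth jj"
    using depth_less_word [OF V(1)] depth_less_word [OF V(2)] by (auto intro!: binop_val_exact(2))
  have "depth n + 1 < 2 ^ w" using depth_less_word [OF V(1)] .
  then have ad: "binop_val w Add (depth n) 1 = depth v"
    using pops_Some(3) [OF sc] by (simp add: binop_val_exact n_def)
  have "endr v \<le> cells" "endc v \<le> cells"
    using end_le [of v] nr_le_cells [OF v] nc_le_cells [OF v] by linarith+
  then have "offr v u + endr u < 2 ^ w" "offc v u + endc u < 2 ^ w"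
    using endr_Some [OF sc] endc_Some [OF sc] word_cells cells_pos by linarith+
  then have ends: "binop_val w Add (offr v u) (endr u) = endr v" "binop_val w Add (offc v u) (endc u) = endc v"
    using endr_Some [OF sc] endc_Some [OF sc] by (simp_all add: binop_val_exact)
  have jv: "jp v = (if depth n - depth j = depth j - depth jj then jj else n)"
    using jp_Some [OF sc] by (simp add: n_def j_def jj_def)
  have run: "run w store_path s = s\<lparr>reg := (reg s)(18 := jp v), mem := (mem s)(fld N v 4 := nr v, fld N v 5 := nc v,
      fld N v 6 := key v, fld N v 7 := n, fld N v 8 := depth v, fld N v 9 := jp v,
      fld N v 10 := endr v, fld N v 11 := endc v)\<rparr>"
    using r N m ne sub ad ends unfolding n_def [symmetric]
    by (cases "depth n - depth j = depth j - depth jj") (simp_all add: store_path_def jv)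
  have sv: "scratch_ok v (run w store_path s)" unfolding run scratch_ok_def by (simp add: n_def)
  have "at_var v 4 (run w store_path s)"
    unfolding run using a N V_less length_Q_le_N pos_less_N [OF v]
    by (auto simp: at_var_def holds_rules_def scratch_ok_def)
  then show "pathed v 4 (run w store_path s)" using sv r by (simp add: pathed_def run)
qed (simp_all add: store_path_def)

lemma store_link:
  assumes p: "pathed v k s" and v: "v \<in> V" and x: "reg s r = x" "x \<in> set (spath v)" "pos v < pos x"
    and k: "k + 5 \<le> 14" and wd: "\<And>i. i < 5 \<Longrightarrow> word v (k + i) = [16 * pos x, endr v - endr x, endc v - endc x, nr x, nc x] ! i"
  shows "reaches w (store_link r k) s 200 (pathed v (k + 5))"
proof (rule reaches_straight)
  have a: "at_var v k s" "scratch_ok v s" and r: "reg s 6 = v" "reg s 2 = 3 * N" "reg s 3 = 19 * N" "reg s 4 = pos v"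
    using p by (auto simp: pathed_def at_var_def holds_rules_def)
  have xV: "x \<in> V" by (rule spath_same(1) [OF x(2) v])
  have N: "v < N" "x < N" "pos v < N" using V_less v xV pos_less_N by auto
  have m: "mem s (fld N v 10) = endr v" "mem s (fld N v 11) = endc v" "mem s (fld N x 10) = endr x"
      "mem s (fld N x 11) = endc x" "mem s (fld N x 4) = nr x" "mem s (fld N x 5) = nc x" "mem s (fld N x 2) = pos x"
    using a xV x(3) by (auto simp: at_var_def scratch_ok_def)
  have "endr v < 2 ^ w" "endc v < 2 ^ w"
    using end_le [of v] nr_le_cells [OF v] nc_le_cells [OF v] word_cells cells_pos by linarith+
  then have sub: "binop_val w Sub (endr v) (endr x) = endr v - endr x" "binop_val w Sub (endc v) (endc x) = endc v - endc x"
    using end_spath [OF x(2)] by (simp_all add: binop_val_exact)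
  have run: "run w (store_link r k) s = s\<lparr>mem := (mem s)(out N (pos v) k := 16 * pos x,
      out N (pos v) (k + 1) := endr v - endr x, out N (pos v) (k + 2) := endc v - endc x,
      out N (pos v) (k + 3) := nr x, out N (pos v) (k + 4) := nc x)\<rparr>"
    using r N m sub pos16 [OF xV] x(1) k by (simp add: store_link_def)
  have lt: "f < k + 5 \<longleftrightarrow> f < k \<or> f = k \<or> f = k + 1 \<or> f = k + 2 \<or> f = k + 3 \<or> f = k + 4" for f by auto
  have "at_var v (k + 5) (run w (store_link r k) s)"
    unfolding run at_var_def lt using a(1) N V_less length_Q_le_N wd [of 0] wd [of 1] wd [of 2] wd [of 3] wd [of 4] k
    by (auto simp: at_var_def holds_rules_def scratch_ok_def)
  moreover have "scratch_ok v (run w (store_link r k) s)"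
    unfolding run using a(2) N by (simp add: scratch_ok_def)
  ultimately show "pathed v (k + 5) (run w (store_link r k) s)" using p by (simp add: pathed_def run)
qed (simp_all add: store_link_def)

lemma build_body:
  assumes b: "built (Suc (pos v)) s" and v: "v \<in> V"
  shows "reaches w build_body s (1500 + 60 * pops v) (built (pos v))"
  unfolding build_body_def seqs.simps
proof (rule reaches_seq [OF fetch [OF b v], where T' = "1400 + 60 * pops v"])
  fix s
  assume "fetched v s"
  then have "reaches w measure_rule s 450 (measured v)" using v by (rule measure_rule)
  then show "reaches w (Seq measure_rule (Cond (Reg 13) (Seq climb (Seq store_path (Seq (store_link 18 4)
      (store_link 17 9)))) path_end)) s (1400 + 60 * pops v) (built (pos v))"
  proof (rule reaches_seq [where T' = "900 + 60 * pops v"])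
    fix s
    assume m: "measured v s"
    show "reaches w (Cond (Reg 13) (Seq climb (Seq store_path (Seq (store_link 18 4) (store_link 17 9)))) path_end)
       s (900 + 60 * pops v) (built (pos v))"
    proof (rule reaches_cond [where T = "850 + 60 * pops v"])
      assume "exp_val w (Reg 13) s \<noteq> 0"
      then obtain u where sc: "sc v = Some u" using m by (auto simp: measured_def)
      note j = jp_sc_pos [OF sc] and n = nx_sc_pos [OF sc]
      have wj: "word v (4 + i) = [16 * pos (jp v), endr v - endr (jp v), endc v - endc (jp v), nr (jp v), nc (jp v)] ! i"
        and wn: "word v (9 + i) = [16 * pos (nx v), endr v - endr (nx v), endc v - endc (nx v), nr (nx v), nc (nx v)] ! i"
        if "i < 5" for i
        using that sc by (simp_all add: word_def link_def)
      show "reaches w (Seq climb (Seq store_path (Seq (store_link 18 4) (store_link 17 9)))) s (850 + 60 * pops v) (built (pos v))"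
      proof (rule reaches_seq [OF climb [OF m sc], where T' = 720])
        fix s
        assume "climbed v s"
        from store_path [OF this sc]
        show "reaches w (Seq store_path (Seq (store_link 18 4) (store_link 17 9))) s 720 (built (pos v))"
        proof (rule reaches_seq [where T' = 410])
          fix s
          assume p: "pathed v 4 s"
          have "reaches w (store_link 18 4) s 200 (pathed v (4 + 5))"
            by (rule store_link [OF p v _ jp_in_spath j(4) _ wj]) (use p in \<open>auto simp: pathed_def\<close>)
          then show "reaches w (Seq (store_link 18 4) (store_link 17 9)) s 410 (built (pos v))"
          proof (rule reaches_seq [where T' = 200])
            fix s
            assume p: "pathed v (4 + 5) s"
            have "reaches w (store_link 17 9) s 200 (pathed v (9 + 5))"
              by (rule store_link [OF _ v _ nx_in_spath _ _ wn]) (use p n in \<open>auto simp: pathed_def\<close>)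
            then show "reaches w (store_link 17 9) s 200 (built (pos v))"
              by (rule reaches_mono) (use built_at_var v in \<open>auto simp: pathed_def\<close>)
          qed simp
        qed simp
      qed simp
    next
      assume "exp_val w (Reg 13) s = 0"
      then have "sc v = None" using m by (auto simp: measured_def)
      from path_end [OF m v this] show "reaches w path_end s (850 + 60 * pops v) (built (pos v))"
        by (rule reaches_mono) auto
    qed simp
  qed simp
qed simp

lemma built_kahn_post: "kahn_post Q rho s \<Longrightarrow> built (length Q) s"
proof -
  assume k: "kahn_post Q rho s"
  have "mem s (fld N c 2) = pos c" if "c \<in> V" for c
    using k pos [OF that] by (auto simp: kahn_post_def)
  moreover have "\<not> length Q \<le> pos c" if "c \<in> V" for c using pos(1) [OF that] by simp
  ultimately show ?thesis using k length_Q_le_N by (auto simp: kahn_post_def built_def)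
qed

definition build_post :: "state \<Rightarrow> bool" where
  "build_post s \<longleftrightarrow> reg s 0 = out N 0 0 \<and> reg s 1 = 16 * length Q \<and>
     (\<forall>i<length Q. \<forall>f<16. mem s (out N i f) = word (Q ! i) f)"

lemma sum_pops_Q: "(\<Sum>i<length Q. pops (Q ! (length Q - Suc i))) \<le> length Q"
proof -
  have bij: "bij_betw ((!) Q) {..<length Q} V"
    unfolding set_Q [symmetric] by (rule bij_betw_nth [OF distinct_Q]) (rule refl)+
  have "(\<Sum>i<length Q. pops (Q ! (length Q - Suc i))) = (\<Sum>i<length Q. pops (Q ! i))"
    by (rule sum.nat_diff_reindex [of "\<lambda>i. pops (Q ! i)"])
  also have "\<dots> = (\<Sum>v\<in>V. pops v)" by (rule sum.reindex_bij_betw [OF bij])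
  finally show ?thesis using sum_pops length_Q_card by simp
qed

lemma build:
  assumes "kahn_post Q rho s"
  shows "reaches w build s (1600 * N) build_post"
proof -
  let ?n = "length Q"
  let ?T = "\<lambda>k. 1500 + 60 * pops (Q ! (?n - Suc k))"
  let ?I = "\<lambda>k. built (?n - k)"
  have "reaches w (While (Reg 4) build_body) s ((\<Sum>k<?n. ?T k) + Suc ?n * (1 + exp_time (Reg 4))) (?I ?n)"
  proof (rule reaches_while [where I = ?I and T = ?T])
    fix k s
    assume k: "k < ?n" and I: "?I k s"
    let ?v = "Q ! (?n - Suc k)"
    have v: "?v \<in> V" using nth_mem [of "?n - Suc k" Q] k unfolding set_Q by simp
    have p: "pos ?v = ?n - Suc k" by (rule pos_nth) (use k in simp)
    have e: "?n - k = Suc (pos ?v)" unfolding p using k by linarith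
    have "reaches w build_body s (?T k) (built (pos ?v))"
      by (rule build_body [OF _ v]) (use I e in simp)
    moreover have "exp_val w (Reg 4) s \<noteq> 0" using I e by (simp add: built_def)
    ultimately show "exp_val w (Reg 4) s \<noteq> 0 \<and> reaches w build_body s (?T k) (?I (Suc k))" using p by simp
  next
    fix s
    assume "?I ?n s"
    then show "exp_val w (Reg 4) s = 0" by (simp add: built_def)
  next
    show "?I 0 s" using built_kahn_post [OF assms] by simp
  qed
  then have "reaches w (While (Reg 4) build_body) s (1562 * ?n + 2) (built 0)"
  proof (rule reaches_mono)
    have "(\<Sum>k<?n. ?T k) = 1500 * ?n + 60 * (\<Sum>k<?n. pops (Q ! (?n - Suc k)))"
      by (simp add: sum.distrib sum_distrib_left)
    then show "(\<Sum>k<?n. ?T k) + Suc ?n * (1 + exp_time (Reg 4)) \<le> 1562 * ?n + 2" using sum_pops_Q by simp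
  qed simp
  then show ?thesis unfolding build_def seqs.simps
  proof (rule reaches_seq [where T' = 20])
    fix s
    assume b: "built 0 s"
    have "16 * ?n < 2 ^ w" using length_Q_le_N word_rules N_pos by linarith
    then have "binop_val w Mul 16 ?n = 16 * ?n" by (simp add: binop_val_exact)
    then show "reaches w (Seq (Assign 0 (Reg 3)) (Assign 1 (Bin Mul (Const 16) (Reg 5)))) s 20 build_post"
      using b by (intro reaches_straight) (auto simp: build_post_def built_def holds_rules_def out_def)
  next
    show "1562 * ?n + 2 + 20 \<le> 1600 * N" using length_Q_le_N N_pos by linarith
  qed
qed

end

section \<open>Answering queries\<close>

definition e_word :: "nat \<Rightarrow> exp" where
  "e_word k = Load (Bin Add (Reg 2) (Const k))"

definition e_inside :: "nat \<Rightarrow> exp" where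
  "e_inside k = Bin And (Bin Less (Bin Sub (Reg 0) (e_word (k + 1))) (e_word (k + 3)))
     (Bin Less (Bin Sub (Reg 1) (e_word (k + 2))) (e_word (k + 4)))"

definition follow :: "nat \<Rightarrow> com" where
  "follow k = seqs [Assign 0 (Bin Sub (Reg 0) (e_word (k + 1))), Assign 1 (Bin Sub (Reg 1) (e_word (k + 2))),
     Assign 2 (e_word k)]"

definition descend :: com where
  "descend = Cond (Bin Eq (e_word 0) (Const 1))
     (Cond (Bin Less (Reg 1) (e_word 3)) (Assign 2 (e_word 1))
        (seqs [Assign 1 (Bin Sub (Reg 1) (e_word 3)), Assign 2 (e_word 2)]))
     (Cond (Bin Eq (e_word 0) (Const 2))
        (Cond (Bin Less (Reg 0) (e_word 3)) (Assign 2 (e_word 1))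
           (seqs [Assign 0 (Bin Sub (Reg 0) (e_word 3)), Assign 2 (e_word 2)]))
        (Cond (Bin Eq (e_word 0) (Const 3))
           (seqs [Assign 1 (Bin Mod (Reg 1) (e_word 3)), Assign 2 (e_word 2)])
           (seqs [Assign 0 (Bin Mod (Reg 0) (e_word 3)), Assign 2 (e_word 2)])))"

definition query_body :: com where
  "query_body = Cond (e_inside 4) (follow 4) (Cond (e_inside 9) (follow 9) descend)"

definition query :: com where
  "query = seqs [Assign 2 (Const 0), While (e_word 0) query_body, Assign 0 (e_word 1)]"

lemma query_times [simp]:
  "exp_time (e_word k) = 4" "exp_time (e_inside k) = 23"
  "straight (follow k)" "cost (follow k) \<le> 20" "straight descend" "cost descend \<le> 60"
  by (simp_all add: e_word_def e_inside_def follow_def descend_def)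

text \<open>A wrapped-around difference exceeds every dimension, so one comparison tests both bounds.\<close>

lemma sub_less_iff:
  assumes "x \<le> B" "d \<le> B" "r \<le> B" "2 * B < 2 ^ w"
  shows "binop_val w Sub x d < r \<longleftrightarrow> d \<le> x \<and> x < d + r"
proof (cases "d \<le> x")
  case True
  then have "binop_val w Sub x d = x - d" using assms by (intro binop_val_exact) auto
  then show ?thesis using True by auto
next
  case False
  then have "2 ^ w + x - d < 2 ^ w" using assms by linarith
  then have "binop_val w Sub x d = 2 ^ w + x - d" by (simp add: binop_val.simps)
  moreover have "\<not> 2 ^ w + x - d < r" using assms by linarith
  ultimately show ?thesis using False by simp
qed

context slp2d_builder
begin

definition holds_structure :: "state \<Rightarrow> bool" where
  "holds_structure s \<longleftrightarrow> (\<forall>i<length Q. \<forall>f<16. mem s (16 * i + f) = word (Q ! i) f)"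

definition query_at :: "nat \<Rightarrow> nat \<Rightarrow> nat \<Rightarrow> state \<Rightarrow> bool" where
  "query_at v i j s \<longleftrightarrow> holds_structure s \<and> v \<in> V \<and> i < nr v \<and> j < nc v \<and>
     reg s 0 = i \<and> reg s 1 = j \<and> reg s 2 = 16 * pos v"

lemma word_val:
  assumes "holds_structure s" "v \<in> V" "reg s 2 = 16 * pos v" "k < 16"
  shows "exp_val w (e_word k) s = word v k"
proof -
  have "16 * pos v + k < 2 ^ w" using pos_less_N [OF assms(2)] assms(4) word_rules by linarith
  then have "exp_val w (e_word k) s = mem s (16 * pos v + k)"
    using assms(3,4) by (simp add: e_word_def binop_val_exact)
  then show ?thesis using assms pos [OF assms(2)] by (simp add: holds_structure_def)
qed

lemma inside_val:
  assumes q: "query_at v i j s" and k: "k = 4 \<and> x = jp v \<or> k = 9 \<and> x = nx v"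
  shows "exp_val w (e_inside k) s = of_bool (depth v \<noteq> 0 \<and> inside (here v i j) x)"
proof -
  have v: "v \<in> V" and ij: "i < nr v" "j < nc v" "reg s 0 = i" "reg s 1 = j"
    and s: "holds_structure s" "reg s 2 = 16 * pos v"
    using q by (auto simp: query_at_def)
  have wd: "exp_val w (e_word (k + a)) s = link v x a" if "a < 5" for a
    using word_val [OF s(1) v s(2), of "k + a"] k that by (auto simp: word_def)
  have xs: "x \<in> set (spath v)" using k jp_in_spath nx_in_spath by auto
  have xV: "x \<in> V" by (rule spath_same(1) [OF xs v])
  have ev: "exp_val w (e_inside k) s = of_bool (binop_val w Sub i (link v x 1) < link v x 3 \<and>
      binop_val w Sub j (link v x 2) < link v x 4)"
    using wd [of 1] wd [of 2] wd [of 3] wd [of 4] ij by (simp add: e_inside_def and_of_bool)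
  show ?thesis
  proof (cases "sc v")
    case None
    \<comment> \<open>Without a symmetric edge the stored box has no rows, and no difference is
      below 0.\<close>
    then show ?thesis unfolding ev by (simp add: link_def depth_None numeral_3_eq_3)
  next
    case (Some u)
    have lk: "link v x 1 = endr v - endr x" "link v x 2 = endc v - endc x" "link v x 3 = nr x" "link v x 4 = nc x"
      using Some by (simp_all add: link_def)
    have b: "i \<le> cells" "j \<le> cells" "endr v - endr x \<le> cells" "endc v - endc x \<le> cells" "nr x \<le> cells" "nc x \<le> cells"
      "2 * cells < 2 ^ w"
      using ij nr_le_cells [OF v] nc_le_cells [OF v] nr_le_cells [OF xV] nc_le_cells [OF xV] end_le [of v]
        word_cells cells_pos by linarith+
    have "depth v \<noteq> 0" using pops_Some(3) [OF Some] by simp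
    then show ?thesis unfolding ev lk inside_here_iff [OF xs]
      using sub_less_iff [OF b(1,3,5,7)] sub_less_iff [OF b(2,4,6,7)] by auto
  qed
qed

lemma follow:
  assumes q: "query_at v i j s" and k: "k = 4 \<and> x = jp v \<or> k = 9 \<and> x = nx v"
    and d: "depth v \<noteq> 0" and ins: "inside (here v i j) x" and st: "path_step x v i j = (v', i', j')"
  shows "reaches w (follow k) s 20 (query_at v' i' j')"
proof (rule reaches_straight)
  have v: "v \<in> V" and ij: "i < nr v" "j < nc v" "reg s 0 = i" "reg s 1 = j"
    and s: "holds_structure s" "reg s 2 = 16 * pos v"
    using q by (auto simp: query_at_def)
  obtain u where sc: "sc v = Some u" using d depth_None by (cases "sc v") auto
  have xs: "x \<in> set (spath v)" using k jp_in_spath nx_in_spath by auto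
  have xV: "x \<in> V" by (rule spath_same(1) [OF xs v])
  note io = ins [unfolded inside_here_iff [OF xs]]
  have v': "v' = x" "i' = i - (endr v - endr x)" "j' = j - (endc v - endc x)"
    using st by (auto simp: path_step_def)
  have wd: "exp_val w (e_word (k + a)) t = [16 * pos x, endr v - endr x, endc v - endc x, nr x, nc x] ! a"
    if "a < 5" "mem t = mem s" "reg t 2 = 16 * pos v" for a t
  proof -
    have "holds_structure t" using s that(2) by (simp add: holds_structure_def)
    then show ?thesis
      using word_val [of t v "k + a"] that v k sc by (auto simp: word_def link_def)
  qed
  have lt: "i < 2 ^ w" "j < 2 ^ w"
    using ij nr_le_cells [OF v] nc_le_cells [OF v] word_cells cells_pos by linarith+
  then have sub: "binop_val w Sub i (endr v - endr x) = i'" "binop_val w Sub j (endc v - endc x) = j'"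
    using io v' by (simp_all add: binop_val_exact)
  have i': "i' < nr x" "j' < nc x" unfolding v' using io by linarith+
  have run: "run w (follow k) s = s\<lparr>reg := (reg s)(0 := i', 1 := j', 2 := 16 * pos x)\<rparr>"
    using wd [of 1] wd [of 2] wd [of 0] s ij sub by (simp add: follow_def)
  show "query_at v' i' j' (run w (follow k) s)"
    unfolding run query_at_def using s xV i' v'(1) by (auto simp: holds_structure_def)
qed simp_all

lemma descend:
  assumes q: "query_at v i j s" and r: "\<nexists>a. rl v = Sym a" and st: "kid_step v i j = (v', i', j')"
  shows "reaches w descend s 60 (query_at v' i' j')"
proof (rule reaches_straight)
  have v: "v \<in> V" and ij: "i < nr v" "j < nc v" "reg s 0 = i" "reg s 1 = j"
    and s: "holds_structure s" "reg s 2 = 16 * pos v"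
    using q by (auto simp: query_at_def)
  have wd: "exp_val w (e_word f) t = rule_word v f" if "f < 4" "mem t = mem s" "reg t 2 = 16 * pos v" for f t
  proof -
    have "holds_structure t" using s that(2) by (simp add: holds_structure_def)
    then show ?thesis using word_val [of t v f] that v by (auto simp: word_def)
  qed
  have lt: "i < 2 ^ w" "j < 2 ^ w"
    using ij nr_le_cells [OF v] nc_le_cells [OF v] word_cells cells_pos by linarith+
  note k = kid_step [OF v ij(1,2) st r]
  have v': "v' \<in> V" by (rule V.kid [OF v k(1)])
  have "run w descend s = s\<lparr>reg := (reg s)(0 := i', 1 := j', 2 := 16 * pos v')\<rparr>"
  proof (cases "rl v")
    case (HCat B C)
    then show ?thesis using st s ij lt wd
      by (auto simp: descend_def kid_step_def rule_word_def binop_val_exact fun_eq_iff split: if_splits)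
  next
    case (VCat B C)
    then show ?thesis using st s ij lt wd
      by (auto simp: descend_def kid_step_def rule_word_def binop_val_exact fun_eq_iff split: if_splits)
  next
    case (HRun k B)
    then show ?thesis using st s ij lt wd
      by (auto simp: descend_def kid_step_def rule_word_def numeral_3_eq_3 fun_eq_iff)
  next
    case (VRun k B)
    then show ?thesis using st s ij lt wd
      by (auto simp: descend_def kid_step_def rule_word_def numeral_3_eq_3 fun_eq_iff)
  qed (use r in auto)
  then show "query_at v' i' j' (run w descend s)"
    unfolding query_at_def using s v' k(2,3) by (auto simp: holds_structure_def)
qed simp_all

lemma query_body:
  assumes q: "query_at v i j s" and r: "\<nexists>a. rl v = Sym a" and st: "query_step v i j = (v', i', j')"
  shows "reaches w query_body s 120 (query_at v' i' j')"
  unfolding query_body_def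
proof (rule reaches_cond [where T = 90])
  assume "exp_val w (e_inside 4) s \<noteq> 0"
  then have d: "depth v \<noteq> 0" "inside (here v i j) (jp v)" using inside_val [OF q, of 4 "jp v"] by (auto split: if_splits)
  then have "path_step (jp v) v i j = (v', i', j')" using st by (simp add: query_step_def)
  from follow [OF q _ d this, of 4] show "reaches w (follow 4) s 90 (query_at v' i' j')"
    by (auto elim: reaches_mono)
next
  assume "exp_val w (e_inside 4) s = 0"
  then have n4: "\<not> (depth v \<noteq> 0 \<and> inside (here v i j) (jp v))" using inside_val [OF q, of 4 "jp v"] by (auto split: if_splits)
  show "reaches w (Cond (e_inside 9) (follow 9) descend) s 90 (query_at v' i' j')"
  proof (rule reaches_cond [where T = 60])
    assume "exp_val w (e_inside 9) s \<noteq> 0"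
    then have d: "depth v \<noteq> 0" "inside (here v i j) (nx v)" using inside_val [OF q, of 9 "nx v"] by (auto split: if_splits)
    then have "path_step (nx v) v i j = (v', i', j')" using st n4 by (simp add: query_step_def)
    from follow [OF q _ d this, of 9] show "reaches w (follow 9) s 60 (query_at v' i' j')"
      by (auto elim: reaches_mono)
  next
    assume "exp_val w (e_inside 9) s = 0"
    then have n9: "\<not> (depth v \<noteq> 0 \<and> inside (here v i j) (nx v))" using inside_val [OF q, of 9 "nx v"] by (auto split: if_splits)
    then have "kid_step v i j = (v', i', j')" using st n4 by (auto simp: query_step_def)
    with q r show "reaches w descend s 60 (query_at v' i' j')" by (rule descend)
  qed simp
qed simp

definition query_bound :: nat where
  "query_bound = (2 * floor_log cells + floor_log (2 * cells) + 1) * run_bound"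

lemma pos_start: "pos (start G) = 0"
proof -
  have "0 < length Q" using pos(1) [OF V.start] by linarith
  from pos_nth [OF this] show ?thesis by (simp add: Q_start)
qed

lemma rule_word_tag: "rule_word v 0 = tag (rl v)"
  by (cases "rl v") (simp_all add: rule_word_def)

lemma query:
  assumes s: "holds_structure s" "reg s 0 = i" "reg s 1 = j" and ij: "i < dim_row M" "j < dim_col M"
  shows "reaches w query s (Suc query_bound * 125 + 10) (\<lambda>s'. reg s' 0 = M $$ (i, j) \<and> holds_structure s')"
proof -
  let ?I = "\<lambda>s'. \<exists>v i' j'. query_at v i' j' s' \<and> expn v $$ (i', j') = M $$ (i, j)"
  \<comment> \<open>The current variable is recovered from its record address in register 2, which
    makes the measure a function of the state alone.\<close>
  let ?f = "\<lambda>s'. query_measure (Q ! (reg s' 2 div 16)) (reg s' 0) (reg s' 1)"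
  have f: "?f s' = query_measure v i' j'" if "query_at v i' j' s'" for v i' j' s'
    using that pos(2) by (simp add: query_at_def)
  have tag: "exp_val w (e_word 0) s' = tag (rl v)" if "query_at v i' j' s'" for v i' j' s'
    using word_val [of s' v 0] that by (simp add: query_at_def word_def rule_word_tag)
  have start: "query_at (start G) i j (s\<lparr>reg := (reg s)(2 := 0)\<rparr>)"
    using s ij V.start by (simp add: query_at_def holds_structure_def pos_start nr_def nc_def expn_start)
  show ?thesis unfolding query_def seqs.simps
  proof (rule reaches_seq [where T = 2 and T' = "Suc query_bound * 125 + 8"])
    show "reaches w (Assign 2 (Const 0)) s 2 (\<lambda>s'. s' = s\<lparr>reg := (reg s)(2 := 0)\<rparr>)"
      by (rule reaches_straight) simp_all
  next
    fix s1
    assume "s1 = s\<lparr>reg := (reg s)(2 := 0)\<rparr>"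
    then have q: "query_at (start G) i j s1" using start by simp
    show "reaches w (Seq (While (e_word 0) query_body) (Assign 0 (e_word 1))) s1 (Suc query_bound * 125 + 8)
        (\<lambda>s'. reg s' 0 = M $$ (i, j) \<and> holds_structure s')"
    proof (rule reaches_seq [where T = "Suc query_bound * (1 + exp_time (e_word 0) + 120)" and T' = 8
          and R = "\<lambda>s'. ?I s' \<and> exp_val w (e_word 0) s' = 0"])
      show "reaches w (While (e_word 0) query_body) s1 (Suc query_bound * (1 + exp_time (e_word 0) + 120))
          (\<lambda>s'. ?I s' \<and> exp_val w (e_word 0) s' = 0)"
      proof (rule reaches_while_measure [where I = ?I and f = ?f])
        fix s'
        assume "?I s'" and ne: "exp_val w (e_word 0) s' \<noteq> 0"
        then obtain v i' j' where q: "query_at v i' j' s'" and e: "expn v $$ (i', j') = M $$ (i, j)" by blast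
        have r: "\<nexists>a. rl v = Sym a" using ne tag [OF q] by auto
        obtain u i2 j2 where st: "query_step v i' j' = (u, i2, j2)" by (cases "query_step v i' j'")
        have v: "v \<in> V" "i' < nr v" "j' < nc v" using q by (auto simp: query_at_def)
        note c = query_step_correct [OF v r st]
        show "reaches w query_body s' 120 (\<lambda>s''. ?I s'' \<and> ?f s'' < ?f s')"
        proof (rule reaches_mono [OF query_body [OF q r st] order_refl])
          fix s''
          assume q': "query_at u i2 j2 s''"
          show "?I s'' \<and> ?f s'' < ?f s'" unfolding f [OF q] f [OF q'] using c q' e by metis
        qed
      next
        show "?I s1" using q expn_start by blast
      next
        have "query_measure (start G) i j \<le> query_bound"
          unfolding query_bound_def using q by (intro query_measure_le) (auto simp: query_at_def)
        then show "?f s1 \<le> query_bound" unfolding f [OF q] .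
      qed
    next
      fix s'
      assume "?I s' \<and> exp_val w (e_word 0) s' = 0"
      then obtain v i' j' where q: "query_at v i' j' s'" and e: "expn v $$ (i', j') = M $$ (i, j)"
        and z: "exp_val w (e_word 0) s' = 0" by blast
      have v: "v \<in> V" "i' < nr v" "j' < nc v" using q by (auto simp: query_at_def)
      obtain a where a: "rl v = Sym a" using z tag [OF q] by (cases "rl v") auto
      have "expn v $$ (i', j') = a" using Sym_expn(1-3) [OF v(1) a] v(2,3) by simp
      moreover have "exp_val w (e_word 1) s' = a"
        using word_val [of s' v 1] q a by (simp add: query_at_def word_def rule_word_def)
      moreover have "holds_structure s'" using q by (simp add: query_at_def)
      ultimately show "reaches w (Assign 0 (e_word 1)) s' 8 (\<lambda>s'. reg s' 0 = M $$ (i, j) \<and> holds_structure s')"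
        using e by (intro reaches_straight) (simp_all add: holds_structure_def)
    qed simp
  qed simp
qed

section \<open>Correctness and space of the data structure\<close>

lemma structure_nth:
  assumes "build_post s"
  shows "length (built_structure s) = 16 * length Q"
    "i < length Q \<Longrightarrow> f < 16 \<Longrightarrow> built_structure s ! (16 * i + f) = word (Q ! i) f"
proof -
  have r: "reg s 0 = out N 0 0" "reg s 1 = 16 * length Q" using assms by (auto simp: build_post_def)
  show l: "length (built_structure s) = 16 * length Q" using r by (simp add: built_structure_def)
  assume if': "i < length Q" "f < 16"
  then have "16 * i + f < 16 * length Q" by linarith
  then have "built_structure s ! (16 * i + f) = mem s (out N i f)"
    using r by (simp add: built_structure_def out_def add.assoc)
  then show "built_structure s ! (16 * i + f) = word (Q ! i) f" using assms if' by (simp add: build_post_def)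
qed

lemma answers_query:
  assumes b: "build_post s" and T: "real (Suc query_bound * 125 + 10) \<le> T"
  shows "answers_access w query (built_structure s) M T"
  unfolding answers_access_def
proof (intro allI impI)
  let ?D = "built_structure s"
  note D = structure_nth [OF b]
  have holds: "holds_structure s' \<longleftrightarrow> (\<forall>a < length ?D. mem s' a = ?D ! a)" for s'
  proof
    assume h: "holds_structure s'"
    show "\<forall>a < length ?D. mem s' a = ?D ! a"
    proof (intro allI impI)
      fix a
      assume "a < length ?D"
      then have "a div 16 < length Q" using D(1) by (simp add: less_mult_imp_div_less mult.commute)
      moreover have "a = 16 * (a div 16) + a mod 16" by simp
      moreover have "a mod 16 < 16" by simp
      ultimately show "mem s' a = ?D ! a" using h D(2) unfolding holds_structure_def by metis
    qed
  next
    assume h: "\<forall>a < length ?D. mem s' a = ?D ! a"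
    show "holds_structure s'" unfolding holds_structure_def
    proof (intro allI impI)
      fix i f
      assume "i < length Q" "f < (16::nat)"
      moreover from this have "16 * i + f < length ?D" unfolding D(1) by linarith
      ultimately show "mem s' (16 * i + f) = word (Q ! i) f" using h D(2) by simp
    qed
  qed
  fix i j s'
  assume "i < dim_row M" "j < dim_col M" and
    "word_state w s' \<and> (\<forall>a < length ?D. mem s' a = ?D ! a) \<and> reg s' 0 = i \<and> reg s' 1 = j"
  then have "reaches w query s' (Suc query_bound * 125 + 10) (\<lambda>s'. reg s' 0 = M $$ (i, j) \<and> holds_structure s')"
    using holds by (intro query) auto
  then obtain t s'' where "exec w query s' t s''" "t \<le> Suc query_bound * 125 + 10"
      "reg s'' 0 = M $$ (i, j)" "holds_structure s''"
    by (auto simp: reaches_def)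
  moreover from this(2) have "real t \<le> T" using T by linarith
  ultimately show "\<exists>t s''. exec w query s' t s'' \<and> real t \<le> T \<and> reg s'' 0 = M $$ (i, j) \<and>
      (\<forall>a < length ?D. mem s'' a = ?D ! a)"
    using holds by blast
qed

text \<open>Addresses are below \<open>16 * length Q\<close>, hence below \<open>32 * cells\<close>;
  offsets and dimensions are at most \<open>cells\<close>, so only symbols depend on the alphabet,
  through \<open>b\<close>. In the exponent, 6 consists of 5 for the factor 32 and 1 for the
  rounding in \<open>floor_log\<close>.\<close>

lemma word_less:
  assumes v: "v \<in> V" and f: "f < 16" and \<Sigma>: "\<forall>a\<in>\<Sigma>. a < 2 ^ b"
  shows "word v f < 2 ^ (floor_log cells + 6 + b)"
proof -
  let ?B = "32 * cells"
  have c: "1 \<le> cells" using cells_pos by simp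
  have p: "16 * pos u < ?B" if "u \<in> V" for u using pos(1) [OF that] length_Q by linarith
  have link: "link v x g < ?B" if "x \<in> V" "g < 5" for x g
  proof -
    have "endr v - endr x \<le> cells" "endc v - endc x \<le> cells" "nr x \<le> cells" "nc x \<le> cells"
      using end_le [of v] nr_le_cells [OF v] nc_le_cells [OF v] nr_le_cells [OF that(1)] nc_le_cells [OF that(1)]
      by linarith+
    moreover have "g = 0 \<or> g = 1 \<or> g = 2 \<or> g = 3 \<or> g = 4" using that(2) by linarith
    ultimately show ?thesis using p [OF that(1)] c by (auto simp: link_def)
  qed
  have kid: "u \<in> V \<and> 16 * pos u < ?B \<and> nr u < ?B \<and> nc u < ?B" if "u \<in> set (kids (rl v))" for u
    using V.kid [OF v that] p nr_le_cells [of u] nc_le_cells [of u] c by auto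
  have rule: "rule_word v f < ?B \<or> rule_word v f < 2 ^ b" if "f < 4"
  proof (cases "rl v")
    case (Sym a)
    then have "a < 2 ^ b" using Sym_expn(4) [OF v] \<Sigma> by blast
    then show ?thesis using Sym that c by (auto simp: rule_word_def less_4_cases)
  next
    case (HCat B C)
    then show ?thesis using that c kid [of B] kid [of C] by (auto simp: rule_word_def less_4_cases)
  next
    case (VCat B C)
    then show ?thesis using that c kid [of B] kid [of C] by (auto simp: rule_word_def less_4_cases)
  next
    case (HRun k B)
    then show ?thesis using that c kid [of B] by (auto simp: rule_word_def less_4_cases)
  next
    case (VRun k B)
    then show ?thesis using that c kid [of B] by (auto simp: rule_word_def less_4_cases)
  qed
  have "word v f < ?B \<or> word v f < 2 ^ b"
    using rule link [OF jp_V [OF v], of "f - 4"] link [OF nx_V [OF v], of "f - 9"] c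
    by (auto simp: word_def)
  moreover have "?B < 2 ^ (floor_log cells + 6 + b)"
  proof -
    have "32 * cells < 32 * (2 * 2 ^ floor_log cells)" using floor_log_exp2_gt [of cells] by simp
    also have "\<dots> = 2 ^ (floor_log cells + 6)" by (simp add: power_add)
    also have "\<dots> \<le> 2 ^ (floor_log cells + 6 + b)" by (intro power_increasing) auto
    finally show ?thesis .
  qed
  moreover have "(2::nat) ^ b \<le> 2 ^ (floor_log cells + 6 + b)" by (intro power_increasing) auto
  ultimately show ?thesis by linarith
qed

lemma space_structure:
  assumes b: "build_post s" and \<Sigma>: "\<forall>a\<in>\<Sigma>. a < 2 ^ b"
  shows "space_bits (built_structure s) \<le> 16 * N * (floor_log cells + 6 + b)"
proof -
  let ?D = "built_structure s"
  note D = structure_nth [OF assms(1)]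
  have "x < 2 ^ (floor_log cells + 6 + b)" if x: "x \<in> set ?D" for x
  proof -
    obtain a where a: "a < 16 * length Q" "x = ?D ! a" using x D(1) by (auto simp: in_set_conv_nth)
    then have "a div 16 < length Q" by (simp add: less_mult_imp_div_less mult.commute)
    moreover have "a = 16 * (a div 16) + a mod 16" "a mod 16 < 16" by simp_all
    ultimately have "x = word (Q ! (a div 16)) (a mod 16)" using D(2) a(2) by metis
    moreover have "Q ! (a div 16) \<in> V" using \<open>a div 16 < length Q\<close> set_Q nth_mem by blast
    ultimately show ?thesis using word_less \<Sigma> by simp
  qed
  then have "cell_width ?D \<le> floor_log cells + 6 + b"
    unfolding cell_width_def by (intro Least_le) auto
  then show ?thesis unfolding space_bits_def D(1) using length_Q_le_N by (intro mult_le_mono) auto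
qed

end

section \<open>Assembly and constants\<close>

definition prep :: com where
  "prep = Seq bfs (Seq kahn build)"

lemma real_floor_log_le: "0 < x \<Longrightarrow> real (floor_log x) \<le> log 2 (real x)"
  by (simp add: floor_log_altdef)

lemma lg_ge: "1 \<le> lg x" "log 2 x \<le> lg x"
  by (simp_all add: lg_def)

context slp2d_machine
begin

lemma floor_log_cells_le: "real (floor_log cells) \<le> lg (real cells)"
proof -
  have "0 < cells" using area_pos [OF V.start] area_start by simp
  then show ?thesis using real_floor_log_le lg_ge(2) order_trans by blast
qed

lemma dims_pos: "0 < dim_row M" "0 < dim_col M"
  using nr_pos [OF V.start] nc_pos [OF V.start] by (simp_all add: nr_def nc_def expn_start)

text \<open>\<open>cells\<close> is at most the square of the larger dimension, so its logarithm is
  at most twice that of this dimension, and the iterated logarithms differ by a constant. The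
  potential contributes a factor 5, the chain steps a factor 11, and a round of the loop costs 125;
  \<open>125 * (55 + 1) + 10\<close> is below 8000.\<close>

lemma query_time:
  "real (Suc ((2 * floor_log cells + floor_log (2 * cells) + 1) * (3 * floor_log (Suc (floor_log cells)) + 2)) * 125 + 10)
    \<le> 8000 * lg (real cells) * lg (lg (real (max (dim_row M) (dim_col M))))"
proof -
  let ?m = "max (dim_row M) (dim_col M)"
  define L where "L = lg (real cells)"
  define l where "l = lg (real ?m)"
  define K where "K = lg l"
  have L: "1 \<le> L" and l: "1 \<le> l" and K: "1 \<le> K" by (simp_all add: L_def l_def K_def lg_ge)
  have c: "0 < cells" using dims_pos by (simp add: cells_def)
  have fL: "real (floor_log cells) \<le> L" unfolding L_def by (rule floor_log_cells_le)
  have m: "0 < ?m" using dims_pos by simp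
  have "cells \<le> ?m * ?m" unfolding cells_def by (intro mult_mono) auto
  then have "log 2 (real cells) \<le> log 2 (real ?m * real ?m)"
    using c m by (subst log_le_cancel_iff) (auto simp flip: of_nat_mult)
  also have "\<dots> = 2 * log 2 (real ?m)"
  proof -
    have "log 2 (x * x) = 2 * log 2 x" if "0 < x" for x :: real using that by (simp add: log_mult)
    then show ?thesis using m by (simp only: of_nat_0_less_iff)
  qed
  finally have "real (floor_log cells) \<le> 2 * l"
    using real_floor_log_le [OF c] lg_ge(2) [of "real ?m"] unfolding l_def by linarith
  then have "real (Suc (floor_log cells)) \<le> 4 * l" using l by simp
  then have "log 2 (real (Suc (floor_log cells))) \<le> log 2 (4 * l)" using l by (subst log_le_cancel_iff) auto
  also have "\<dots> = 2 + log 2 l"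
  proof -
    have "log 2 (4::real) = 2" using log_nat_power [of 2 2 2] by simp
    then show ?thesis using l by (simp add: log_mult)
  qed
  also have "\<dots> \<le> 3 * K" using lg_ge(2) [of l] K by (simp add: K_def)
  finally have "real (floor_log (Suc (floor_log cells))) \<le> 3 * K"
    using real_floor_log_le [of "Suc (floor_log cells)"] by simp
  then have r: "real (3 * floor_log (Suc (floor_log cells)) + 2) \<le> 11 * K" using K by simp
  have LK: "1 * 1 \<le> L * K" using L K by (intro mult_mono) auto
  have total: "real (Suc x * 125 + 10) \<le> 8000 * (L * K)" if "real x \<le> 55 * (L * K)" for x
    using that LK by simp
  have "real (2 * floor_log cells + floor_log (2 * cells) + 1) \<le> 5 * L" using fL L c by simp
  from mult_mono [OF this r] have
    "real ((2 * floor_log cells + floor_log (2 * cells) + 1) * (3 * floor_log (Suc (floor_log cells)) + 2)) \<le> 55 * (L * K)"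
    using L by (simp only: of_nat_mult of_nat_0_le_iff) (simp add: mult_ac)
  from total [OF this] show ?thesis by (simp add: L_def l_def K_def mult.assoc)
qed

lemma prep_correct:
  assumes \<Sigma>: "\<forall>a\<in>\<Sigma>. a < 2 ^ b"
  shows "reaches w prep (input_state G) (2200 * N) (\<lambda>s.
     space_bits (built_structure s) \<le> 16 * N * (floor_log cells + 6 + b) \<and>
     answers_access w query (built_structure s) M
       (8000 * lg (real cells) * lg (lg (real (max (dim_row M) (dim_col M))))))"
  unfolding prep_def
proof (rule reaches_seq [OF bfs_correct, where T' = "1950 * N"])
  fix s
  assume "bfs_post s"
  from kahn_correct [OF this]
  show "reaches w (Seq kahn build) s (1950 * N) (\<lambda>s.
     space_bits (built_structure s) \<le> 16 * N * (floor_log cells + 6 + b) \<and>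
     answers_access w query (built_structure s) M
       (8000 * lg (real cells) * lg (lg (real (max (dim_row M) (dim_col M))))))"
  proof (rule reaches_seq [where T' = "1600 * N"])
    fix s
    assume "\<exists>Q rho. ordered_slp2d \<Sigma> G M Q rho \<and> kahn_post Q rho s"
    then obtain Q rho where Q: "ordered_slp2d \<Sigma> G M Q rho" "kahn_post Q rho s" by blast
    interpret ordered_slp2d \<Sigma> G M Q rho by (rule Q)
    interpret slp2d_builder \<Sigma> G M w Q rho ..
    have T: "real (Suc query_bound * 125 + 10) \<le> 8000 * lg (real cells) * lg (lg (real (max (dim_row M) (dim_col M))))"
      using query_time by (simp only: query_bound_def run_bound_def)
    show "reaches w build s (1600 * N) (\<lambda>s.
     space_bits (built_structure s) \<le> 16 * N * (floor_log cells + 6 + b) \<and>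
     answers_access w query (built_structure s) M
       (8000 * lg (real cells) * lg (lg (real (max (dim_row M) (dim_col M))))))"
      by (rule reaches_mono [OF build [OF Q(2)] order_refl])
        (use space_structure [OF _ \<Sigma>] answers_query [OF _ T] in blast)
  qed simp
qed simp

end

lemma finite_nat_less_power: "finite S \<Longrightarrow> \<exists>b. \<forall>a\<in>S. a < 2 ^ b" for S :: "nat set"
proof -
  assume "finite S"
  then obtain n where "\<forall>a\<in>S. a \<le> n" using finite_nat_set_iff_bounded_le by auto
  then have "\<forall>a\<in>S. a < 2 ^ n" using less_exp order_le_less_trans by blast
  then show ?thesis ..
qed

lemma length_rules_le_gsize: "length (rules G) \<le> gsize G"
proof -
  have one: "1 \<le> rule_size r" for r by (cases r) auto
  have "length rs \<le> (\<Sum>r\<leftarrow>rs. rule_size r)" for rs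
  proof (induction rs)
    case (Cons r rs)
    then show ?case using one [of r] by simp
  qed simp
  then show ?thesis by (simp add: gsize_def)
qed

text \<open>The factor 64 costs 6 bits, which a factor 7 absorbs because \<open>lg\<close> is at
  least 1. The number 112 is \<open>16 * 7\<close>, the value of the theorem's \<open>d\<close> for
  \<open>b = 0\<close>.\<close>

lemma word_length_bound:
  assumes "112 \<le> d" "d * lg x \<le> real w" "0 < x"
  shows "64 * x \<le> 2 ^ w"
proof -
  have "7 * lg x \<le> d * lg x" using assms(1) lg_ge(1) [of x] by (intro mult_right_mono) auto
  then have "6 + log 2 x \<le> real w" using assms(2) lg_ge [of x] by linarith
  moreover have "log 2 (64 * x) = 6 + log 2 x"
  proof -
    have "log 2 (64::real) = 6" using log_nat_power [of 2 2 6] by simp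
    then show ?thesis using assms(3) by (simp add: log_mult)
  qed
  ultimately have "log 2 (64 * x) \<le> real w" by simp
  then have "64 * x \<le> 2 powr real w" using assms(3) by (subst (asm) log_le_iff) auto
  then show ?thesis by (simp add: powr_realpow)
qed

text \<open>The programs and the time constant are fixed before the alphabet. Only \<open>d\<close>
  depends on it, because the bits of a symbol widen the cells of the data structure.\<close>

theorem theorem2:
  shows "\<exists>(prep :: com) (query :: com) (c :: real).
    \<forall>\<Sigma> :: nat set. finite \<Sigma> \<longrightarrow> (\<exists>d :: real.
      \<forall>(m :: nat) (n :: nat) (M :: nat mat) (G :: grammar) (w :: nat).
        M \<in> carrier_mat m n \<longrightarrow> rlslp \<Sigma> G \<longrightarrow> generates G M \<longrightarrow>
        word_state w (input_state G) \<longrightarrow> d * lg (real (m * n * gsize G)) \<le> real w \<longrightarrow>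
        (\<exists>t s. exec w prep (input_state G) t s \<and>
           real t \<le> c * real (gsize G) \<and>
           real (space_bits (built_structure s)) \<le> d * real (gsize G) * lg (real (m * n)) \<and>
           answers_access w query (built_structure s) M
             (c * lg (real (m * n)) * lg (lg (real (max m n))))))"
proof (rule exI [of _ prep], rule exI [of _ query], rule exI [of _ 8000], intro allI impI)
  fix \<Sigma> :: "nat set"
  assume "finite \<Sigma>"
  then obtain b where b: "\<forall>a\<in>\<Sigma>. a < 2 ^ b" using finite_nat_less_power by blast
  \<comment> \<open>A record has 16 words of \<open>floor_log cells + 6 + b\<close> bits, and this
    width is at most \<open>(7 + b) * lg cells\<close> because \<open>lg\<close> is at least
    1.\<close>
  let ?d = "16 * (7 + real b)"
  show "\<exists>d :: real.
      \<forall>(m :: nat) (n :: nat) (M :: nat mat) (G :: grammar) (w :: nat).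
        M \<in> carrier_mat m n \<longrightarrow> rlslp \<Sigma> G \<longrightarrow> generates G M \<longrightarrow>
        word_state w (input_state G) \<longrightarrow> d * lg (real (m * n * gsize G)) \<le> real w \<longrightarrow>
        (\<exists>t s. exec w prep (input_state G) t s \<and>
           real t \<le> 8000 * real (gsize G) \<and>
           real (space_bits (built_structure s)) \<le> d * real (gsize G) * lg (real (m * n)) \<and>
           answers_access w query (built_structure s) M
             (8000 * lg (real (m * n)) * lg (lg (real (max m n)))))"
  proof (intro exI [of _ ?d] allI impI)
    fix m n :: nat and M :: "nat mat" and G :: grammar and w :: nat
    assume M: "M \<in> carrier_mat m n" and rl: "rlslp \<Sigma> G" and gen: "generates G M"
      and w: "?d * lg (real (m * n * gsize G)) \<le> real w"
    interpret slp2d \<Sigma> G M by unfold_locales (rule rl gen)+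
    let ?g = "gsize G"
    have cells: "cells = m * n" using M by (simp add: cells_def)
    have N: "N \<le> ?g" by (rule length_rules_le_gsize)
    have N0: "0 < N" using V_less [OF V.start] by linarith
    have c0: "0 < cells" using area_pos [OF V.start] area_start by simp
    have g0: "1 \<le> ?g" using N N0 by linarith
    then have "0 < m * n * ?g" using c0 by (simp add: cells)
    then have "0 < real (m * n * ?g)" by (simp only: of_nat_0_less_iff)
    from word_length_bound [OF _ w this] have "real (64 * (cells * ?g)) \<le> real (2 ^ w)"
      by (simp add: cells)
    then have W: "64 * (cells * ?g) \<le> 2 ^ w" by (simp only: of_nat_le_iff)
    \<comment> \<open>Both factors are positive, so the assumption on the logarithm of their product
      bounds each of them.\<close>
    have "1 * N \<le> cells * ?g" "cells * 1 \<le> cells * ?g" using N c0 g0 by (intro mult_le_mono; simp)+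
    then have "64 * N \<le> 2 ^ w" "64 * cells \<le> 2 ^ w" using W by linarith+
    then interpret slp2d_machine \<Sigma> G M w by unfold_locales
    from prep_correct [OF b] obtain t s where ts: "exec w prep (input_state G) t s" "t \<le> 2200 * N"
        "space_bits (built_structure s) \<le> 16 * N * (floor_log cells + 6 + b)"
        "answers_access w query (built_structure s) M
          (8000 * lg (real cells) * lg (lg (real (max (dim_row M) (dim_col M)))))"
      by (auto simp: reaches_def)
    have "real t \<le> 8000 * real ?g" using ts(2) N by linarith
    moreover have "real (space_bits (built_structure s)) \<le> ?d * real ?g * lg (real (m * n))"
    proof -
      have "real b * 1 \<le> real b * lg (real cells)" by (intro mult_left_mono lg_ge) simp
      then have f: "real (floor_log cells + 6 + b) \<le> (7 + real b) * lg (real cells)"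
        using floor_log_cells_le lg_ge(1) [of "real cells"] by (simp add: distrib_right)
      have "real (space_bits (built_structure s)) \<le> real (16 * N * (floor_log cells + 6 + b))"
        using ts(3) by (simp only: of_nat_le_iff)
      also have "\<dots> = 16 * real N * real (floor_log cells + 6 + b)" by simp
      also have "\<dots> \<le> 16 * real ?g * ((7 + real b) * lg (real cells))"
        using f N by (intro mult_mono) auto
      finally show ?thesis by (simp add: cells mult_ac)
    qed
    moreover have "dim_row M = m" "dim_col M = n" using M by auto
    ultimately show "\<exists>t s. exec w prep (input_state G) t s \<and> real t \<le> 8000 * real ?g \<and>
        real (space_bits (built_structure s)) \<le> ?d * real ?g * lg (real (m * n)) \<and>
        answers_access w query (built_structure s) M (8000 * lg (real (m * n)) * lg (lg (real (max m n))))"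
      using ts(1,4) by (auto simp: cells)
  qed
qed

end
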